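(* Let $r\in\mathbb{N}$ and $k\in\mathbb{Z}_+$ with $k\leqslant r-1$, and let $\mathscr{R}=\mathscr{O}$ or $\mathscr{R}=\mathscr{L}$. Then, for every $\delta>0$, there exists a unique $\lambda=\lambda(\delta)>0$ such that $\delta\lambda\,\|u_\lambda\|_2=\|u_\lambda^{(r)}\|_2$, and for this $\lambda$ \[ \Omega_{-1}(\delta)=\mathcal{E}_\delta\left(\mathscr{R};D^k_{-1};W^r_2\right)=\left\|u_\lambda^{(r)}\right\|_2\delta+\left\|u_\lambda\right\|_2 . \]
   Context: Let $\mathbb{I}=[-1,1]$, $L_2=L_2(\mathbb{I})$ (real-valued functions) with norm $\|f\|_2=\left(\int_{-1}^1|f(x)|^2\,dx\right)^{1/2}$. For $m\in\mathbb{N}$, $L_2^m$ is the space of functions $f:\mathbb{I}\to\mathbb{R}$ having absolutely continuous derivative $f^{(m-1)}$ and such that $f^{(m)}\in L_2$. Let $W^r_2=\{f\in L_2^r:\|f^{(r)}\|_2\leqslant 1\}$. For $\lambda\geqslant 0$ (with $r,k$ fixed), $u_\lambda\in L_2^{2r}$ denotes the unique solution of the boundary value problem \[ \begin{cases}(-1)^ru^{(2r)}(x)+\lambda u(x)=0,& x\in(-1,1),\\ u^{(s)}(-1)=(-1)^{k-1}\delta_{r-k-1,s},& s=0,1,\ldots,r-1,\\ u^{(s)}(1)=0,& s=0,1,\ldots,r-1,\end{cases} \] where $\delta_{i,j}$ is the Kronecker symbol. $D^k_{-1}$ is the functional $f\mapsto f^{(k)}(-1)$ (from $L_2$ to $\mathbb{R}$,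 with domain $L_2^r$). Its modulus of continuity on $W_2^r$ is \[ \Omega_{-1}(\delta)=\Omega(\delta;D^k_{-1};W^r_2)=\sup\{|f^{(k)}(-1)|: f\in W^r_2,\ \|f\|_2\leqslant\delta\}. \] Optimal recovery: $\mathscr{L}$ is the set of all linear maps $S:L_2\to\mathbb{R}$ and $\mathscr{O}$ is the set of all mappings $S:L_2\to\mathbb{R}$. For $\mathscr{R}\in\{\mathscr{L},\mathscr{O}\}$, \[ \mathcal{E}_\delta(\mathscr{R};D^k_{-1};W^r_2)=\inf_{S\in\mathscr{R}}\ \sup\{|f^{(k)}(-1)-Sg|: f\in W^r_2,\ g\in L_2,\ \|f-g\|_2\leqslant\delta\}. \] *)

theory Defs
  imports "HOL-Analysis.Analysis"
begin

text \<open>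
  A function on the interval \<open>\<II>\<close> is represented by a total function \<open>real \<Rightarrow> real\<close>; no notion below
  except the normalisation in \<open>bvp_sol\<close> looks at its values outside \<open>\<II>\<close>.
\<close>

abbreviation sym_interval :: "real set" (\<open>\<II>\<close>)
  where "\<II> \<equiv> {-1..1}"

definition L2 :: "(real \<Rightarrow> real) set" where
  "L2 = {f. f \<in> borel_measurable (lebesgue_on \<II>) \<and> integrable (lebesgue_on \<II>) (\<lambda>x. \<bar>f x\<bar>\<^sup>2)}"

definition norm2 :: "(real \<Rightarrow> real) \<Rightarrow> real" where
  "norm2 f = sqrt (integral\<^sup>L (lebesgue_on \<II>) (\<lambda>x. \<bar>f x\<bar>\<^sup>2))"

definition abs_continuous_on :: "real set \<Rightarrow> (real \<Rightarrow> real) \<Rightarrow> bool" where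
  "abs_continuous_on A f \<longleftrightarrow>
    (\<forall>\<epsilon>>0. \<exists>\<delta>>0. \<forall>P :: (real \<times> real) set.
       finite P \<and> (\<forall>(a, b)\<in>P. a < b \<and> {a..b} \<subseteq> A) \<and>
       disjoint_family_on (\<lambda>(a, b). {a<..<b}) P \<and> (\<Sum>(a, b)\<in>P. b - a) < \<delta>
       \<longrightarrow> (\<Sum>(a, b)\<in>P. \<bar>f b - f a\<bar>) < \<epsilon>)"

text \<open>
  \<open>nderiv n f\<close> is the derivative of order \<open>n\<close> relative to \<open>\<II>\<close>, hence one-sided at the end points.
  Where the derivative does not exist its value is arbitrary.
\<close>

definition nderiv :: "nat \<Rightarrow> (real \<Rightarrow> real) \<Rightarrow> real \<Rightarrow> real" where
  "nderiv n f = ((\<lambda>g x. vector_derivative g (at x within \<II>)) ^^ n) f"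

text \<open>
  For \<open>m \<ge> 1\<close>. The derivative of order \<open>m\<close> of a member exists almost everywhere on \<open>\<II>\<close>, so the
  arbitrary values of \<open>nderiv m f\<close> are confined to a null set.
\<close>

definition L2_sobolev :: "nat \<Rightarrow> (real \<Rightarrow> real) set" where
  "L2_sobolev m = {f.
     (\<forall>j<m - 1. \<forall>x\<in>\<II>. nderiv j f differentiable (at x within \<II>)) \<and>
     abs_continuous_on \<II> (nderiv (m - 1) f) \<and>
     nderiv m f \<in> L2}"

definition W2 :: "nat \<Rightarrow> (real \<Rightarrow> real) set" where
  "W2 r = {f \<in> L2_sobolev r. norm2 (nderiv r f) \<le> 1}"

definition is_bvp_sol :: "nat \<Rightarrow> nat \<Rightarrow> real \<Rightarrow> (real \<Rightarrow> real) \<Rightarrow> bool" where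
  "is_bvp_sol r k lam u \<longleftrightarrow>
     u \<in> L2_sobolev (2 * r) \<and>
     (\<forall>x\<in>{-1<..<1}. nderiv (2 * r - 1) u differentiable (at x within \<II>) \<and>
        (-1) ^ r * nderiv (2 * r) u x + lam * u x = 0) \<and>
     (\<forall>s<r. nderiv s u (-1) = (-1) powi (int k - 1) * (if s = r - k - 1 then 1 else 0)) \<and>
     (\<forall>s<r. nderiv s u 1 = 0)"

text \<open>
  The solution is unique only as a function on \<open>\<II>\<close>; the value 0 outside \<open>\<II>\<close> singles out one
  total function.
\<close>

definition bvp_sol :: "nat \<Rightarrow> nat \<Rightarrow> real \<Rightarrow> real \<Rightarrow> real" where
  "bvp_sol r k lam = (THE u. is_bvp_sol r k lam u \<and> (\<forall>x. x \<notin> \<II> \<longrightarrow> u x = 0))"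

text \<open>
  Suprema and infima are taken in \<^typ>\<open>ereal\<close>, since the error of a recovery map may be infinite.
\<close>

definition modulus :: "nat \<Rightarrow> nat \<Rightarrow> real \<Rightarrow> ereal" where
  "modulus r k \<delta> = (SUP f\<in>{f \<in> W2 r. norm2 f \<le> \<delta>}. ereal \<bar>nderiv k f (-1)\<bar>)"

text \<open>
  Mappings from the space of equivalence classes to the reals are mappings on representatives
  that respect equality almost everywhere; this has to be required of linear maps as well, as
  they need not be bounded.
\<close>

definition all_maps :: "((real \<Rightarrow> real) \<Rightarrow> real) set" where
  "all_maps = {S. \<forall>f\<in>L2. \<forall>g\<in>L2. (AE x in lebesgue_on \<II>. f x = g x) \<longrightarrow> S f = S g}"

definition linear_maps :: "((real \<Rightarrow> real) \<Rightarrow> real) set" where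
  "linear_maps = {S \<in> all_maps.
     (\<forall>f\<in>L2. \<forall>g\<in>L2. S (\<lambda>x. f x + g x) = S f + S g) \<and>
     (\<forall>c. \<forall>f\<in>L2. S (\<lambda>x. c * f x) = c * S f)}"

definition recovery_error :: "((real \<Rightarrow> real) \<Rightarrow> real) set \<Rightarrow> nat \<Rightarrow> nat \<Rightarrow> real \<Rightarrow> ereal" where
  "recovery_error R r k \<delta> =
     (INF S\<in>R. SUP (f, g)\<in>{(f, g). f \<in> W2 r \<and> g \<in> L2 \<and> norm2 (\<lambda>x. f x - g x) \<le> \<delta>}.
        ereal \<bar>nderiv k f (-1) - S g\<bar>)"

end

theory Submission
  imports Defs
begin

text \<open>
  Write \<open>u = u\<^sub>\<lambda>\<close>, \<open>g = u\<^sup>(\<^sup>r\<^sup>)\<close> and \<open>D f = f\<^sup>(\<^sup>k\<^sup>)(-1)\<close>. Integration by parts and the boundary values of \<open>u\<close> give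
  \<open>D f = (g, f) - (-1)\<^sup>r (u, f\<^sup>(\<^sup>r\<^sup>))\<close> on the Sobolev space. Hence the linear map \<open>S h = (g, h)\<close> has error at
  most \<open>\<delta> \<parallel>g\<parallel> + \<parallel>u\<parallel>\<close>, for every \<open>\<lambda>\<close>. Since \<open>g\<^sup>(\<^sup>r\<^sup>) = - (-1)\<^sup>r \<lambda> u\<close>, equality holds in both Cauchy-Schwarz
  inequalities at \<open>f = g / (\<lambda> \<parallel>u\<parallel>)\<close>, which is admissible exactly when \<open>\<delta> \<lambda> \<parallel>u\<parallel> = \<parallel>g\<parallel>\<close>; the pair \<open>f, - f\<close>
  with the observation 0 bounds the error of an arbitrary map from below.

  Applied to \<open>f = g\<^sub>\<lambda>\<close>, the formula says that \<open>(g\<^sub>\<mu>, g\<^sub>\<lambda>) + \<lambda> (u\<^sub>\<mu>, u\<^sub>\<lambda>)\<close> does not depend on \<open>\<mu>\<close>. So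
  \<open>E(\<lambda>) = \<parallel>g\<^sub>\<lambda>\<parallel>\<^sup>2 + \<lambda> \<parallel>u\<^sub>\<lambda>\<parallel>\<^sup>2\<close> is at most \<open>\<parallel>g\<^sub>\<mu>\<parallel>\<^sup>2 + \<lambda> \<parallel>u\<^sub>\<mu>\<parallel>\<^sup>2\<close> for all \<open>\<mu>\<close>, and the balanced \<open>\<lambda>\<close> is found as a
  minimum point of \<open>(\<delta>\<^sup>2 + 1/\<lambda>) E(\<lambda>)\<close>. This function tends to infinity at 0, because \<open>D\<close> does not vanish on the
  kernel of the \<open>r\<close>-th derivative, and at infinity, because \<open>D\<close> is unbounded in the norm of \<open>L\<^sub>2\<close>.
  For two balanced parameters all inequalities become equalities, which makes \<open>g\<^sub>\<lambda>\<close> and \<open>g\<^sub>\<mu>\<close> parallel,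
  and testing with \<open>(x + 1)\<^sup>k\<close> shows that they have the same norm.

  For the integration by parts one needs that an absolutely continuous function is differentiable almost
  everywhere and is the integral of its derivative. If the difference quotients at the points of a set of
  positive measure came both below \<open>p\<close> and above \<open>q > p\<close>, two nested Vitali coverings of this set would
  exhaust nearly the same measure with contradictory total increments, as absolute continuity makes the
  increment over the remaining gaps negligible.
\<close>

section \<open>Absolutely continuous functions\<close>

lemma division_of_interval_cases:
  fixes D :: "real set set"
  assumes "D division_of S" "K \<in> D"
  obtains a b where "K = {a..b}" "a \<le> b" "Inf K = a" "Sup K = b" "measure lborel K = b - a"
proof -
  obtain a b where "K = cbox a b" "K \<noteq> {}"
    using division_ofD(3,4)[OF assms(1) assms(2)] by metis
  then have "K = {a..b}" "a \<le> b" by auto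
  then show thesis using that by auto
qed

text \<open>Tagging every interval by its left end point reduces the telescoping of increments to
  the statement for tagged divisions.\<close>

lemma additive_division_1:
  fixes f :: "real \<Rightarrow> real"
  assumes "a \<le> b" "D division_of {a..b}"
  shows "(\<Sum>K\<in>D. f (Sup K) - f (Inf K)) = f b - f a"
proof -
  let ?p = "(\<lambda>K. (Inf K, K)) ` D"
  have "?p tagged_division_of {a..b}"
  proof (rule tagged_division_ofI)
    show "finite ?p" using division_ofD(1)[OF assms(2)] by simp
  next
    fix x K assume "(x, K) \<in> ?p"
    then have K: "K \<in> D" "x = Inf K" by auto
    obtain c d where cd: "K = {c..d}" "c \<le> d" "Inf K = c"
      using division_of_interval_cases[OF assms(2) K(1)] by metis
    show "x \<in> K" using cd K(2) by auto
    show "K \<subseteq> {a..b}" using division_ofD(2)[OF assms(2) K(1)] .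
    show "\<exists>a b. K = cbox a b" using division_ofD(4)[OF assms(2) K(1)] .
  next
    fix x1 K1 x2 K2 assume "(x1, K1) \<in> ?p" "(x2, K2) \<in> ?p" "(x1, K1) \<noteq> (x2, K2)"
    then show "interior K1 \<inter> interior K2 = {}"
      using division_ofD(5)[OF assms(2)] by auto
  next
    show "\<Union>{K. \<exists>x. (x, K) \<in> ?p} = {a..b}"
    proof -
      have "{K. \<exists>x. (x, K) \<in> ?p} = D" by auto
      then show ?thesis using division_ofD(6)[OF assms(2)] by simp
    qed
  qed
  then have "(\<Sum>(x,K)\<in>?p. f (Sup K) - f (Inf K)) = f b - f a"
    using additive_tagged_division_1[OF assms(1)] by blast
  then show ?thesis
    by (subst (asm) sum.reindex) (auto simp: inj_on_def)
qed

text \<open>Absolute continuity is defined through pairs of end points of nondegenerate intervals. A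
  division may also contain one-point intervals; these contribute nothing to either sum and are
  discarded.\<close>

lemma abs_continuous_on_division:
  assumes f: "abs_continuous_on A f" and e: "e > 0"
  obtains d where "d > 0"
    "\<And>D. \<lbrakk>D division_of \<Union>D; \<Union>D \<subseteq> A; (\<Sum>K\<in>D. measure lborel K) < d\<rbrakk>
       \<Longrightarrow> (\<Sum>K\<in>D. \<bar>f (Sup K) - f (Inf K)\<bar>) < e"
proof -
  obtain d where d: "d > 0" and P: "\<forall>P :: (real \<times> real) set.
       finite P \<and> (\<forall>(a, b)\<in>P. a < b \<and> {a..b} \<subseteq> A) \<and>
       disjoint_family_on (\<lambda>(a, b). {a<..<b}) P \<and> (\<Sum>(a, b)\<in>P. b - a) < d
       \<longrightarrow> (\<Sum>(a, b)\<in>P. \<bar>f b - f a\<bar>) < e"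
    using f[unfolded abs_continuous_on_def, THEN spec, THEN mp, OF e] by (elim exE conjE)
  show thesis
  proof (rule that[OF d])
    fix D assume D: "D division_of \<Union>D" "\<Union>D \<subseteq> A" "(\<Sum>K\<in>D. measure lborel K) < d"
    define D' where "D' = {K \<in> D. Inf K < Sup K}"
    define h where "h = (\<lambda>K :: real set. (Inf K, Sup K))"
    have fin: "finite D" "finite D'" using division_ofD(1)[OF D(1)] by (auto simp: D'_def)
    have eq: "K = {Inf K..Sup K}" "measure lborel K = Sup K - Inf K" "Inf K \<le> Sup K" if "K \<in> D" for K
      by (rule division_of_interval_cases[OF D(1) that]; simp)+
    have inj: "inj_on h D'"
    proof (rule inj_onI)
      fix K L assume "K \<in> D'" "L \<in> D'" "h K = h L"
      then have "K \<in> D" "L \<in> D" "Inf K = Inf L" "Sup K = Sup L" by (auto simp: h_def D'_def)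
      then show "K = L" using eq(1)[of K] eq(1)[of L] by presburger
    qed
    have s: "(\<Sum>K\<in>D. \<phi> K) = (\<Sum>K\<in>D'. \<phi> K)" if "\<And>K. K \<in> D \<Longrightarrow> Inf K = Sup K \<Longrightarrow> \<phi> K = 0" for \<phi> :: "real set \<Rightarrow> real"
    proof (rule sum.mono_neutral_right)
      show "\<forall>i\<in>D - D'. \<phi> i = 0"
      proof
        fix K assume "K \<in> D - D'"
        then have "K \<in> D" "\<not> Inf K < Sup K" by (auto simp: D'_def)
        then show "\<phi> K = 0" using eq(3)[of K] that[of K] by linarith
      qed
    qed (use fin in \<open>auto simp: D'_def\<close>)
    have "(\<Sum>(a, b)\<in>h ` D'. \<bar>f b - f a\<bar>) < e"
    proof (rule P[THEN spec, THEN mp], intro conjI)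
      show "finite (h ` D')" using fin by simp
      show "\<forall>(a, b)\<in>h ` D'. a < b \<and> {a..b} \<subseteq> A"
      proof
        fix z assume "z \<in> h ` D'"
        then obtain K where K: "K \<in> D" "z = (Inf K, Sup K)" "Inf K < Sup K" by (auto simp: h_def D'_def)
        have "{Inf K..Sup K} \<subseteq> A" using eq(1)[OF K(1)] K(1) D(2) by blast
        then show "case z of (a, b) \<Rightarrow> a < b \<and> {a..b} \<subseteq> A" using K by simp
      qed
      show "disjoint_family_on (\<lambda>(a, b). {a<..<b}) (h ` D')"
        unfolding disjoint_family_on_def
      proof (intro ballI impI)
        fix m n assume "m \<in> h ` D'" "n \<in> h ` D'" "m \<noteq> n"
        then obtain K L where KL: "K \<in> D" "L \<in> D" "m = h K" "n = h L" "K \<noteq> L"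
          by (auto simp: D'_def)
        have "interior K = {Inf K<..<Sup K}" "interior L = {Inf L<..<Sup L}"
          using eq(1)[OF KL(1)] eq(1)[OF KL(2)] interior_atLeastAtMost_real by metis+
        moreover have "interior K \<inter> interior L = {}"
          using division_ofD(5)[OF D(1) KL(1,2,5)] .
        ultimately show "(case m of (a, b) \<Rightarrow> {a<..<b}) \<inter> (case n of (a, b) \<Rightarrow> {a<..<b}) = {}"
          using KL(3,4) unfolding h_def by simp
      qed
      have "(\<Sum>(a, b)\<in>h ` D'. b - a) = (\<Sum>K\<in>D'. Sup K - Inf K)"
        by (subst sum.reindex[OF inj]) (simp add: h_def)
      also have "\<dots> = (\<Sum>K\<in>D. Sup K - Inf K)" using s[of "\<lambda>K. Sup K - Inf K"] by simp
      also have "\<dots> = (\<Sum>K\<in>D. measure lborel K)" by (rule sum.cong) (auto simp: eq(2))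
      finally show "(\<Sum>(a, b)\<in>h ` D'. b - a) < d" using D(3) by simp
    qed
    also have "(\<Sum>(a, b)\<in>h ` D'. \<bar>f b - f a\<bar>) = (\<Sum>K\<in>D'. \<bar>f (Sup K) - f (Inf K)\<bar>)"
      by (subst sum.reindex[OF inj]) (simp add: h_def)
    also have "\<dots> = (\<Sum>K\<in>D. \<bar>f (Sup K) - f (Inf K)\<bar>)" using s[of "\<lambda>K. \<bar>f (Sup K) - f (Inf K)\<bar>"] by simp
    finally show "(\<Sum>K\<in>D. \<bar>f (Sup K) - f (Inf K)\<bar>) < e" .
  qed
qed

lemma abs_continuous_on_imp_continuous_on:
  assumes "abs_continuous_on {l..u} f"
  shows "continuous_on {l..u} f"
  unfolding continuous_on_iff
proof (intro ballI allI impI)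
  fix x and e :: real assume x: "x \<in> {l..u}" and e: "e > 0"
  obtain d where d: "d > 0" and D: "\<And>D. \<lbrakk>D division_of \<Union>D; \<Union>D \<subseteq> {l..u}; (\<Sum>K\<in>D. measure lborel K) < d\<rbrakk>
       \<Longrightarrow> (\<Sum>K\<in>D. \<bar>f (Sup K) - f (Inf K)\<bar>) < e"
    using abs_continuous_on_division[OF assms e] by metis
  show "\<exists>d>0. \<forall>x'\<in>{l..u}. dist x' x < d \<longrightarrow> dist (f x') (f x) < e"
  proof (intro exI conjI ballI impI)
    fix y assume y: "y \<in> {l..u}" "dist y x < d"
    let ?K = "{min x y..max x y}"
    have ne: "min x y \<le> max x y" by auto
    have "{?K} division_of \<Union>{?K}"
      using division_of_self[of "min x y" "max x y"] ne by simp
    then have "(\<Sum>K\<in>{?K}. \<bar>f (Sup K) - f (Inf K)\<bar>) < e"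
      by (rule D) (use x y in \<open>auto simp: dist_real_def min_def max_def\<close>)
    then have "\<bar>f (max x y) - f (min x y)\<bar> < e" using ne by simp
    then show "dist (f y) (f x) < e" by (auto simp: dist_real_def min_def max_def split: if_splits)
  qed (rule d)
qed

section \<open>Finite Vitali coverings\<close>

text \<open>Closed intervals are balls around their midpoints, so the covering theorem for balls
  gives a countable disjoint family that covers \<open>E\<close> up to a null set. By continuity of
  measure from above, finitely many members leave out less than \<open>\<eta>\<close>. The intervals
  obtained are disjoint as closed sets, not only in their interiors.\<close>

lemma Vitali_covering_finite:
  fixes E U :: "real set"
  assumes E: "E \<in> lmeasurable" "E \<subseteq> U" and U: "open U" and \<eta>: "\<eta> > 0"
    and cov: "\<And>x d. x \<in> E \<Longrightarrow> d > 0 \<Longrightarrow> \<exists>a b. a < x \<and> x < b \<and> b - a < d \<and> P a b"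
  obtains D where "D division_of \<Union>D" "\<Union>D \<subseteq> U" "measure lebesgue (E - \<Union>D) < \<eta>"
    "\<And>K. K \<in> D \<Longrightarrow> \<exists>a b. K = {a..b} \<and> a < b \<and> P a b"
    "pairwise disjnt D"
proof -
  define I where "I = {(a, b). a < b \<and> P a b \<and> {a..b} \<subseteq> U}"
  define m where "m = (\<lambda>(a::real, b::real). (a + b) / 2)"
  define h where "h = (\<lambda>(a::real, b::real). (b - a) / 2)"
  define J where "J = (\<lambda>(a::real, b::real). {a..b})"
  have cb: "cball (m i) (h i) = J i" for i
  proof -
    obtain a b where i: "i = (a, b)" by fastforce
    have "(a + b) / 2 - (b - a) / 2 = a" "(a + b) / 2 + (b - a) / 2 = b" by (simp_all add: field_simps)
    then show ?thesis unfolding m_def h_def J_def i by (simp add: cball_eq_atLeastAtMost)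
  qed
  obtain C where C: "countable C" "C \<subseteq> I"
     "pairwise (\<lambda>i j. disjnt (cball (m i) (h i)) (cball (m j) (h j))) C"
     "negligible (E - (\<Union>i \<in> C. cball (m i) (h i)))"
  proof (rule Vitali_covering_theorem_cballs[of I h E m])
    show "0 < h i" if "i \<in> I" for i using that by (auto simp: I_def h_def)
    show "\<exists>i. i \<in> I \<and> x \<in> cball (m i) (h i) \<and> h i < d" if x: "x \<in> E" "0 < d" for x d
    proof -
      \<comment> \<open>Intervals around \<open>x\<close> shorter than \<open>e\<close> stay inside
        \<open>U\<close>, so arbitrarily short intervals around \<open>x\<close> survive the
        restriction to \<open>U\<close>.\<close>
      obtain e where e: "e > 0" "ball x e \<subseteq> U" using U E(2) x(1) openE by blast
      obtain a b where ab: "a < x" "x < b" "b - a < min d e" "P a b"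
        using cov[OF x(1), of "min d e"] x(2) e(1) by auto
      have "{a..b} \<subseteq> ball x e" using ab by (auto simp: dist_real_def)
      then have "(a, b) \<in> I" using ab e by (auto simp: I_def)
      moreover have "x \<in> cball (m (a, b)) (h (a, b))" using ab by (simp add: cb J_def)
      moreover have "h (a, b) < d" using ab by (simp add: h_def)
      ultimately show ?thesis by blast
    qed
  qed
  have dj: "disjnt (J i) (J j)" if "i \<in> C" "j \<in> C" "i \<noteq> j" for i j
    using C(3) that by (auto simp: pairwise_def cb)
  have neg: "negligible (E - (\<Union>i\<in>C. J i))" using C(4) by (simp add: cb)
  obtain F where F: "finite F" "F \<subseteq> C" "measure lebesgue (E - (\<Union>i\<in>F. J i)) < \<eta>"
  proof (cases "C = {}")
    case True
    then show thesis using that[of "{}"] neg \<eta> by (simp add: negligible_imp_measure0)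
  next
    case False
    \<comment> \<open>The empty family is treated apart because \<open>from_nat_into C\<close>
      enumerates \<open>C\<close> only if \<open>C\<close> is nonempty.\<close>
    let ?c = "from_nat_into C"
    have rc: "range ?c = C" using C(1) False by (simp add: range_from_nat_into)
    let ?A = "\<lambda>n. E - (\<Union>i<n. J (?c i))"
    have Jm: "J i \<in> sets lebesgue" for i by (cases i) (simp add: J_def)
    have "(\<lambda>n. measure lebesgue (?A n)) \<longlonglongrightarrow> measure lebesgue (\<Inter>n. ?A n)"
    proof (rule Lim_measure_decseq)
      have "?A n \<in> sets lebesgue" for n
        by (intro sets.Diff sets.finite_UN fmeasurableD[OF E(1)] Jm) simp
      then show "range ?A \<subseteq> sets lebesgue" by blast
      show "decseq ?A" unfolding decseq_def by (intro allI impI Diff_mono UN_mono) auto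
      show "emeasure lebesgue (?A i) \<noteq> \<infinity>" for i
      proof -
        have "E - (\<Union>i<i. J (?c i)) \<in> lmeasurable"
          by (intro fmeasurable_Diff[OF E(1)] sets.finite_UN Jm) simp
        then show ?thesis unfolding infinity_ennreal_def by (rule fmeasurableD2)
      qed
    qed
    moreover have "(\<Inter>n. ?A n) = E - (\<Union>i\<in>C. J i)"
    proof -
      have "(\<Inter>n. ?A n) = E - (\<Union>i. J (?c i))"
        by (rule equalityI) (blast intro: lessI, blast)
      also have "(\<Union>i. J (?c i)) = \<Union>(J ` range ?c)" by (simp only: image_image)
      also have "range ?c = C" by (rule rc)
      finally show ?thesis .
    qed
    ultimately have "(\<lambda>n. measure lebesgue (?A n)) \<longlonglongrightarrow> 0"
      using neg by (simp add: negligible_imp_measure0)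
    then have "\<forall>\<^sub>F n in sequentially. measure lebesgue (?A n) < \<eta>"
      by (rule order_tendstoD(2)) (rule \<eta>)
    then obtain n where n: "measure lebesgue (?A n) < \<eta>" by (auto simp: eventually_sequentially)
    show thesis
      by (rule that[of "?c ` {..<n}"]) (use n rc in auto)
  qed
  let ?D = "J ` F"
  have J: "\<exists>a b. K = {a..b} \<and> a < b \<and> P a b \<and> K \<subseteq> U" if "K \<in> ?D" for K
    using that F(2) C(2) by (auto simp: J_def I_def)
  have pd: "pairwise disjnt ?D"
  proof (rule pairwiseI)
    fix K L assume "K \<in> ?D" "L \<in> ?D" and KL: "K \<noteq> L"
    then obtain i j where ij: "i \<in> F" "j \<in> F" "K = J i" "L = J j" by (elim imageE)
    have "i \<noteq> j" using KL ij by blast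
    then show "disjnt K L" unfolding ij(3,4) using dj ij(1,2) F(2) by (intro dj) auto
  qed
  show thesis
  proof (rule that[of ?D])
    show "?D division_of \<Union>?D"
    proof (rule division_ofI)
      fix K1 K2 assume "K1 \<in> ?D" "K2 \<in> ?D" "K1 \<noteq> K2"
      then have "K1 \<inter> K2 = {}" by (intro pairwiseD[OF pd, unfolded disjnt_def])
      then show "interior K1 \<inter> interior K2 = {}" using interior_subset by blast
    next
      fix K assume "K \<in> ?D"
      then obtain a b where "K = {a..b}" "a < b" using J by blast
      then show "K \<noteq> {}" "\<exists>a b. K = cbox a b" by auto
    qed (use F in auto)
    show "\<Union>?D \<subseteq> U" using J by blast
    show "measure lebesgue (E - \<Union>?D) < \<eta>" using F(3) .
    show "\<exists>a b. K = {a..b} \<and> a < b \<and> P a b" if "K \<in> ?D" for K using J[OF that] by blast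
    show "pairwise disjnt ?D" by (rule pd)
  qed
qed

lemma division_of_disjoint_Union:
  fixes D :: "real set set"
  assumes "finite D" "\<And>K. K \<in> D \<Longrightarrow> q K division_of K" "pairwise disjnt D"
  shows "(\<Union>K\<in>D. q K) division_of \<Union>D"
proof (rule division_ofI)
  show "finite (\<Union>K\<in>D. q K)" using assms(1,2) division_ofD(1) by blast
next
  fix L assume "L \<in> (\<Union>K\<in>D. q K)"
  then obtain K where K: "K \<in> D" "L \<in> q K" by blast
  show "L \<subseteq> \<Union>D" using division_ofD(2)[OF assms(2)[OF K(1)] K(2)] K(1) by blast
  show "L \<noteq> {}" using division_ofD(3)[OF assms(2)[OF K(1)] K(2)] .
  show "\<exists>a b. L = cbox a b" using division_ofD(4)[OF assms(2)[OF K(1)] K(2)] .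
next
  fix L M assume "L \<in> (\<Union>K\<in>D. q K)" "M \<in> (\<Union>K\<in>D. q K)" and LM: "L \<noteq> M"
  then obtain K K' where K: "K \<in> D" "L \<in> q K" "K' \<in> D" "M \<in> q K'" by blast
  show "interior L \<inter> interior M = {}"
  proof (cases "K = K'")
    case True
    then show ?thesis using division_ofD(5)[OF assms(2)[OF K(1)]] K LM by blast
  next
    case False
    then have "K \<inter> K' = {}" using pairwiseD[OF assms(3) K(1,3)] by (simp add: disjnt_def)
    moreover have "L \<subseteq> K" "M \<subseteq> K'"
      using division_ofD(2)[OF assms(2)[OF K(1)] K(2)] division_ofD(2)[OF assms(2)[OF K(3)] K(4)] by auto
    ultimately have "L \<inter> M = {}" by blast
    then show ?thesis using interior_subset by blast
  qed
next
  show "\<Union>(\<Union>K\<in>D. q K) = \<Union>D"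
  proof -
    have "\<Union>(q K) = K" if "K \<in> D" for K using division_ofD(6)[OF assms(2)[OF that]] .
    then have "(\<Union>K\<in>D. \<Union>(q K)) = (\<Union>K\<in>D. K)" by (intro SUP_cong) auto
    moreover have "\<Union>(\<Union>K\<in>D. q K) = (\<Union>K\<in>D. \<Union>(q K))" by blast
    ultimately show ?thesis by simp
  qed
qed

text \<open>
  The intervals are required to contain the point in their interior: the set is then a countable
  intersection of open sets, and for continuous functions the one-sided quotients are still controlled.
\<close>

definition steep_points :: "real \<Rightarrow> real \<Rightarrow> (real \<Rightarrow> real \<Rightarrow> bool) \<Rightarrow> real set" where
  "steep_points l u P =
     {x. l < x \<and> x < u \<and> (\<forall>d>0. \<exists>a b. l \<le> a \<and> a < x \<and> x < b \<and> b \<le> u \<and> b - a < d \<and> P a b)}"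

lemma steep_points_lmeasurable: "steep_points l u P \<in> lmeasurable"
proof -
  define A where "A n = (\<Union>(a, b)\<in>{(a, b). l \<le> a \<and> b \<le> u \<and> b - a < 1 / real (Suc n) \<and> P a b}. {a<..<b})" for n
  have "steep_points l u P = {l<..<u} \<inter> (\<Inter>n. A n)" (is "?L = ?R")
  proof (intro equalityI subsetI)
    fix x assume x: "x \<in> ?L"
    have "x \<in> A n" for n
    proof -
      have "0 < 1 / real (Suc n)" by simp
      then obtain a b where "l \<le> a" "a < x" "x < b" "b \<le> u" "b - a < 1 / real (Suc n)" "P a b"
        using x unfolding steep_points_def by blast
      then have "(a, b) \<in> {(a, b). l \<le> a \<and> b \<le> u \<and> b - a < 1 / real (Suc n) \<and> P a b}" "x \<in> {a<..<b}" by auto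
      then show ?thesis unfolding A_def by blast
    qed
    then show "x \<in> ?R" using x by (simp add: steep_points_def)
  next
    fix x assume x: "x \<in> ?R"
    have "\<exists>a b. l \<le> a \<and> a < x \<and> x < b \<and> b \<le> u \<and> b - a < d \<and> P a b" if d: "d > 0" for d
    proof -
      obtain n where n: "1 / real (Suc n) < d" using nat_approx_posE[OF d] by blast
      have "x \<in> A n" using x by blast
      then obtain a b where "l \<le> a" "b \<le> u" "b - a < 1 / real (Suc n)" "P a b" "a < x" "x < b"
        unfolding A_def by auto
      then show ?thesis using n by (meson less_trans)
    qed
    then show "x \<in> ?L" using x by (simp add: steep_points_def)
  qed
  moreover have "open (A n)" for n unfolding A_def by (intro open_UN) auto
  then have "(\<Inter>n. A n) \<in> sets lebesgue" by (intro sets.countable_INT') auto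
  then have "{l<..<u} \<inter> (\<Inter>n. A n) \<in> lmeasurable"
    by (intro fmeasurable_Int_fmeasurable) auto
  ultimately show ?thesis by simp
qed

lemma measure_division_lebesgue:
  fixes D :: "real set set"
  assumes "D division_of S"
  shows "measure lebesgue S = (\<Sum>K\<in>D. measure lborel K)"
proof -
  have "measure lebesgue K = measure lborel K" if "K \<in> D" for K
    using division_of_interval_cases[OF assms that] by (metis borel_closed closed_real_atLeastAtMost measure_completion sets_lborel)
  then have "(\<Sum>K\<in>D. measure lborel K) = (\<Sum>K\<in>D. measure lebesgue K)" by (intro sum.cong) auto
  then show ?thesis using content_division[OF assms] by simp
qed

section \<open>Negligibility of the points with oscillating or unbounded difference
  quotients\<close>

text \<open>Intervals \<open>J\<close> of slope above \<open>q\<close> are chosen first, then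
  intervals \<open>I\<close> of slope below \<open>p\<close> inside them. The increment over
  \<open>J\<close> is at least \<open>q\<close> times the measure of \<open>J\<close>; computed
  along a division containing \<open>I\<close>, it is at most \<open>p\<close> times the measure of
  \<open>I\<close> plus the increment over the gaps. As \<open>I\<close> and \<open>J\<close> both
  have nearly the measure \<mu> of the set and absolute continuity controls the gaps, this
  contradicts \<open>p < q\<close>.\<close>

lemma negligible_oscillation_points:
  assumes f: "abs_continuous_on {l..u} f" and pq: "p < q"
  shows "negligible (steep_points l u (\<lambda>a b. f b - f a < p * (b - a)) \<inter>
                     steep_points l u (\<lambda>a b. q * (b - a) < f b - f a))" (is "negligible ?E")
proof (rule ccontr)
  assume nn: "\<not> negligible ?E"
  define E where "E = ?E"
  have Em: "E \<in> lmeasurable" unfolding E_def by (intro fmeasurable.Int steep_points_lmeasurable)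
  have Es: "E \<in> sets lebesgue" using Em by (rule fmeasurableD)
  define \<mu> where "\<mu> = measure lebesgue E"
  have \<mu>: "\<mu> > 0"
    using nn negligible_iff_measure0[OF Em] measure_nonneg[of lebesgue E] unfolding \<mu>_def E_def by linarith
  \<comment> \<open>The increment over the gaps and the term \<open>q * y\<close> cost at most
    \<open>e\<close> each. Together this is a quarter of \<open>(q - p) * \<mu>\<close>, while the
    measure of \<open>\<Union>I\<close> stays above \<open>\<mu> / 2\<close>.\<close>
  define e where "e = (q - p) * \<mu> / 8"
  have e: "e > 0" using pq \<mu> by (simp add: e_def)
  obtain d0 where d0: "d0 > 0" and AC: "\<And>D. \<lbrakk>D division_of \<Union>D; \<Union>D \<subseteq> {l..u}; (\<Sum>K\<in>D. measure lborel K) < d0\<rbrakk>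
       \<Longrightarrow> (\<Sum>K\<in>D. \<bar>f (Sup K) - f (Inf K)\<bar>) < e"
    using abs_continuous_on_division[OF f e] by blast
  \<comment> \<open>In this order the bounds make the gaps short enough for \<open>AC\<close>, bound
    \<open>\<bar>q\<bar>\<close> times their length by \<open>e\<close> (\<open>q\<close> may be
    negative), and keep the measure of \<open>\<Union>I\<close> above \<open>\<mu> / 2\<close>. The
    summand 1 covers \<open>q = 0\<close>.\<close>
  define \<eta> where "\<eta> = Min {d0, e / (1 + \<bar>q\<bar>), \<mu> / 2}"
  have \<eta>: "\<eta> > 0" "\<eta> \<le> d0" "\<eta> \<le> e / (1 + \<bar>q\<bar>)" "\<eta> \<le> \<mu> / 2"
  proof -
    show "\<eta> > 0" using d0 e \<mu> by (simp add: \<eta>_def)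
    show "\<eta> \<le> d0" "\<eta> \<le> e / (1 + \<bar>q\<bar>)" "\<eta> \<le> \<mu> / 2" unfolding \<eta>_def by (rule Min_le; simp)+
  qed
  have q\<eta>: "\<bar>q\<bar> * \<eta> \<le> e"
  proof -
    have "\<bar>q\<bar> * \<eta> \<le> (1 + \<bar>q\<bar>) * \<eta>" using \<eta>(1) by (simp add: algebra_simps)
    also have "\<dots> \<le> e" using \<eta>(3) by (simp add: field_simps)
    finally show ?thesis .
  qed
  obtain U0 where U0: "open U0" "E \<subseteq> U0" "U0 - E \<in> lmeasurable" "emeasure lebesgue (U0 - E) < ennreal (\<eta> / 4)"
    using sets_lebesgue_outer_open[OF Es, of "\<eta> / 4"] \<eta>(1) by auto
  define U where "U = U0 \<inter> {l<..<u}"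
  have U: "open U" "E \<subseteq> U" "U \<subseteq> {l..u}"
    using U0(1,2) by (auto simp: U_def E_def steep_points_def)
  have Um: "U \<in> lmeasurable" unfolding U_def
    by (rule fmeasurableI2[of "{l<..<u}"]) (use U0(1) in auto)
  have U0m: "measure lebesgue (U0 - E) < \<eta> / 4"
    using U0(3,4) \<eta>(1) by (simp add: emeasure_eq_measure2 ennreal_less_iff)
  have mU: "measure lebesgue U < \<mu> + \<eta> / 4"
  proof -
    have "measure lebesgue U = measure lebesgue E + measure lebesgue (U - E)"
      using measurable_measure_Diff[OF Um Es U(2)] by simp
    moreover have "measure lebesgue (U - E) \<le> measure lebesgue (U0 - E)"
      by (rule measure_mono_fmeasurable) (use U0(3) Um Em in \<open>auto simp: U_def fmeasurableD\<close>)
    ultimately show ?thesis using U0m by (simp add: \<mu>_def)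
  qed
  obtain J where J: "J division_of \<Union>J" "\<Union>J \<subseteq> U" "measure lebesgue (E - \<Union>J) < \<eta> / 4"
    "\<And>K. K \<in> J \<Longrightarrow> \<exists>a b. K = {a..b} \<and> a < b \<and> q * (b - a) < f b - f a" "pairwise disjnt J"
  proof (rule Vitali_covering_finite[of E U "\<eta> / 4" "\<lambda>a b. q * (b - a) < f b - f a"])
    show "\<exists>a b. a < x \<and> x < b \<and> b - a < d \<and> q * (b - a) < f b - f a" if "x \<in> E" "d > 0" for x d
      using that unfolding E_def steep_points_def by blast
  qed (use Em U \<eta>(1) in auto)
  \<comment> \<open>The second covering has to lie in an open set; passing to the interior removes
    only finitely many end points.\<close>
  define V where "V = interior (\<Union>J)"
  have finJ: "finite J" using J(1) by blast
  have Jm: "\<Union>J \<in> lmeasurable" using J(1) lmeasurable_division by blast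
  have Vm: "V \<in> lmeasurable" unfolding V_def
    by (rule fmeasurableI2[OF Jm interior_subset]) simp
  have negJ: "negligible (\<Union>J - V)"
  proof -
    have "\<Union>J - V \<subseteq> frontier (\<Union>J)" unfolding V_def frontier_def using closure_subset[of "\<Union>J"] by blast
    moreover have "negligible (frontier (\<Union>J))"
    proof -
      have "frontier (\<Union>J) \<subseteq> (\<Union>K\<in>J. frontier K)"
        using frontier_Union_subset[OF finJ] .
      moreover have "negligible (\<Union>K\<in>J. frontier K)"
      proof (rule negligible_Union)
        show "finite (frontier ` J)" using finJ by simp
        fix L assume "L \<in> frontier ` J"
        then obtain K where K: "K \<in> J" "L = frontier K" by (elim imageE)
        obtain a b where "K = cbox a b" using division_ofD(4)[OF J(1) K(1)] by (elim exE)
        with K(2) have "L = frontier (cbox a b)" by (simp only:)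
        then show "negligible L" using negligible_frontier_interval[of a b] by (simp only: frontier_cbox)
      qed
      ultimately show ?thesis by (rule negligible_subset[rotated])
    qed
    ultimately show ?thesis by (rule negligible_subset[rotated])
  qed
  have EV: "measure lebesgue (E - V) < \<eta> / 4"
  proof -
    have "measure lebesgue (E - V) \<le> measure lebesgue ((E - \<Union>J) \<union> (\<Union>J - V))"
    proof (rule measure_mono_fmeasurable)
      show "E - V \<subseteq> (E - \<Union>J) \<union> (\<Union>J - V)" by blast
    qed (intro fmeasurable.Un fmeasurable_Diff sets.Diff fmeasurableD Em Vm Jm)+
    also have "\<dots> = measure lebesgue (E - \<Union>J)"
      by (intro measure_Un_null_set sets.Diff Es fmeasurableD[OF Jm] negJ[unfolded negligible_iff_null_sets])
    finally show ?thesis using J(3) by simp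
  qed
  obtain I where I: "I division_of \<Union>I" "\<Union>I \<subseteq> V" "measure lebesgue ((E \<inter> V) - \<Union>I) < \<eta> / 4"
    "\<And>K. K \<in> I \<Longrightarrow> \<exists>a b. K = {a..b} \<and> a < b \<and> f b - f a < p * (b - a)" "pairwise disjnt I"
  proof (rule Vitali_covering_finite[of "E \<inter> V" V "\<eta> / 4" "\<lambda>a b. f b - f a < p * (b - a)"])
    show "\<exists>a b. a < x \<and> x < b \<and> b - a < d \<and> f b - f a < p * (b - a)" if "x \<in> E \<inter> V" "d > 0" for x d
      using that unfolding E_def steep_points_def by blast
    show "open V" by (simp add: V_def)
  qed (use Em Vm \<eta>(1) in \<open>auto intro: fmeasurable.Int\<close>)
  have finI: "finite I" using I(1) by blast
  have Im: "\<Union>I \<in> lmeasurable" using I(1) lmeasurable_division by blast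
  have mI: "measure lebesgue (\<Union>I) > \<mu> - \<eta> / 2"
  proof -
    have "\<mu> \<le> measure lebesgue ((E - V) \<union> ((E \<inter> V) - \<Union>I) \<union> \<Union>I)"
      unfolding \<mu>_def
      by (rule measure_mono_fmeasurable) (use Em Vm Im in \<open>auto simp: fmeasurableD intro!: fmeasurable.Un fmeasurable.Int fmeasurable_Diff\<close>)
    also have "\<dots> \<le> measure lebesgue ((E - V) \<union> ((E \<inter> V) - \<Union>I)) + measure lebesgue (\<Union>I)"
      by (rule measure_Un_le) (use Em Vm Im in \<open>auto simp: fmeasurableD\<close>)
    also have "measure lebesgue ((E - V) \<union> ((E \<inter> V) - \<Union>I)) \<le> measure lebesgue (E - V) + measure lebesgue ((E \<inter> V) - \<Union>I)"
      by (rule measure_Un_le) (use Em Vm Im in \<open>auto simp: fmeasurableD\<close>)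
    finally show ?thesis using EV I(3) by simp
  qed
  \<comment> \<open>Each interval of \<open>J\<close> gets a division containing all members of
    \<open>I\<close> inside it; the additional intervals are the gaps.\<close>
  have "\<exists>q. {L \<in> I. L \<subseteq> K} \<subseteq> q \<and> q division_of K" if K: "K \<in> J" for K
  proof -
    obtain a b where ab: "K = cbox a b" using J(1) K by blast
    have "{L \<in> I. L \<subseteq> K} division_of \<Union>{L \<in> I. L \<subseteq> K}"
      by (rule division_of_subset[OF I(1)]) auto
    moreover have "\<Union>{L \<in> I. L \<subseteq> K} \<subseteq> cbox a b" using ab by blast
    ultimately show ?thesis using partial_division_extend_interval ab by metis
  qed
  then obtain R where R: "\<And>K. K \<in> J \<Longrightarrow> {L \<in> I. L \<subseteq> K} \<subseteq> R K" "\<And>K. K \<in> J \<Longrightarrow> R K division_of K" by metis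
  let ?Q = "\<Union>K\<in>J. R K"
  have Q: "?Q division_of \<Union>J" using division_of_disjoint_Union[OF finJ R(2) J(5)] by blast
  have QU: "\<Union>?Q = \<Union>J" using division_ofD(6)[OF Q] .
  have finQ: "finite ?Q" using Q by blast
  \<comment> \<open>An interval of \<open>I\<close> is connected and is covered by the finitely many
    disjoint closed intervals of \<open>J\<close>, so it lies in a single one.\<close>
  have IQ: "I \<subseteq> ?Q"
  proof
    fix L assume L: "L \<in> I"
    obtain a b where ab: "L = {a..b}" "a < b" using I(4)[OF L] by blast
    have LJ: "L \<subseteq> \<Union>J" using L I(2) interior_subset unfolding V_def by blast
    have cl: "\<And>K. K \<in> J \<Longrightarrow> closed K" using J(4) closed_real_atLeastAtMost by metis
    have "a \<in> L" using ab by simp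
    then obtain K where K: "K \<in> J" "a \<in> K" using LJ by blast
    have "closed (\<Union>(J - {K}))" using finJ cl by (intro closed_Union) auto
    moreover have "K \<inter> \<Union>(J - {K}) = {}"
      using pairwiseD[OF J(5) K(1)] by (auto simp: disjnt_def)
    moreover have "connected L" using ab by simp
    ultimately have "K \<inter> L = {} \<or> \<Union>(J - {K}) \<inter> L = {}"
      using connected_closedD[of L K "\<Union>(J - {K})"] cl[OF K(1)] LJ by blast
    then have "L \<subseteq> K" using K(2) \<open>a \<in> L\<close> LJ by blast
    then show "L \<in> ?Q" using R(1)[OF K(1)] L K(1) by blast
  qed
  let ?F = "\<lambda>K. f (Sup K) - f (Inf K)"
  let ?G = "?Q - I"
  have sumsplit: "(\<Sum>K\<in>?Q. \<phi> K) = (\<Sum>K\<in>I. \<phi> K) + (\<Sum>K\<in>?G. \<phi> K)" for \<phi> :: "real set \<Rightarrow> real"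
    using sum.subset_diff[OF IQ finQ, of \<phi>] by simp
  have disjR: "R K \<inter> R K' = {}" if "K \<in> J" "K' \<in> J" "K \<noteq> K'" for K K'
  proof (rule ccontr)
    assume "R K \<inter> R K' \<noteq> {}"
    then obtain L where L: "L \<in> R K" "L \<in> R K'" by blast
    have "L \<subseteq> K" "L \<subseteq> K'" "L \<noteq> {}"
      using division_ofD(2,3)[OF R(2)[OF that(1)] L(1)] division_ofD(2)[OF R(2)[OF that(2)] L(2)] by auto
    then show False using pairwiseD[OF J(5) that] by (auto simp: disjnt_def)
  qed
  have sumQ: "(\<Sum>K\<in>?Q. ?F K) = (\<Sum>K\<in>J. ?F K)"
  proof -
    have "(\<Sum>K\<in>?Q. ?F K) = (\<Sum>K\<in>J. \<Sum>L\<in>R K. ?F L)"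
      by (rule sum.UNION_disjoint) (use finJ R(2) disjR in auto)
    also have "\<dots> = (\<Sum>K\<in>J. ?F K)"
    proof (rule sum.cong[OF refl])
      fix K assume K: "K \<in> J"
      then obtain a b where "K = {a..b}" "a < b" using J(4) by blast
      then show "(\<Sum>L\<in>R K. ?F L) = ?F K" using additive_division_1[of a b "R K" f] R(2)[OF K] by simp
    qed
    finally show ?thesis .
  qed
  have mJ: "measure lebesgue (\<Union>J) = (\<Sum>K\<in>I. measure lborel K) + (\<Sum>K\<in>?G. measure lborel K)"
    using measure_division_lebesgue[OF Q] sumsplit by simp
  have mI': "measure lebesgue (\<Union>I) = (\<Sum>K\<in>I. measure lborel K)" using measure_division_lebesgue[OF I(1)] .
  have mJ': "measure lebesgue (\<Union>J) = (\<Sum>K\<in>J. measure lborel K)" using measure_division_lebesgue[OF J(1)] .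
  have "measure lebesgue (\<Union>J) \<le> measure lebesgue U"
    by (rule measure_mono_fmeasurable) (use J(2) Jm Um in \<open>auto simp: fmeasurableD\<close>)
  then have mG: "(\<Sum>K\<in>?G. measure lborel K) < \<eta>" using mJ mI' mI mU \<eta>(1) by linarith
  have "?G division_of \<Union>?G" by (rule division_of_subset[OF Q[folded QU]]) auto
  moreover have "\<Union>?G \<subseteq> {l..u}"
  proof -
    have "\<Union>?G \<subseteq> \<Union>?Q" by blast
    also have "\<dots> \<subseteq> {l..u}" unfolding QU using J(2) U(3) by (rule subset_trans)
    finally show ?thesis .
  qed
  ultimately have G: "(\<Sum>K\<in>?G. \<bar>?F K\<bar>) < e" by (rule AC) (use mG \<eta>(2) in linarith)
  have "(\<Sum>K\<in>?G. ?F K) \<le> (\<Sum>K\<in>?G. \<bar>?F K\<bar>)" by (intro sum_mono) auto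
  with G have G': "(\<Sum>K\<in>?G. ?F K) < e" by linarith
  have FI: "(\<Sum>K\<in>I. ?F K) \<le> p * (\<Sum>K\<in>I. measure lborel K)"
    unfolding sum_distrib_left
  proof (rule sum_mono)
    fix K assume "K \<in> I"
    then obtain a b where "K = {a..b}" "a < b" "f b - f a < p * (b - a)" using I(4) by blast
    then show "?F K \<le> p * measure lborel K" by simp
  qed
  have FJ: "q * (\<Sum>K\<in>J. measure lborel K) \<le> (\<Sum>K\<in>J. ?F K)"
    unfolding sum_distrib_left
  proof (rule sum_mono)
    fix K assume "K \<in> J"
    then obtain a b where "K = {a..b}" "a < b" "q * (b - a) < f b - f a" using J(4) by blast
    then show "q * measure lborel K \<le> ?F K" by simp
  qed
  define x where "x = (\<Sum>K\<in>I. measure lborel K)"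
  define y where "y = (\<Sum>K\<in>?G. measure lborel K)"
  have y: "0 \<le> y" unfolding y_def by (intro sum_nonneg) auto
  have "q * (x + y) \<le> p * x + e"
  proof -
    have "q * (x + y) \<le> (\<Sum>K\<in>?Q. ?F K)"
      using FJ unfolding sumQ mJ'[symmetric] mJ x_def y_def .
    also have "\<dots> \<le> p * x + e"
      unfolding sumsplit[of ?F] x_def using FI G' by linarith
    finally show ?thesis .
  qed
  then have qp: "(q - p) * x \<le> e - q * y" by (simp add: algebra_simps)
  have "- (q * y) \<le> \<bar>q\<bar> * \<eta>"
  proof -
    have "- (q * y) \<le> \<bar>q\<bar> * y" using y by (metis abs_ge_minus_self abs_mult abs_of_nonneg)
    also have "\<dots> \<le> \<bar>q\<bar> * \<eta>" using mG unfolding y_def by (intro mult_left_mono) auto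
    finally show ?thesis .
  qed
  then have 1: "(q - p) * x \<le> 2 * e" using qp q\<eta> by linarith
  have "x > \<mu> / 2" using mI \<eta>(4) \<mu> unfolding mI'[folded x_def] by linarith
  moreover have "2 * e = (q - p) * (\<mu> / 4)" by (simp add: e_def)
  then have "(q - p) * x \<le> (q - p) * (\<mu> / 4)" using 1 by (simp only:)
  then have "x \<le> \<mu> / 4" using pq by (simp only: mult_le_cancel_left_pos diff_gt_0_iff_gt)
  ultimately show False using \<mu> by linarith
qed

text \<open>If a part of the set inside a window shorter than \<open>d0\<close> had positive
  measure, a Vitali covering of it by intervals of large slope would have total increment above 1,
  whereas absolute continuity keeps the increment below 1. Negligibility is a local property, so
  short windows suffice.\<close>

lemma negligible_infinite_slope_points:
  assumes f: "abs_continuous_on {l..u} f"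
  shows "negligible (\<Inter>n::nat. steep_points l u (\<lambda>a b. real n * (b - a) < \<bar>f b - f a\<bar>))" (is "negligible ?F")
proof -
  define F where "F = ?F"
  have Fm: "F \<in> lmeasurable"
  proof (rule fmeasurableI2)
    show "steep_points l u (\<lambda>a b. real 0 * (b - a) < \<bar>f b - f a\<bar>) \<in> lmeasurable" by (rule steep_points_lmeasurable)
    show "F \<subseteq> steep_points l u (\<lambda>a b. real 0 * (b - a) < \<bar>f b - f a\<bar>)" unfolding F_def by (rule INF_lower) simp
    show "F \<in> sets lebesgue" unfolding F_def
      by (intro sets.countable_INT') (auto intro: fmeasurableD[OF steep_points_lmeasurable])
  qed
  obtain d0 where d0: "d0 > 0" and AC: "\<And>D. \<lbrakk>D division_of \<Union>D; \<Union>D \<subseteq> {l..u}; (\<Sum>K\<in>D. measure lborel K) < d0\<rbrakk>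
       \<Longrightarrow> (\<Sum>K\<in>D. \<bar>f (Sup K) - f (Inf K)\<bar>) < 1"
    using abs_continuous_on_division[OF f zero_less_one] by blast
  have loc: "negligible (F \<inter> {c<..<d})" if cd: "c < d" "d - c < d0" for c d
  proof (rule ccontr)
    let ?E = "F \<inter> {c<..<d}"
    assume nn: "\<not> negligible ?E"
    have Em: "?E \<in> lmeasurable" by (intro fmeasurable.Int Fm) simp
    define \<mu> where "\<mu> = measure lebesgue ?E"
    have \<mu>: "\<mu> > 0"
      using nn negligible_iff_measure0[OF Em] measure_nonneg[of lebesgue ?E] unfolding \<mu>_def by linarith
    \<comment> \<open>The covering keeps measure above \<open>\<mu> / 2\<close>, so this
      \<open>n\<close> makes the total increment exceed 1.\<close>
    obtain n :: nat where n: "2 / \<mu> < real n" using reals_Archimedean2 by blast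
    define T where "T = {c<..<d} \<inter> {l<..<u}"
    have FT: "F \<subseteq> {l<..<u}" unfolding F_def steep_points_def by auto
    have Fn: "F \<subseteq> steep_points l u (\<lambda>a b. real n * (b - a) < \<bar>f b - f a\<bar>)" unfolding F_def by (rule INF_lower) simp
    obtain D where D: "D division_of \<Union>D" "\<Union>D \<subseteq> T" "measure lebesgue (?E - \<Union>D) < \<mu> / 2"
      "\<And>K. K \<in> D \<Longrightarrow> \<exists>a b. K = {a..b} \<and> a < b \<and> real n * (b - a) < \<bar>f b - f a\<bar>" "pairwise disjnt D"
    proof (rule Vitali_covering_finite[of ?E T "\<mu> / 2" "\<lambda>a b. real n * (b - a) < \<bar>f b - f a\<bar>"])
      show "?E \<in> lmeasurable" by (rule Em)
      show "?E \<subseteq> T" using FT unfolding T_def by blast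
      show "open T" unfolding T_def by (intro open_Int) auto
      show "\<mu> / 2 > 0" using \<mu> by simp
      show "\<exists>a b. a < x \<and> x < b \<and> b - a < e \<and> real n * (b - a) < \<bar>f b - f a\<bar>" if "x \<in> ?E" "e > 0" for x e
        using subsetD[OF Fn, of x] that unfolding steep_points_def by blast
    qed (rule that; auto)
    have Dm: "\<Union>D \<in> lmeasurable" using D(1) by (rule lmeasurable_division)
    have "\<mu> \<le> measure lebesgue ((?E - \<Union>D) \<union> \<Union>D)" unfolding \<mu>_def
    proof (rule measure_mono_fmeasurable)
      show "?E \<subseteq> (?E - \<Union>D) \<union> \<Union>D" by blast
    qed (intro fmeasurable.Un fmeasurable_Diff fmeasurableD Em Dm)+
    also have "\<dots> \<le> measure lebesgue (?E - \<Union>D) + measure lebesgue (\<Union>D)"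
      by (rule measure_Un_le) (intro sets.Diff fmeasurableD Em Dm)+
    finally have mD: "measure lebesgue (\<Union>D) > \<mu> / 2" using D(3) by linarith
    have mD': "measure lebesgue (\<Union>D) = (\<Sum>K\<in>D. measure lborel K)" using measure_division_lebesgue[OF D(1)] .
    have "measure lebesgue (\<Union>D) \<le> measure lebesgue {c<..<d}"
    proof (rule measure_mono_fmeasurable)
      show "\<Union>D \<subseteq> {c<..<d}" using D(2) unfolding T_def by blast
    qed (auto intro: fmeasurableD[OF Dm])
    also have "\<dots> = d - c" using cd by simp
    finally have "(\<Sum>K\<in>D. measure lborel K) < d0" using cd mD' by linarith
    moreover have "\<Union>D \<subseteq> {l..u}" using D(2) unfolding T_def by auto
    ultimately have "(\<Sum>K\<in>D. \<bar>f (Sup K) - f (Inf K)\<bar>) < 1" by (intro AC D(1))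
    moreover have "real n * (\<Sum>K\<in>D. measure lborel K) \<le> (\<Sum>K\<in>D. \<bar>f (Sup K) - f (Inf K)\<bar>)"
      unfolding sum_distrib_left
    proof (rule sum_mono)
      fix K assume "K \<in> D"
      then obtain a b where "K = {a..b}" "a < b" "real n * (b - a) < \<bar>f b - f a\<bar>" using D(4) by blast
      then show "real n * measure lborel K \<le> \<bar>f (Sup K) - f (Inf K)\<bar>" by simp
    qed
    moreover have "1 < real n * measure lebesgue (\<Union>D)"
    proof -
      have "1 < real n * (\<mu> / 2)" using n \<mu> by (simp add: field_simps)
      also have "\<dots> \<le> real n * measure lebesgue (\<Union>D)" using mD by (intro mult_left_mono) auto
      finally show ?thesis .
    qed
    ultimately show False unfolding mD' by linarith
  qed
  have "negligible F"
  proof (rule locally_negligible_alt[THEN iffD2], intro ballI exI conjI)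
    fix x assume x: "x \<in> F"
    show "openin (top_of_set F) (F \<inter> {x - d0 / 3<..<x + d0 / 3})" by (intro openin_open_Int) auto
    show "x \<in> F \<inter> {x - d0 / 3<..<x + d0 / 3}" using x d0 by simp
    show "negligible (F \<inter> {x - d0 / 3<..<x + d0 / 3})" by (rule loc) (use d0 in auto)
  qed
  then show ?thesis unfolding F_def .
qed

section \<open>Differentiability almost everywhere\<close>

lemma not_steep_pointsD:
  assumes "x \<notin> steep_points l u P" "l < x" "x < u"
  obtains d where "d > 0" "\<And>a b. l \<le> a \<Longrightarrow> a < x \<Longrightarrow> x < b \<Longrightarrow> b \<le> u \<Longrightarrow> b - a < d \<Longrightarrow> \<not> P a b"
proof -
  have "\<not> (\<forall>d>0. \<exists>a b. l \<le> a \<and> a < x \<and> x < b \<and> b \<le> u \<and> b - a < d \<and> P a b)"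
    using assms unfolding steep_points_def by simp
  then show thesis using that by blast
qed

text \<open>Letting one end point tend to \<open>x\<close> passes from intervals around \<open>x\<close> to one-sided quotients.\<close>

lemma straddling_limit:
  fixes f :: "real \<Rightarrow> real"
  assumes f: "isCont f x" and x: "l < x" "x < u" and d: "d > 0"
    and bd: "\<And>a b. l \<le> a \<Longrightarrow> a < x \<Longrightarrow> x < b \<Longrightarrow> b \<le> u \<Longrightarrow> b - a < d \<Longrightarrow> \<bar>f b - f a - L * (b - a)\<bar> \<le> e * (b - a)"
    and y: "l \<le> y" "y \<le> u" "\<bar>y - x\<bar> < d / 2"
  shows "\<bar>f y - f x - L * (y - x)\<bar> \<le> e * \<bar>y - x\<bar>"
proof -
  have fl: "(f \<longlongrightarrow> f x) (at_left x)" and fr: "(f \<longlongrightarrow> f x) (at_right x)"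
    using f unfolding isCont_def filterlim_at_split by blast+
  consider "y = x" | "x < y" | "y < x" by linarith
  then show ?thesis
  proof cases
    case 1 then show ?thesis by simp
  next
    case 2
    have "\<bar>f y - f x - L * (y - x)\<bar> \<le> e * (y - x)"
    proof (rule tendsto_le)
      show "((\<lambda>a. e * (y - a)) \<longlongrightarrow> e * (y - x)) (at_left x)" by (intro tendsto_intros)
      show "((\<lambda>a. \<bar>f y - f a - L * (y - a)\<bar>) \<longlongrightarrow> \<bar>f y - f x - L * (y - x)\<bar>) (at_left x)"
        by (intro tendsto_intros fl)
      have "max l (x - d / 2) < x" using x d by simp
      then have "\<forall>\<^sub>F a in at_left x. a \<in> {max l (x - d / 2)<..<x}" by (rule eventually_at_leftI[rotated]) simp
      then show "\<forall>\<^sub>F a in at_left x. \<bar>f y - f a - L * (y - a)\<bar> \<le> e * (y - a)"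
      proof eventually_elim
        case (elim a)
        show ?case by (rule bd) (use elim 2 y in auto)
      qed
    qed simp
    then show ?thesis using 2 by simp
  next
    case 3
    have "\<bar>f x - f y - L * (x - y)\<bar> \<le> e * (x - y)"
    proof (rule tendsto_le)
      show "((\<lambda>b. e * (b - y)) \<longlongrightarrow> e * (x - y)) (at_right x)" by (intro tendsto_intros)
      show "((\<lambda>b. \<bar>f b - f y - L * (b - y)\<bar>) \<longlongrightarrow> \<bar>f x - f y - L * (x - y)\<bar>) (at_right x)"
        by (intro tendsto_intros fr)
      have "x < min u (x + d / 2)" using x d by simp
      then have "\<forall>\<^sub>F b in at_right x. b \<in> {x<..<min u (x + d / 2)}" by (rule eventually_at_rightI[rotated]) simp
      then show "\<forall>\<^sub>F b in at_right x. \<bar>f b - f y - L * (b - y)\<bar> \<le> e * (b - y)"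
      proof eventually_elim
        case (elim b)
        show ?case by (rule bd) (use elim 3 y in auto)
      qed
    qed simp
    then show ?thesis using 3 by (simp add: abs_minus_commute algebra_simps)
  qed
qed

text \<open>The derivative is the supremum \<open>L\<close> of the lower bounds for the slopes over
  short intervals around \<open>x\<close>. A rational slope \<open>p\<close> slightly above
  \<open>L\<close> is undercut by arbitrarily short intervals, so by \<open>osc\<close> slopes above
  a further rational \<open>q\<close> near \<open>L\<close> do not occur on short intervals.\<close>

lemma differentiable_off_steep_points:
  fixes f :: "real \<Rightarrow> real"
  assumes f: "isCont f x" and x: "l < x" "x < u"
    and fin: "x \<notin> steep_points l u (\<lambda>a b. real n * (b - a) < \<bar>f b - f a\<bar>)"
    and osc: "\<And>p q. p \<in> \<rat> \<Longrightarrow> q \<in> \<rat> \<Longrightarrow> p < q \<Longrightarrow>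
      x \<notin> steep_points l u (\<lambda>a b. f b - f a < p * (b - a)) \<inter> steep_points l u (\<lambda>a b. q * (b - a) < f b - f a)"
  shows "\<exists>L. (f has_vector_derivative L) (at x)"
proof -
  obtain d0 where d0: "d0 > 0" and bd: "\<And>a b. l \<le> a \<Longrightarrow> a < x \<Longrightarrow> x < b \<Longrightarrow> b \<le> u \<Longrightarrow> b - a < d0 \<Longrightarrow> \<not> real n * (b - a) < \<bar>f b - f a\<bar>"
    using not_steep_pointsD[OF fin x] by blast
  define S where "S = {p. \<exists>d>0. \<forall>a b. l \<le> a \<and> a < x \<and> x < b \<and> b \<le> u \<and> b - a < d \<longrightarrow> p * (b - a) \<le> f b - f a}"
  have "- real n \<in> S"
    unfolding S_def
  proof (intro CollectI exI conjI allI impI)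
    show "d0 > 0" by (rule d0)
    fix a b assume "l \<le> a \<and> a < x \<and> x < b \<and> b \<le> u \<and> b - a < d0"
    then have "\<not> real n * (b - a) < \<bar>f b - f a\<bar>" by (elim conjE) (rule bd)
    then have "- (real n * (b - a)) \<le> f b - f a" by linarith
    then show "- real n * (b - a) \<le> f b - f a" by (simp only: mult_minus_left)
  qed
  then have ne: "S \<noteq> {}" by blast
  have ub: "p \<le> real n" if pS: "p \<in> S" for p
  proof -
    obtain d where d: "d > 0" "\<forall>a b. l \<le> a \<and> a < x \<and> x < b \<and> b \<le> u \<and> b - a < d \<longrightarrow> p * (b - a) \<le> f b - f a"
      using pS unfolding S_def by (elim CollectE exE conjE)
    \<comment> \<open>A symmetric interval short enough for both bounds and contained in
      \<open>{l..u}\<close> allows \<open>p\<close> and \<open>n\<close> to be compared.\<close>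
    define h where "h = Min {d / 3, d0 / 3, x - l, u - x}"
    have h: "h > 0" using d d0 x by (simp add: h_def)
    have h': "h \<le> d / 3" "h \<le> d0 / 3" "h \<le> x - l" "h \<le> u - x" unfolding h_def by (rule Min_le; simp)+
    have hh: "(x + h) - (x - h) = 2 * h" by simp
    have xh: "l \<le> x - h" "x - h < x" "x < x + h" "x + h \<le> u" using h h' by auto
    have "p * ((x + h) - (x - h)) \<le> f (x + h) - f (x - h)"
      by (rule d(2)[rule_format]) (use xh h h' d(1) in linarith)
    also have "\<dots> \<le> real n * ((x + h) - (x - h))"
    proof -
      have "\<not> real n * ((x + h) - (x - h)) < \<bar>f (x + h) - f (x - h)\<bar>"
        by (rule bd[OF xh]) (use h h' d0 in linarith)
      then show ?thesis by linarith
    qed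
    finally have "p * (2 * h) \<le> real n * (2 * h)" unfolding hh .
    then show ?thesis using h by simp
  qed
  have bdd: "bdd_above S" by (rule bdd_aboveI[OF ub])
  define L where "L = Sup S"
  have key: "\<exists>d>0. \<forall>a b. l \<le> a \<and> a < x \<and> x < b \<and> b \<le> u \<and> b - a < d \<longrightarrow> \<bar>f b - f a - L * (b - a)\<bar> \<le> e * (b - a)"
    if e: "e > 0" for e
  proof -
    have "L - e < Sup S" using e by (simp add: L_def)
    then obtain p1 where p1: "p1 \<in> S" "L - e < p1" using less_cSup_iff[OF ne bdd] by blast
    obtain d1 where d1: "d1 > 0" "\<forall>a b. l \<le> a \<and> a < x \<and> x < b \<and> b \<le> u \<and> b - a < d1 \<longrightarrow> p1 * (b - a) \<le> f b - f a"
      using p1(1) unfolding S_def by (elim CollectE exE conjE)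
    \<comment> \<open>Two rationals, because \<open>osc\<close> needs a gap: \<open>p\<close> lies
      above the supremum, and \<open>q > p\<close> is still below \<open>L + e\<close>.\<close>
    obtain p where p: "p \<in> \<rat>" "L < p" "p < L + e / 2" using Rats_dense_in_real[of L "L + e / 2"] e by auto
    obtain q where q: "q \<in> \<rat>" "L + e / 2 < q" "q < L + e" using Rats_dense_in_real[of "L + e / 2" "L + e"] e by auto
    have "p \<notin> S"
    proof
      assume "p \<in> S"
      then have "p \<le> L" unfolding L_def by (rule cSup_upper[OF _ bdd])
      then show False using p(2) by simp
    qed
    have "x \<in> steep_points l u (\<lambda>a b. f b - f a < p * (b - a))"
    proof (rule ccontr)
      assume "x \<notin> steep_points l u (\<lambda>a b. f b - f a < p * (b - a))"
      then obtain d where d: "d > 0" "\<And>a b. l \<le> a \<Longrightarrow> a < x \<Longrightarrow> x < b \<Longrightarrow> b \<le> u \<Longrightarrow> b - a < d \<Longrightarrow> \<not> f b - f a < p * (b - a)"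
        using not_steep_pointsD[OF _ x] by blast
      have "p \<in> S" unfolding S_def
      proof (intro CollectI exI conjI allI impI)
        show "d > 0" by (rule d)
        fix a b assume "l \<le> a \<and> a < x \<and> x < b \<and> b \<le> u \<and> b - a < d"
        then show "p * (b - a) \<le> f b - f a" using d(2)[of a b] by auto
      qed
      with \<open>p \<notin> S\<close> show False by blast
    qed
    then have "x \<notin> steep_points l u (\<lambda>a b. q * (b - a) < f b - f a)" using osc[OF p(1) q(1)] p q by auto
    then obtain d2 where d2: "d2 > 0" "\<And>a b. l \<le> a \<Longrightarrow> a < x \<Longrightarrow> x < b \<Longrightarrow> b \<le> u \<Longrightarrow> b - a < d2 \<Longrightarrow> \<not> q * (b - a) < f b - f a"
      using not_steep_pointsD[OF _ x] by blast
    show ?thesis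
    proof (intro exI conjI allI impI)
      show "min d1 d2 > 0" using d1 d2 by simp
      fix a b assume ab: "l \<le> a \<and> a < x \<and> x < b \<and> b \<le> u \<and> b - a < min d1 d2"
      have 1: "p1 * (b - a) \<le> f b - f a" using d1(2) ab by simp
      have 2: "f b - f a \<le> q * (b - a)" using d2(2)[of a b] ab by simp
      have "(L - e) * (b - a) \<le> p1 * (b - a)" using p1 ab by (intro mult_right_mono) auto
      moreover have "q * (b - a) \<le> (L + e) * (b - a)" using q ab by (intro mult_right_mono) auto
      ultimately show "\<bar>f b - f a - L * (b - a)\<bar> \<le> e * (b - a)" using 1 2 by (simp add: abs_le_iff algebra_simps)
    qed
  qed
  have "(f has_derivative (\<lambda>h. h *\<^sub>R L)) (at x)"
    unfolding has_derivative_at_alt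
  proof (intro conjI allI impI)
    show "bounded_linear (\<lambda>h. h *\<^sub>R L)" by (rule bounded_linear_scaleR_left)
    fix e :: real assume e: "e > 0"
    obtain d where d: "d > 0" "\<forall>a b. l \<le> a \<and> a < x \<and> x < b \<and> b \<le> u \<and> b - a < d \<longrightarrow> \<bar>f b - f a - L * (b - a)\<bar> \<le> e * (b - a)"
      using key[OF e] by (elim exE conjE)
    show "\<exists>d>0. \<forall>y. norm (y - x) < d \<longrightarrow> norm (f y - f x - (y - x) *\<^sub>R L) \<le> e * norm (y - x)"
    proof (intro exI conjI allI impI)
      show "Min {d / 2, x - l, u - x} > 0" using d x by simp
      fix y assume "norm (y - x) < Min {d / 2, x - l, u - x}"
      then have y: "\<bar>y - x\<bar> < d / 2" "\<bar>y - x\<bar> < x - l" "\<bar>y - x\<bar> < u - x" by auto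
      have "\<bar>f y - f x - L * (y - x)\<bar> \<le> e * \<bar>y - x\<bar>"
        by (rule straddling_limit[OF f x d(1)]) (use d(2) y in auto)
      then show "norm (f y - f x - (y - x) *\<^sub>R L) \<le> e * norm (y - x)" by (simp add: mult.commute)
    qed
  qed
  then show ?thesis unfolding has_vector_derivative_def by blast
qed

text \<open>Pairs of rational slopes suffice, so the exceptional set is a countable union of null
  sets. The end points are added to it since the derivative is two-sided.\<close>

theorem abs_continuous_on_imp_differentiable_ae:
  assumes f: "abs_continuous_on {l..u} f"
  obtains N where "negligible N" "\<And>x. x \<in> {l..u} - N \<Longrightarrow> \<exists>L. (f has_vector_derivative L) (at x)"
proof -
  define osc where "osc = (\<lambda>(p, q). if p < q then steep_points l u (\<lambda>a b. f b - f a < p * (b - a)) \<inter> steep_points l u (\<lambda>a b. q * (b - a) < f b - f a) else {})"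
  define F where "F = (\<Inter>n::nat. steep_points l u (\<lambda>a b. real n * (b - a) < \<bar>f b - f a\<bar>))"
  define N where "N = \<Union>(osc ` (\<rat> \<times> \<rat>)) \<union> F \<union> {l, u}"
  have "negligible (osc z)" for z
    using negligible_oscillation_points[OF f] unfolding osc_def by (cases z) simp
  then have "negligible (\<Union>(osc ` (\<rat> \<times> \<rat>)))"
    by (intro negligible_countable_Union countable_image countable_SIGMA countable_rat) auto
  moreover have "negligible F" unfolding F_def by (rule negligible_infinite_slope_points[OF f])
  ultimately have N: "negligible N" unfolding N_def by (intro negligible_Un) auto
  have D: "\<exists>L. (f has_vector_derivative L) (at x)" if x: "x \<in> {l..u} - N" for x
  proof -
    have lx: "l < x" "x < u" using x unfolding N_def by auto
    have "continuous_on {l<..<u} f"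
      using abs_continuous_on_imp_continuous_on[OF f] by (rule continuous_on_subset) auto
    then have c: "isCont f x" using lx by (simp add: continuous_on_eq_continuous_at)
    have "x \<notin> F" using x unfolding N_def by blast
    then obtain n :: nat where n: "x \<notin> steep_points l u (\<lambda>a b. real n * (b - a) < \<bar>f b - f a\<bar>)" unfolding F_def by blast
    show ?thesis
    proof (rule differentiable_off_steep_points[OF c lx n])
      fix p q :: real assume pq: "p \<in> \<rat>" "q \<in> \<rat>" "p < q"
      have "(p, q) \<in> \<rat> \<times> \<rat>" using pq by simp
      then have "osc (p, q) \<subseteq> N" unfolding N_def by (intro le_supI1 UN_upper)
      then have "x \<notin> osc (p, q)" using x by (meson DiffE subsetD)
      then show "x \<notin> steep_points l u (\<lambda>a b. f b - f a < p * (b - a)) \<inter> steep_points l u (\<lambda>a b. q * (b - a) < f b - f a)"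
        using pq(3) by (simp add: osc_def)
    qed
  qed
  show thesis by (rule that[OF N D])
qed

section \<open>The fundamental theorem of calculus for absolutely continuous functions\<close>

text \<open>The gauge treats tags inside and outside \<open>N\<close> separately. Around a tag in
  \<open>N\<close> it stays in an open set \<open>U\<close> of small measure, where absolute
  continuity bounds the total increment; elsewhere differentiability makes the increment nearly
  \<open>h x\<close> times the length.\<close>

theorem fundamental_theorem_of_calculus_abs_continuous:
  fixes f h :: "real \<Rightarrow> real"
  assumes ab: "a \<le> b" and f: "abs_continuous_on {a..b} f" and N: "negligible N"
    and h: "\<And>x. x \<in> {a..b} - N \<Longrightarrow> (f has_vector_derivative h x) (at x within {a..b})"
  shows "(h has_integral (f b - f a)) {a..b}"
proof -
  \<comment> \<open>On \<open>N\<close> nothing is known about \<open>h\<close>; the value 0 leaves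
    only the increments of \<open>f\<close> to be estimated there.\<close>
  define g where "g x = (if x \<in> N then 0 else h x)" for x
  have "(g has_integral (f b - f a)) (cbox a b)"
    unfolding has_integral
  proof (intro allI impI)
    fix e :: real assume e: "e > 0"
    \<comment> \<open>The summand 1 keeps the denominator positive when
      \<open>a = b\<close>.\<close>
    define e' where "e' = e / (2 * (b - a + 1))"
    have e': "e' > 0" using e ab by (simp add: e'_def)
    have e'ab: "e' * (b - a) < e / 2"
      using e ab by (simp add: e'_def field_simps)
    have "e / 2 > 0" using e by simp
    then obtain d0 where d0: "d0 > 0" and AC: "\<And>D. \<lbrakk>D division_of \<Union>D; \<Union>D \<subseteq> {a..b}; (\<Sum>K\<in>D. measure lborel K) < d0\<rbrakk>
       \<Longrightarrow> (\<Sum>K\<in>D. \<bar>f (Sup K) - f (Inf K)\<bar>) < e / 2"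
      using abs_continuous_on_division[OF f] by blast
    have Nm: "N \<in> sets lebesgue" using negligible_imp_sets[OF N] .
    obtain U where U: "open U" "N \<subseteq> U" "U - N \<in> lmeasurable" "emeasure lebesgue (U - N) < ennreal d0"
      using sets_lebesgue_outer_open[OF Nm d0] by blast
    have mU: "measure lebesgue (U - N) < d0"
      using U(3,4) d0 by (simp add: emeasure_eq_measure2 ennreal_less_iff)
    have "\<exists>d>0. (x \<in> N \<longrightarrow> ball x d \<subseteq> U) \<and>
        (x \<in> {a..b} - N \<longrightarrow> (\<forall>y\<in>{a..b}. \<bar>y - x\<bar> < d \<longrightarrow> \<bar>f y - f x - (y - x) * h x\<bar> \<le> e' * \<bar>y - x\<bar>))" for x
    proof (cases "x \<in> N")
      case True
      then show ?thesis using U(1,2) openE by blast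
    next
      case False
      show ?thesis
      proof (cases "x \<in> {a..b}")
        case True
        then have "(f has_derivative (\<lambda>y. y *\<^sub>R h x)) (at x within {a..b})"
          using h[of x] False unfolding has_vector_derivative_def by simp
        then obtain d where "d > 0" "\<forall>y\<in>{a..b}. norm (y - x) < d \<longrightarrow> norm (f y - f x - (y - x) *\<^sub>R h x) \<le> e' * norm (y - x)"
          using e' unfolding has_derivative_within_alt by blast
        then show ?thesis using False by (intro exI[of _ d]) simp
      next
        case False2: False
        then show ?thesis using False by (intro exI[of _ 1] conjI impI) auto
      qed
    qed
    then obtain \<rho> where \<rho>: "\<And>x. \<rho> x > 0" "\<And>x. x \<in> N \<Longrightarrow> ball x (\<rho> x) \<subseteq> U"
      "\<And>x y. x \<in> {a..b} - N \<Longrightarrow> y \<in> {a..b} \<Longrightarrow> \<bar>y - x\<bar> < \<rho> x \<Longrightarrow> \<bar>f y - f x - (y - x) * h x\<bar> \<le> e' * \<bar>y - x\<bar>"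
      by metis
    show "\<exists>\<gamma>. gauge \<gamma> \<and> (\<forall>\<D>. \<D> tagged_division_of cbox a b \<and> \<gamma> fine \<D> \<longrightarrow>
            norm ((\<Sum>(x, K)\<in>\<D>. measure lborel K *\<^sub>R g x) - (f b - f a)) < e)"
    proof (intro exI conjI allI impI)
      show "gauge (\<lambda>x. ball x (\<rho> x))" using \<rho>(1) by (intro gauge_ball_dependent) simp
      fix p assume p: "p tagged_division_of cbox a b \<and> (\<lambda>x. ball x (\<rho> x)) fine p"
      then have pt: "p tagged_division_of {a..b}" and pf: "(\<lambda>x. ball x (\<rho> x)) fine p" by auto
      note pD = tagged_division_ofD[OF pt]
      let ?F = "\<lambda>K. f (Sup K) - f (Inf K)"
      define q where "q = {(x, K) \<in> p. x \<in> N}"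
      have qp: "q \<subseteq> p" unfolding q_def by blast
      have "q tagged_partial_division_of {a..b}"
        using pt qp unfolding tagged_division_of_def by (metis tagged_partial_division_subset)
      then have qt: "q tagged_division_of \<Union>(snd ` q)" and qd: "snd ` q division_of \<Union>(snd ` q)"
        using tagged_partial_division_of_Union_self partial_division_of_tagged_division by auto
      have finp: "finite p" using pD(1) .
      have K: "\<exists>c d. K = {c..d} \<and> c \<le> x \<and> x \<le> d" if xK: "(x, K) \<in> p" for x K
      proof -
        obtain c d where "K = cbox c d" using pD(4)[OF xK] by (elim exE)
        moreover have "x \<in> K" using pD(2)[OF xK] .
        ultimately show ?thesis by auto
      qed
      have qU: "\<Union>(snd ` q) \<subseteq> U"
      proof
        fix y assume "y \<in> \<Union>(snd ` q)"
        then obtain x K where xK: "(x, K) \<in> q" "y \<in> K" by auto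
        have "(x, K) \<in> p" "x \<in> N" using xK(1) unfolding q_def by auto
        then have "K \<subseteq> ball x (\<rho> x)" using pf unfolding fine_def by auto
        then show "y \<in> U" using \<rho>(2)[OF \<open>x \<in> N\<close>] xK(2) by blast
      qed
      have qab: "\<Union>(snd ` q) \<subseteq> {a..b}"
      proof
        fix y assume "y \<in> \<Union>(snd ` q)"
        then obtain x K where xK: "(x, K) \<in> q" "y \<in> K" by auto
        then show "y \<in> {a..b}" using pD(3)[of x K] qp by blast
      qed
      have "(\<Sum>K\<in>snd ` q. measure lborel K) < d0"
      proof -
        have m: "\<Union>(snd ` q) \<in> lmeasurable" using qd by (rule lmeasurable_division)
        have "(\<Sum>K\<in>snd ` q. measure lborel K) = measure lebesgue (\<Union>(snd ` q))"
          using measure_division_lebesgue[OF qd] by simp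
        also have "\<dots> = measure lebesgue (\<Union>(snd ` q) - N)"
          using measure_Diff_null_set[OF fmeasurableD[OF m] N[unfolded negligible_iff_null_sets]] by simp
        also have "\<dots> \<le> measure lebesgue (U - N)"
          by (rule measure_mono_fmeasurable) (use qU in blast, intro sets.Diff fmeasurableD[OF m] Nm, rule U(3))
        finally show ?thesis using mU by linarith
      qed
      then have s1: "(\<Sum>K\<in>snd ` q. \<bar>?F K\<bar>) < e / 2" by (intro AC qd qab)
      have s2: "(\<Sum>(x, K)\<in>q. \<bar>?F K\<bar>) = (\<Sum>K\<in>snd ` q. \<bar>?F K\<bar>)"
      proof -
        \<comment> \<open>An interval occurs with several tags only if it is degenerate, which is
          harmless for a function vanishing on boxes with empty interior. The empty set is such a
          box and is sent to 0 explicitly, as \<open>Sup {}\<close> and \<open>Inf {}\<close> carry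
          no information.\<close>
        let ?d = "\<lambda>K. if K = {} then 0 else \<bar>?F K\<bar>"
        have "(\<Sum>(x, K)\<in>q. ?d K) = (\<Sum>K\<in>snd ` q. ?d K)"
        proof (rule sum.over_tagged_division_lemma[OF qt])
          fix u v :: real assume "box u v = {}"
          then have "v \<le> u" by simp
          then show "?d (cbox u v) = 0" by (cases "u = v") auto
        qed
        moreover have "(\<Sum>(x, K)\<in>q. ?d K) = (\<Sum>(x, K)\<in>q. \<bar>?F K\<bar>)"
          by (rule sum.cong) (use K qp in fastforce)+
        moreover have "(\<Sum>K\<in>snd ` q. ?d K) = (\<Sum>K\<in>snd ` q. \<bar>?F K\<bar>)"
          by (rule sum.cong) (use K qp in fastforce)+
        ultimately show ?thesis by simp
      qed
      have s3: "(\<Sum>(x, K)\<in>p. if x \<in> N then \<bar>?F K\<bar> else 0) = (\<Sum>(x, K)\<in>q. \<bar>?F K\<bar>)"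
      proof -
        have "(\<Sum>(x, K)\<in>p. if x \<in> N then \<bar>?F K\<bar> else 0) = (\<Sum>(x, K)\<in>q. if x \<in> N then \<bar>?F K\<bar> else 0)"
          by (rule sum.mono_neutral_right[OF finp qp]) (auto simp: q_def split: if_splits)
        also have "\<dots> = (\<Sum>(x, K)\<in>q. \<bar>?F K\<bar>)" by (rule sum.cong) (auto simp: q_def)
        finally show ?thesis .
      qed
      have s4: "(\<Sum>(x, K)\<in>p. measure lborel K) = b - a"
        using additive_content_tagged_division[of p a b] p ab by simp
      have pt: "\<bar>measure lborel K * g x - ?F K\<bar> \<le> e' * measure lborel K + (if x \<in> N then \<bar>?F K\<bar> else 0)"
        if xK: "(x, K) \<in> p" for x K
      proof -
        obtain c d where cd: "K = {c..d}" "c \<le> x" "x \<le> d" using K[OF xK] by blast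
        have Kc: "measure lborel K = d - c" "?F K = f d - f c" using cd by auto
        show ?thesis
        proof (cases "x \<in> N")
          case True
          have "0 \<le> e' * (d - c)" using e' cd by simp
          with True show ?thesis by (simp add: g_def Kc)
        next
          case False
          have sub: "K \<subseteq> {a..b}" using pD(3)[OF xK] .
          have Kb: "K \<subseteq> ball x (\<rho> x)" using pf xK unfolding fine_def by blast
          have c: "c \<in> {a..b}" "d \<in> {a..b}" "x \<in> {a..b}" using sub cd by auto
          have "c \<in> ball x (\<rho> x)" "d \<in> ball x (\<rho> x)" by (rule subsetD[OF Kb], use cd in simp)+
          then have cb: "\<bar>c - x\<bar> < \<rho> x" "\<bar>d - x\<bar> < \<rho> x" by (auto simp: dist_real_def abs_minus_commute)
          have x: "x \<in> {a..b} - N" using c False by blast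
          have 1: "\<bar>f c - f x - (c - x) * h x\<bar> \<le> e' * (x - c)" using \<rho>(3)[OF x c(1) cb(1)] cd by simp
          have 2: "\<bar>f d - f x - (d - x) * h x\<bar> \<le> e' * (d - x)" using \<rho>(3)[OF x c(2) cb(2)] cd by simp
          have "(d - c) * h x - (f d - f c) = (f c - f x - (c - x) * h x) - (f d - f x - (d - x) * h x)"
            by (simp add: algebra_simps)
          then have "\<bar>(d - c) * h x - (f d - f c)\<bar> \<le> e' * (x - c) + e' * (d - x)" using 1 2 by linarith
          also have "\<dots> = e' * (d - c)" by (simp add: algebra_simps)
          finally show ?thesis using False by (simp add: g_def Kc)
        qed
      qed
      have "(\<Sum>(x, K)\<in>p. measure lborel K *\<^sub>R g x) - (f b - f a) = (\<Sum>(x, K)\<in>p. measure lborel K * g x - ?F K)"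
        using additive_tagged_division_1[OF ab \<open>p tagged_division_of {a..b}\<close>, of f]
        by (simp add: sum_subtractf split_def)
      then have "norm ((\<Sum>(x, K)\<in>p. measure lborel K *\<^sub>R g x) - (f b - f a)) \<le> (\<Sum>(x, K)\<in>p. \<bar>measure lborel K * g x - ?F K\<bar>)"
        using sum_abs[of "\<lambda>(x, K). measure lborel K * g x - ?F K" p] by (simp add: split_def)
      also have "\<dots> \<le> (\<Sum>(x, K)\<in>p. e' * measure lborel K + (if x \<in> N then \<bar>?F K\<bar> else 0))"
        by (rule sum_mono) (use pt in auto)
      also have "\<dots> = e' * (\<Sum>(x, K)\<in>p. measure lborel K) + (\<Sum>(x, K)\<in>p. if x \<in> N then \<bar>?F K\<bar> else 0)"
        by (simp add: split_def sum.distrib sum_distrib_left)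
      also have "\<dots> < e" unfolding s3 s2 s4 using s1 e'ab by linarith
      finally show "norm ((\<Sum>(x, K)\<in>p. measure lborel K *\<^sub>R g x) - (f b - f a)) < e" .
    qed
  qed
  then have "(g has_integral (f b - f a)) {a..b}" by simp
  then show ?thesis
    by (rule has_integral_spike[OF N, rotated]) (simp add: g_def)
qed

section \<open>Stability properties of absolute continuity\<close>

lemma abs_continuous_on_id: "abs_continuous_on A (\<lambda>x. x)"
proof -
  have "(\<Sum>(a, b)\<in>P. \<bar>b - a\<bar>) < e"
    if "finite P \<and> (\<forall>(a, b)\<in>P. a < b \<and> {a..b} \<subseteq> A) \<and>
       disjoint_family_on (\<lambda>(a, b). {a<..<b}) P \<and> (\<Sum>(a, b)\<in>P. b - a) < e" for P :: "(real \<times> real) set" and e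
  proof -
    have "(\<Sum>(a, b)\<in>P. \<bar>b - a\<bar>) = (\<Sum>(a, b)\<in>P. b - a)" by (rule sum.cong) (use that in auto)
    then show ?thesis using that by simp
  qed
  then show ?thesis unfolding abs_continuous_on_def by (intro allI impI exI conjI) auto
qed

text \<open>The definition sees a function only through its increments. Sums, products, Lipschitz
  functions and functions changed outside the interval are all treated by this comparison; two
  comparison functions are what sums and products call for.\<close>

lemma abs_continuous_on_dominated:
  assumes f: "abs_continuous_on A f" and g: "abs_continuous_on A g" and C: "C > 0"
    and h: "\<And>a b. a < b \<Longrightarrow> {a..b} \<subseteq> A \<Longrightarrow> \<bar>h b - h a\<bar> \<le> C * \<bar>f b - f a\<bar> + C * \<bar>g b - g a\<bar>"
  shows "abs_continuous_on A h"
  unfolding abs_continuous_on_def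
proof (intro allI impI)
  fix e :: real assume "e > 0"
  then have e: "e / (2 * C) > 0" using C by simp
  obtain d1 where d1: "d1 > 0" and P1: "\<forall>P :: (real \<times> real) set.
       finite P \<and> (\<forall>(a, b)\<in>P. a < b \<and> {a..b} \<subseteq> A) \<and>
       disjoint_family_on (\<lambda>(a, b). {a<..<b}) P \<and> (\<Sum>(a, b)\<in>P. b - a) < d1
       \<longrightarrow> (\<Sum>(a, b)\<in>P. \<bar>f b - f a\<bar>) < e / (2 * C)"
    using f[unfolded abs_continuous_on_def, THEN spec, THEN mp, OF e] by (elim exE conjE)
  obtain d2 where d2: "d2 > 0" and P2: "\<forall>P :: (real \<times> real) set.
       finite P \<and> (\<forall>(a, b)\<in>P. a < b \<and> {a..b} \<subseteq> A) \<and>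
       disjoint_family_on (\<lambda>(a, b). {a<..<b}) P \<and> (\<Sum>(a, b)\<in>P. b - a) < d2
       \<longrightarrow> (\<Sum>(a, b)\<in>P. \<bar>g b - g a\<bar>) < e / (2 * C)"
    using g[unfolded abs_continuous_on_def, THEN spec, THEN mp, OF e] by (elim exE conjE)
  show "\<exists>d>0. \<forall>P :: (real \<times> real) set.
       finite P \<and> (\<forall>(a, b)\<in>P. a < b \<and> {a..b} \<subseteq> A) \<and>
       disjoint_family_on (\<lambda>(a, b). {a<..<b}) P \<and> (\<Sum>(a, b)\<in>P. b - a) < d
       \<longrightarrow> (\<Sum>(a, b)\<in>P. \<bar>h b - h a\<bar>) < e"
  proof (intro exI conjI allI impI)
    show "min d1 d2 > 0" using d1 d2 by simp
    fix P :: "(real \<times> real) set"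
    assume P: "finite P \<and> (\<forall>(a, b)\<in>P. a < b \<and> {a..b} \<subseteq> A) \<and>
       disjoint_family_on (\<lambda>(a, b). {a<..<b}) P \<and> (\<Sum>(a, b)\<in>P. b - a) < min d1 d2"
    have "(\<Sum>(a, b)\<in>P. \<bar>f b - f a\<bar>) < e / (2 * C)"
      by (rule P1[THEN spec, THEN mp]) (use P in auto)
    moreover have "(\<Sum>(a, b)\<in>P. \<bar>g b - g a\<bar>) < e / (2 * C)"
      by (rule P2[THEN spec, THEN mp]) (use P in auto)
    ultimately have s: "(\<Sum>(a, b)\<in>P. \<bar>f b - f a\<bar>) + (\<Sum>(a, b)\<in>P. \<bar>g b - g a\<bar>) < e / C" by simp
    have "(\<Sum>(a, b)\<in>P. \<bar>h b - h a\<bar>) \<le> (\<Sum>(a, b)\<in>P. C * \<bar>f b - f a\<bar> + C * \<bar>g b - g a\<bar>)"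
    proof (rule sum_mono)
      fix z assume "z \<in> P"
      then show "(case z of (a, b) \<Rightarrow> \<bar>h b - h a\<bar>) \<le> (case z of (a, b) \<Rightarrow> C * \<bar>f b - f a\<bar> + C * \<bar>g b - g a\<bar>)"
        using P h by (cases z) auto
    qed
    also have "\<dots> = C * ((\<Sum>(a, b)\<in>P. \<bar>f b - f a\<bar>) + (\<Sum>(a, b)\<in>P. \<bar>g b - g a\<bar>))"
      by (simp add: split_def sum.distrib sum_distrib_left distrib_left)
    also have "\<dots> < C * (e / C)" using s C by (rule mult_strict_left_mono)
    also have "\<dots> = e" using C by simp
    finally show "(\<Sum>(a, b)\<in>P. \<bar>h b - h a\<bar>) < e" .
  qed
qed

lemma abs_continuous_on_add:
  assumes "abs_continuous_on A f" "abs_continuous_on A g"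
  shows "abs_continuous_on A (\<lambda>x. f x + g x)"
  by (rule abs_continuous_on_dominated[OF assms, of 1]) auto

lemma abs_continuous_on_mult:
  assumes f: "abs_continuous_on {l..u} f" and g: "abs_continuous_on {l..u} g"
  shows "abs_continuous_on {l..u} (\<lambda>x. f x * g x)"
proof -
  have "bounded (f ` {l..u})" "bounded (g ` {l..u})"
    using abs_continuous_on_imp_continuous_on[OF f] abs_continuous_on_imp_continuous_on[OF g]
    by (auto intro: compact_imp_bounded compact_continuous_image)
  then obtain B1 B2 where "\<forall>y\<in>f ` {l..u}. norm y \<le> B1" "\<forall>y\<in>g ` {l..u}. norm y \<le> B2"
    unfolding bounded_iff by blast
  then have B: "\<bar>f x\<bar> \<le> B1" "\<bar>g x\<bar> \<le> B2" if "x \<in> {l..u}" for x using that by auto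
  define C where "C = \<bar>B1\<bar> + \<bar>B2\<bar> + 1"
  show ?thesis
  proof (rule abs_continuous_on_dominated[OF f g])
    show "C > 0" by (simp add: C_def)
    fix a b assume ab: "a < b" "{a..b} \<subseteq> {l..u}"
    then have in': "a \<in> {l..u}" "b \<in> {l..u}" by auto
    have "f b * g b - f a * g a = (f b - f a) * g b + f a * (g b - g a)" by (simp add: algebra_simps)
    then have "\<bar>f b * g b - f a * g a\<bar> \<le> \<bar>g b\<bar> * \<bar>f b - f a\<bar> + \<bar>f a\<bar> * \<bar>g b - g a\<bar>"
      by (metis abs_mult abs_triangle_ineq mult.commute)
    also have "\<dots> \<le> C * \<bar>f b - f a\<bar> + C * \<bar>g b - g a\<bar>"
      using B[OF in'(1)] B[OF in'(2)] by (intro add_mono mult_right_mono) (auto simp: C_def)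
    finally show "\<bar>f b * g b - f a * g a\<bar> \<le> C * \<bar>f b - f a\<bar> + C * \<bar>g b - g a\<bar>" .
  qed
qed

text \<open>A bounded derivative makes \<open>f\<close> Lipschitz, so its increments are dominated
  by those of the identity.\<close>

lemma abs_continuous_on_C1:
  fixes f :: "real \<Rightarrow> real"
  assumes d: "\<And>x. x \<in> {l..u} \<Longrightarrow> (f has_vector_derivative f' x) (at x within {l..u})"
    and c: "continuous_on {l..u} f'"
  shows "abs_continuous_on {l..u} f"
proof -
  have "bounded (f' ` {l..u})" using c by (auto intro: compact_imp_bounded compact_continuous_image)
  then obtain B where "\<forall>y\<in>f' ` {l..u}. norm y \<le> B" unfolding bounded_iff by blast
  then have B: "\<bar>f' x\<bar> \<le> B" if "x \<in> {l..u}" for x using that by auto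
  have L: "\<bar>f b - f a\<bar> \<le> B * \<bar>b - a\<bar>" if "a \<in> {l..u}" "b \<in> {l..u}" for a b
  proof -
    have "norm (f b - f a) \<le> B * norm (b - a)"
    proof (rule field_differentiable_bound[of "{l..u}" f f'])
      show "(f has_field_derivative f' z) (at z within {l..u})" if "z \<in> {l..u}" for z
        using d[OF that] by (simp add: has_real_derivative_iff_has_vector_derivative)
    qed (use B that in auto)
    then show ?thesis by simp
  qed
  show ?thesis
  proof (rule abs_continuous_on_dominated[OF abs_continuous_on_id abs_continuous_on_id])
    show "\<bar>B\<bar> + 1 > 0" by simp
    fix a b assume ab: "a < b" "{a..b} \<subseteq> {l..u}"
    then have "\<bar>f b - f a\<bar> \<le> B * \<bar>b - a\<bar>" by (intro L) auto
    also have "\<dots> \<le> (\<bar>B\<bar> + 1) * \<bar>b - a\<bar>" by (intro mult_right_mono) auto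
    also have "\<dots> \<le> (\<bar>B\<bar> + 1) * \<bar>b - a\<bar> + (\<bar>B\<bar> + 1) * \<bar>b - a\<bar>" by simp
    finally show "\<bar>f b - f a\<bar> \<le> (\<bar>B\<bar> + 1) * \<bar>b - a\<bar> + (\<bar>B\<bar> + 1) * \<bar>b - a\<bar>" .
  qed
qed

section \<open>The space of square integrable functions\<close>

definition inner2 :: "(real \<Rightarrow> real) \<Rightarrow> (real \<Rightarrow> real) \<Rightarrow> real" where
  "inner2 f g = integral\<^sup>L (lebesgue_on \<II>) (\<lambda>x. f x * g x)"

lemma L2D:
  assumes "f \<in> L2"
  shows "f \<in> borel_measurable (lebesgue_on \<II>)" "integrable (lebesgue_on \<II>) (\<lambda>x. f x * f x)"
  using assms by (auto simp: L2_def power2_eq_square)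

lemma L2_integrable_mult:
  assumes f: "f \<in> L2" and g: "g \<in> L2"
  shows "integrable (lebesgue_on \<II>) (\<lambda>x. f x * g x)"
proof (rule Bochner_Integration.integrable_bound)
  show "integrable (lebesgue_on \<II>) (\<lambda>x. f x * f x + g x * g x)"
    using L2D[OF f] L2D[OF g] by (intro Bochner_Integration.integrable_add)
  show "(\<lambda>x. f x * g x) \<in> borel_measurable (lebesgue_on \<II>)"
    using L2D[OF f] L2D[OF g] by measurable
  have "\<bar>a * b\<bar> \<le> a * a + b * b" for a b :: real
  proof -
    have "2 * \<bar>a * b\<bar> \<le> \<bar>a\<bar>\<^sup>2 + \<bar>b\<bar>\<^sup>2" using sum_squares_bound[of "\<bar>a\<bar>" "\<bar>b\<bar>"] by (simp add: abs_mult)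
    then show ?thesis by (simp add: power2_eq_square)
  qed
  then show "AE x in lebesgue_on \<II>. norm (f x * g x) \<le> norm (f x * f x + g x * g x)"
    by (intro always_eventually allI) (smt (verit) real_norm_def)
qed

lemma L2_add:
  assumes f: "f \<in> L2" and g: "g \<in> L2"
  shows "(\<lambda>x. f x + g x) \<in> L2"
proof -
  have "(\<lambda>x. \<bar>f x + g x\<bar>\<^sup>2) = (\<lambda>x. f x * f x + 2 * (f x * g x) + g x * g x)"
    by (rule ext) (simp add: power2_eq_square algebra_simps)
  moreover have "integrable (lebesgue_on \<II>) (\<lambda>x. f x * f x + 2 * (f x * g x) + g x * g x)"
    by (intro Bochner_Integration.integrable_add integrable_mult_right L2_integrable_mult assms)
  moreover have "(\<lambda>x. f x + g x) \<in> borel_measurable (lebesgue_on \<II>)"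
    using L2D[OF f] L2D[OF g] by measurable
  ultimately show ?thesis by (simp add: L2_def)
qed

lemma L2_cmult:
  assumes f: "f \<in> L2"
  shows "(\<lambda>x. c * f x) \<in> L2"
proof -
  have "(\<lambda>x. \<bar>c * f x\<bar>\<^sup>2) = (\<lambda>x. (c * c) * (f x * f x))"
    by (rule ext) (simp add: power2_eq_square algebra_simps)
  moreover have "integrable (lebesgue_on \<II>) (\<lambda>x. (c * c) * (f x * f x))"
    by (intro integrable_mult_right L2_integrable_mult assms)
  moreover have "(\<lambda>x. c * f x) \<in> borel_measurable (lebesgue_on \<II>)"
    using L2D[OF f] by measurable
  ultimately show ?thesis by (simp add: L2_def)
qed

lemma L2_diff:
  assumes f: "f \<in> L2" and g: "g \<in> L2"
  shows "(\<lambda>x. f x - g x) \<in> L2"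
  using L2_add[OF f L2_cmult[OF g, of "-1"]] by simp

lemma L2_zero: "(\<lambda>x. 0) \<in> L2"
  by (simp add: L2_def)

lemma continuous_imp_L2:
  assumes "continuous_on \<II> f"
  shows "f \<in> L2"
proof -
  have "f \<in> borel_measurable (lebesgue_on \<II>)"
    by (intro continuous_imp_measurable_on_sets_lebesgue assms) simp
  moreover have "continuous_on \<II> (\<lambda>x. \<bar>f x\<bar>\<^sup>2)" using assms by (intro continuous_intros)
  then have "integrable (lebesgue_on \<II>) (\<lambda>x. \<bar>f x\<bar>\<^sup>2)"
    by (rule continuous_imp_integrable_real)
  ultimately show ?thesis by (simp add: L2_def)
qed

lemma L2_cong:
  assumes "\<And>x. x \<in> \<II> \<Longrightarrow> f x = g x"
  shows "f \<in> L2 \<longleftrightarrow> g \<in> L2"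
proof -
  have "f \<in> borel_measurable (lebesgue_on \<II>) \<longleftrightarrow> g \<in> borel_measurable (lebesgue_on \<II>)"
    by (rule measurable_cong) (use assms in simp)
  moreover have "integrable (lebesgue_on \<II>) (\<lambda>x. \<bar>f x\<bar>\<^sup>2) \<longleftrightarrow> integrable (lebesgue_on \<II>) (\<lambda>x. \<bar>g x\<bar>\<^sup>2)"
    by (rule Bochner_Integration.integrable_cong) (use assms in auto)
  ultimately show ?thesis by (simp add: L2_def)
qed

lemma norm2_cong:
  assumes "\<And>x. x \<in> \<II> \<Longrightarrow> f x = g x"
  shows "norm2 f = norm2 g"
proof -
  have "integral\<^sup>L (lebesgue_on \<II>) (\<lambda>x. \<bar>f x\<bar>\<^sup>2) = integral\<^sup>L (lebesgue_on \<II>) (\<lambda>x. \<bar>g x\<bar>\<^sup>2)"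
    by (rule Bochner_Integration.integral_cong) (use assms in auto)
  then show ?thesis by (simp add: norm2_def)
qed

lemma inner2_cong:
  assumes "\<And>x. x \<in> \<II> \<Longrightarrow> f x = f' x" "\<And>x. x \<in> \<II> \<Longrightarrow> g x = g' x"
  shows "inner2 f g = inner2 f' g'"
  unfolding inner2_def by (rule Bochner_Integration.integral_cong) (use assms in auto)

lemma inner2_commute: "inner2 f g = inner2 g f"
  by (simp add: inner2_def mult.commute)

lemma inner2_add_right:
  "f \<in> L2 \<Longrightarrow> g \<in> L2 \<Longrightarrow> h \<in> L2 \<Longrightarrow> inner2 f (\<lambda>x. g x + h x) = inner2 f g + inner2 f h"
  unfolding inner2_def
  by (simp add: distrib_left Bochner_Integration.integral_add L2_integrable_mult)

lemma inner2_cmult_right: "inner2 f (\<lambda>x. c * g x) = c * inner2 f g"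
  unfolding inner2_def by (simp add: mult.left_commute)

lemma inner2_cmult_left: "inner2 (\<lambda>x. c * f x) g = c * inner2 f g"
  unfolding inner2_def by (simp add: mult.assoc)

lemma inner2_diff_right:
  "f \<in> L2 \<Longrightarrow> g \<in> L2 \<Longrightarrow> h \<in> L2 \<Longrightarrow> inner2 f (\<lambda>x. g x - h x) = inner2 f g - inner2 f h"
  unfolding inner2_def
  by (simp add: right_diff_distrib Bochner_Integration.integral_diff L2_integrable_mult)

lemma inner2_self_nonneg: "0 \<le> inner2 f f"
  unfolding inner2_def by (rule Bochner_Integration.integral_nonneg) simp

lemma norm2_nonneg: "0 \<le> norm2 f"
  by (simp add: norm2_def)

lemma norm2_power2: "(norm2 f)\<^sup>2 = inner2 f f"
  using inner2_self_nonneg[of f] by (simp add: norm2_def inner2_def power2_eq_square)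

lemma norm2_cmult: "norm2 (\<lambda>x. c * f x) = \<bar>c\<bar> * norm2 f"
proof -
  have "(norm2 (\<lambda>x. c * f x))\<^sup>2 = (\<bar>c\<bar> * norm2 f)\<^sup>2"
    unfolding norm2_power2 power_mult_distrib inner2_cmult_left inner2_cmult_right by (simp add: power2_eq_square)
  then show ?thesis
    by (rule power2_eq_imp_eq) (simp_all add: norm2_nonneg)
qed

lemma inner2_diff_self:
  assumes "f \<in> L2" "g \<in> L2"
  shows "inner2 (\<lambda>x. f x - g x) (\<lambda>x. f x - g x) = inner2 f f - 2 * inner2 f g + inner2 g g"
proof -
  have d: "(\<lambda>x. f x - g x) \<in> L2" using assms by (rule L2_diff)
  have "inner2 (\<lambda>x. f x - g x) (\<lambda>x. f x - g x) = inner2 (\<lambda>x. f x - g x) f - inner2 (\<lambda>x. f x - g x) g"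
    by (rule inner2_diff_right[OF d assms])
  also have "inner2 (\<lambda>x. f x - g x) f = inner2 f f - inner2 f g"
    by (subst inner2_commute) (rule inner2_diff_right[OF assms(1) assms])
  also have "inner2 (\<lambda>x. f x - g x) g = inner2 f g - inner2 g g"
    by (subst inner2_commute) (simp add: inner2_diff_right[OF assms(2) assms] inner2_commute[of g f])
  finally show ?thesis by simp
qed

section \<open>The Cauchy-Schwarz inequality and its equality case\<close>

text \<open>The square of \<open>norm2 g * f - norm2 f * g\<close> has nonnegative integral, which
  gives the claim after division by \<open>norm2 f * norm2 g\<close>. If one norm is 0, a positive
  inner product could be scaled up without bound.\<close>

lemma inner2_le_norm2:
  assumes f: "f \<in> L2" and g: "g \<in> L2"
  shows "inner2 f g \<le> norm2 f * norm2 g"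
proof -
  let ?a = "norm2 f" and ?b = "norm2 g"
  have q: "2 * (s * t * inner2 f g) \<le> s\<^sup>2 * ?a\<^sup>2 + t\<^sup>2 * ?b\<^sup>2" for s t
    using inner2_self_nonneg[of "\<lambda>x. s * f x - t * g x"]
    unfolding inner2_diff_self[OF L2_cmult[OF f] L2_cmult[OF g]] inner2_cmult_left inner2_cmult_right norm2_power2
    by (simp add: power2_eq_square mult.assoc)
  have pos: "?a \<ge> 0" "?b \<ge> 0" by (rule norm2_nonneg)+
  show ?thesis
  proof (cases "?a = 0 \<or> ?b = 0")
    case False
    then have ab: "?a * ?b > 0" using pos by simp
    have "2 * (?b * ?a * inner2 f g) \<le> 2 * ((?a * ?b) * (?a * ?b))"
      using q[of ?b ?a] by (simp add: power2_eq_square algebra_simps)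
    then have "(?a * ?b) * inner2 f g \<le> (?a * ?b) * (?a * ?b)" by (simp add: mult.commute)
    then show ?thesis using ab by (simp only: mult_le_cancel_left_pos)
  next
    case True
    have "inner2 f g \<le> 0"
    proof (rule ccontr)
      assume "\<not> inner2 f g \<le> 0"
      then have i: "inner2 f g > 0" by simp
      define M where "M = ?a\<^sup>2 + ?b\<^sup>2"
      have M: "M \<ge> 0" by (simp add: M_def)
      have "2 * (s * inner2 f g) \<le> M" if "s > 0" for s
      proof (cases "?a = 0")
        case True
        then show ?thesis using q[of s 1] by (simp add: M_def)
      next
        case False
        then have "?b = 0" using \<open>?a = 0 \<or> ?b = 0\<close> by simp
        then show ?thesis using q[of 1 s] by (simp add: M_def)
      qed
      \<comment> \<open>This choice of \<open>s\<close> turns the bound into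
        \<open>2 * (M + 1) \<le> M\<close>.\<close>
      from this[of "(M + 1) / inner2 f g"] i M have "2 * ((M + 1) / inner2 f g * inner2 f g) \<le> M" by simp
      moreover have "(M + 1) / inner2 f g * inner2 f g = M + 1" using i by simp
      ultimately show False using M by linarith
    qed
    then show ?thesis using True pos by auto
  qed
qed

lemma abs_inner2_le_norm2:
  assumes f: "f \<in> L2" and g: "g \<in> L2"
  shows "\<bar>inner2 f g\<bar> \<le> norm2 f * norm2 g"
proof -
  have "inner2 f (\<lambda>x. -1 * g x) \<le> norm2 f * norm2 (\<lambda>x. -1 * g x)"
    by (rule inner2_le_norm2[OF f L2_cmult[OF g]])
  then have "- inner2 f g \<le> norm2 f * norm2 g"
    unfolding inner2_cmult_right norm2_cmult by simp
  then show ?thesis using inner2_le_norm2[OF f g] by linarith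
qed

text \<open>Equality makes the combination \<open>?w\<close> a function of norm 0. Functions equal
  almost everywhere are not identified, so proportionality is expressed by testing against
  \<open>h\<close>.\<close>

lemma inner2_eq_norm2_imp_parallel:
  assumes f: "f \<in> L2" and g: "g \<in> L2" and h: "h \<in> L2" and eq: "inner2 f g = norm2 f * norm2 g"
  shows "norm2 f * inner2 g h = norm2 g * inner2 f h"
proof -
  let ?w = "\<lambda>x. norm2 f * g x - norm2 g * f x"
  have w: "?w \<in> L2" by (intro L2_diff L2_cmult f g)
  have "inner2 ?w ?w = 0"
    unfolding inner2_diff_self[OF L2_cmult[OF g] L2_cmult[OF f]] inner2_cmult_left inner2_cmult_right
      inner2_commute[of g f] eq norm2_power2[symmetric] by (simp add: power2_eq_square)
  then have "norm2 ?w = 0" using norm2_power2[of ?w] by simp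
  then have "inner2 ?w h = 0" using abs_inner2_le_norm2[OF w h] by simp
  moreover have "inner2 ?w h = norm2 f * inner2 g h - norm2 g * inner2 f h"
    by (subst inner2_commute)
      (simp add: inner2_diff_right[OF h L2_cmult[OF g] L2_cmult[OF f]] inner2_cmult_right inner2_commute[of h])
  ultimately show ?thesis by simp
qed

lemma inner2_has_integral:
  assumes "f \<in> L2" "g \<in> L2"
  shows "((\<lambda>x. f x * g x) has_integral inner2 f g) \<II>"
  unfolding inner2_def
  by (rule has_integral_integral_lebesgue_on[OF L2_integrable_mult[OF assms]]) simp

section \<open>Higher derivatives and integration by parts\<close>

lemma nderiv_0 [simp]: "nderiv 0 f = f"
  by (simp add: nderiv_def)

lemma nderiv_Suc: "nderiv (Suc n) f x = vector_derivative (nderiv n f) (at x within \<II>)"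
  by (simp add: nderiv_def)

lemma vector_derivative_within_sym_interval:
  assumes "x \<in> \<II>" "(f has_vector_derivative f') (at x within \<II>)"
  shows "vector_derivative f (at x within \<II>) = f'"
  using vector_derivative_within_cbox[of "-1" 1 x f f'] assms by simp

text \<open>Derivatives of concrete functions are computed below by exhibiting the whole ladder
  \<open>F\<close>. Values off the interval do not enter, because each derivative is taken within
  it.\<close>

lemma nderiv_eqI:
  assumes 0: "\<And>x. x \<in> \<II> \<Longrightarrow> F 0 x = f x"
    and F: "\<And>j x. j < m \<Longrightarrow> x \<in> \<II> \<Longrightarrow> (F j has_vector_derivative F (Suc j) x) (at x within \<II>)"
    and "n \<le> m" "x \<in> \<II>"
  shows "nderiv n f x = F n x"
  using assms(3,4)
proof (induction n arbitrary: x)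
  case 0
  then show ?case using assms(1) by simp
next
  case (Suc n)
  have "(nderiv n f has_vector_derivative F (Suc n) x) (at x within \<II>)"
    by (rule has_vector_derivative_transform[OF _ _ F]) (use Suc in auto)
  then show ?case
    unfolding nderiv_Suc by (intro vector_derivative_within_sym_interval Suc.prems)
qed

lemma abs_continuous_on_cong:
  assumes "abs_continuous_on {l..u} f" "\<And>x. x \<in> {l..u} \<Longrightarrow> f x = g x"
  shows "abs_continuous_on {l..u} g"
proof (rule abs_continuous_on_dominated[OF assms(1) assms(1)])
  fix a b assume "a < b" "{a..b} \<subseteq> {l..u}"
  then have "a \<in> {l..u}" "b \<in> {l..u}" by auto
  then show "\<bar>g b - g a\<bar> \<le> 1 * \<bar>f b - f a\<bar> + 1 * \<bar>f b - f a\<bar>" using assms(2) by simp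
qed simp

lemma abs_continuous_on_sum:
  assumes "finite S" "\<And>i. i \<in> S \<Longrightarrow> abs_continuous_on {l..u} (f i)"
  shows "abs_continuous_on {l..u} (\<lambda>x. \<Sum>i\<in>S. f i x)"
  using assms
proof (induction S rule: finite_induct)
  case empty
  show ?case by (rule abs_continuous_on_C1[of _ _ _ "\<lambda>_. 0"]) auto
next
  case (insert i S)
  then show ?case using abs_continuous_on_add[of "{l..u}" "f i" "\<lambda>x. \<Sum>i\<in>S. f i x"] by simp
qed

lemma L2_sobolev_has_vector_derivative:
  assumes "f \<in> L2_sobolev m" "Suc j < m" "x \<in> \<II>"
  shows "(nderiv j f has_vector_derivative nderiv (Suc j) f x) (at x within \<II>)"
proof -
  have "nderiv j f differentiable (at x within \<II>)"
    using assms by (simp add: L2_sobolev_def)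
  then show ?thesis
    unfolding nderiv_Suc by (simp add: vector_derivative_works)
qed

lemma L2_sobolev_continuous_on:
  assumes "f \<in> L2_sobolev m" "j < m"
  shows "continuous_on \<II> (nderiv j f)"
proof (cases "Suc j < m")
  case True
  then show ?thesis
    using L2_sobolev_has_vector_derivative[OF assms(1) True]
    by (intro continuous_on_vector_derivative) auto
next
  case False
  then have "j = m - 1" using assms(2) by simp
  then show ?thesis
    using assms(1) by (intro abs_continuous_on_imp_continuous_on) (simp add: L2_sobolev_def)
qed

lemma L2_sobolev_abs_continuous_on:
  assumes "f \<in> L2_sobolev m" "j < m"
  shows "abs_continuous_on \<II> (nderiv j f)"
proof (cases "Suc j < m")
  case True
  then show ?thesis
    by (intro abs_continuous_on_C1[where f' = "nderiv (Suc j) f"]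
        L2_sobolev_has_vector_derivative[OF assms(1)] L2_sobolev_continuous_on[OF assms(1)])
next
  case False
  then have "j = m - 1" using assms(2) by simp
  then show ?thesis using assms(1) by (simp add: L2_sobolev_def)
qed

lemma L2_sobolev_imp_L2:
  assumes "f \<in> L2_sobolev m" "0 < m"
  shows "f \<in> L2" "nderiv m f \<in> L2"
  using continuous_imp_L2[OF L2_sobolev_continuous_on[OF assms]] assms by (auto simp: L2_sobolev_def)

lemma L2_sobolevI:
  assumes m: "0 < m" and 0: "\<And>x. x \<in> \<II> \<Longrightarrow> F 0 x = f x"
    and F: "\<And>j x. j < m \<Longrightarrow> x \<in> \<II> \<Longrightarrow> (F j has_vector_derivative F (Suc j) x) (at x within \<II>)"
    and c: "continuous_on \<II> (F m)"
  shows "f \<in> L2_sobolev m"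
proof -
  have eq: "nderiv n f x = F n x" if "n \<le> m" "x \<in> \<II>" for n x
    by (rule nderiv_eqI[where F = F and m = m]) (use 0 F that in auto)
  have "nderiv j f differentiable (at x within \<II>)" if "j < m - 1" "x \<in> \<II>" for j x
  proof -
    have "(nderiv j f has_vector_derivative F (Suc j) x) (at x within \<II>)"
      by (rule has_vector_derivative_transform[OF _ _ F]) (use that eq in auto)
    then show ?thesis by (rule differentiableI_vector)
  qed
  moreover have "abs_continuous_on \<II> (nderiv (m - 1) f)"
  proof (rule abs_continuous_on_cong[OF abs_continuous_on_C1])
    show "(F (m - 1) has_vector_derivative F m x) (at x within \<II>)" if "x \<in> \<II>" for x
      using F[of "m - 1" x] m that by simp
    show "continuous_on \<II> (F m)" by (rule c)
    show "F (m - 1) x = nderiv (m - 1) f x" if "x \<in> \<II>" for x using eq[of "m - 1" x] that by simp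
  qed
  moreover have "nderiv m f \<in> L2"
    using continuous_imp_L2[OF c] L2_cong[of "nderiv m f" "F m"] eq by simp
  ultimately show ?thesis by (simp add: L2_sobolev_def)
qed

section \<open>Green's formula\<close>

text \<open>The derivative of the alternating boundary form \<open>B\<close> telescopes to the
  integrand \<open>H\<close>. The derivative of order \<open>r - 1\<close> of \<open>f\<close> is
  only absolutely continuous, so this holds almost everywhere, and the increment of \<open>B\<close>
  is recovered by the fundamental theorem for absolutely continuous functions.\<close>

theorem Green_formula:
  assumes f: "f \<in> L2_sobolev r" and r: "0 < r"
    and U: "\<And>j x. j < r \<Longrightarrow> x \<in> \<II> \<Longrightarrow> (U j has_vector_derivative U (Suc j) x) (at x within \<II>)"
    and Ur: "continuous_on \<II> (U r)"
  shows "inner2 (U 0) (nderiv r f) - (-1) ^ r * inner2 (U r) f =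
    (\<Sum>s<r. (-1) ^ s * (U s 1 * nderiv (r - Suc s) f 1)) -
    (\<Sum>s<r. (-1) ^ s * (U s (-1) * nderiv (r - Suc s) f (-1)))"
proof -
  define B where "B x = (\<Sum>s<r. (-1) ^ s * (U s x * nderiv (r - Suc s) f x))" for x
  have Uc: "continuous_on \<II> (U s)" if "s \<le> r" for s
  proof (cases "s = r")
    case False
    then have "s < r" using that by simp
    then show ?thesis by (intro continuous_on_vector_derivative[OF U])
  qed (use Ur in simp)
  have "abs_continuous_on \<II> (\<lambda>x. (-1) ^ s * (U s x * nderiv (r - Suc s) f x))" if "s < r" for s
  proof (intro abs_continuous_on_mult)
    show "abs_continuous_on \<II> (\<lambda>x. (-1) ^ s)" by (rule abs_continuous_on_C1[of _ _ _ "\<lambda>_. 0"]) auto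
    show "abs_continuous_on \<II> (U s)" using that by (intro abs_continuous_on_C1[OF U Uc]) auto
    show "abs_continuous_on \<II> (nderiv (r - Suc s) f)"
      using r by (intro L2_sobolev_abs_continuous_on[OF f]) simp
  qed
  then have BAC: "abs_continuous_on \<II> B"
    unfolding B_def by (intro abs_continuous_on_sum) auto
  have "abs_continuous_on \<II> (nderiv (r - 1) f)" using r by (intro L2_sobolev_abs_continuous_on[OF f]) simp
  then obtain N where N: "negligible N" "\<And>x. x \<in> \<II> - N \<Longrightarrow> \<exists>L. (nderiv (r - 1) f has_vector_derivative L) (at x)"
    using abs_continuous_on_imp_differentiable_ae by blast
  define H where "H x = U 0 x * nderiv r f x - (-1) ^ r * (U r x * f x)" for x
  have der: "(B has_vector_derivative H x) (at x within \<II>)" if x: "x \<in> \<II> - N" for x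
  proof -
    \<comment> \<open>The value of \<open>nderiv r f\<close> is arbitrary where the derivative does
      not exist; off \<open>N\<close> it is the derivative.\<close>
    obtain L where "(nderiv (r - 1) f has_vector_derivative L) (at x)" using N(2)[OF x] by blast
    then have L: "(nderiv (r - 1) f has_vector_derivative L) (at x within \<II>)"
      by (rule has_vector_derivative_at_within)
    then have "nderiv r f x = L"
      using vector_derivative_within_sym_interval[of x "nderiv (r - 1) f" L] x nderiv_Suc[of "r - 1" f x] r by simp
    with L have top: "(nderiv (r - 1) f has_vector_derivative nderiv r f x) (at x within \<II>)" by simp
    have fd: "(nderiv (r - Suc s) f has_vector_derivative nderiv (r - s) f x) (at x within \<II>)" if "s < r" for s
    proof (cases "s = 0")
      case False
      then have "Suc (r - Suc s) = r - s" "Suc (r - Suc s) < r" using that by auto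
      then show ?thesis using L2_sobolev_has_vector_derivative[OF f, of "r - Suc s" x] x by simp
    qed (use top in simp)
    \<comment> \<open>In \<open>T\<close> the orders add up to \<open>r\<close>. Differentiating the
      boundary term with index \<open>s\<close> gives the difference of two consecutive values of
      \<open>T\<close>.\<close>
    define T where "T s = (-1) ^ s * (U s x * nderiv (r - s) f x)" for s
    have "((\<lambda>x. (-1) ^ s * (U s x * nderiv (r - Suc s) f x)) has_vector_derivative T s - T (Suc s)) (at x within \<II>)"
      if "s < r" for s
    proof -
      have "((\<lambda>x. (-1) ^ s * (U s x * nderiv (r - Suc s) f x)) has_vector_derivative
          (-1) ^ s * (U s x * nderiv (r - s) f x + U (Suc s) x * nderiv (r - Suc s) f x)) (at x within \<II>)"
        using U[OF that, of x] fd[OF that] x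
        by (intro has_vector_derivative_mult_right has_vector_derivative_mult) auto
      then show ?thesis by (simp add: T_def algebra_simps)
    qed
    then have "(B has_vector_derivative (\<Sum>s<r. T s - T (Suc s))) (at x within \<II>)"
      unfolding B_def by (intro has_vector_derivative_sum) simp
    moreover have "(\<Sum>s<r. T s - T (Suc s)) = H x"
      unfolding sum_lessThan_telescope' by (simp add: T_def H_def)
    ultimately show ?thesis by simp
  qed
  have "(H has_integral (B 1 - B (-1))) \<II>"
    by (rule fundamental_theorem_of_calculus_abs_continuous[OF _ BAC N(1) der]) auto
  moreover have "(H has_integral (inner2 (U 0) (nderiv r f) - (-1) ^ r * inner2 (U r) f)) \<II>"
    unfolding H_def
    by (intro has_integral_diff has_integral_mult_right inner2_has_integral continuous_imp_L2 Uc
        L2_sobolev_imp_L2[OF f r]) auto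
  ultimately have "B 1 - B (-1) = inner2 (U 0) (nderiv r f) - (-1) ^ r * inner2 (U r) f"
    by (rule has_integral_unique)
  then show ?thesis by (simp add: B_def)
qed

section \<open>The boundary value problem\<close>

text \<open>Gaussian elimination, by induction on the columns. A trivial kernel provides a pivot
  \<open>A i0 p \<noteq> 0\<close>. The reduced matrix \<open>A'\<close> inherits the trivial
  kernel, since \<open>ext\<close> continues its solutions to solutions of the full system.\<close>

lemma square_system_solvable:
  fixes A :: "'a \<Rightarrow> 'b \<Rightarrow> real" and b :: "'a \<Rightarrow> real"
  assumes "finite J" "finite I" "card I = card J"
    and "\<And>x. (\<And>i. i \<in> I \<Longrightarrow> (\<Sum>j\<in>J. A i j * x j) = 0) \<Longrightarrow> \<forall>j\<in>J. x j = 0"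
  shows "\<exists>x. \<forall>i\<in>I. (\<Sum>j\<in>J. A i j * x j) = b i"
  using assms
proof (induction J arbitrary: I A b rule: finite_induct)
  case empty
  then show ?case by simp
next
  case (insert p J)
  have "\<exists>i0\<in>I. A i0 p \<noteq> 0"
  proof (rule ccontr)
    assume "\<not> (\<exists>i0\<in>I. A i0 p \<noteq> 0)"
    then have "(\<Sum>j\<in>insert p J. A i j * (if j = p then 1 else 0)) = 0" if "i \<in> I" for i
      using that by (intro sum.neutral) auto
    then show False using insert.prems(3)[of "\<lambda>j. if j = p then 1 else 0"] by auto
  qed
  then obtain i0 where i0: "i0 \<in> I" "A i0 p \<noteq> 0" by blast
  define A' where "A' i j = A i j - A i p / A i0 p * A i0 j" for i j
  define ext where "ext x c = (\<lambda>j. if j = p then (c - (\<Sum>j\<in>J. A i0 j * x j)) / A i0 p else x j)" for x c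
  have J: "(\<Sum>j\<in>J. A i j * ext x c j) = (\<Sum>j\<in>J. A i j * x j)" for i x c
    by (rule sum.cong) (use insert.hyps in \<open>auto simp: ext_def\<close>)
  have row0: "(\<Sum>j\<in>insert p J. A i0 j * ext x c j) = c" for x c
    using insert.hyps i0 by (simp add: J) (simp add: ext_def)
  have row: "(\<Sum>j\<in>insert p J. A i j * ext x c j) = (\<Sum>j\<in>J. A' i j * x j) + A i p / A i0 p * c" for i x c
  proof -
    have "(\<Sum>j\<in>J. A' i j * x j) = (\<Sum>j\<in>J. A i j * x j) - A i p / A i0 p * (\<Sum>j\<in>J. A i0 j * x j)"
      by (simp add: A'_def left_diff_distrib sum_subtractf sum_distrib_left mult.assoc)
    moreover have "(\<Sum>j\<in>insert p J. A i j * ext x c j) = A i p * ext x c p + (\<Sum>j\<in>J. A i j * x j)"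
      using insert.hyps by (simp add: J)
    ultimately show ?thesis using i0 by (simp add: ext_def field_simps)
  qed
  have "\<exists>x. \<forall>i\<in>I - {i0}. (\<Sum>j\<in>J. A' i j * x j) = b i - A i p / A i0 p * b i0"
  proof (rule insert.IH)
    show "finite (I - {i0})" using insert.prems by simp
    show "card (I - {i0}) = card J" using insert.prems insert.hyps i0 by simp
    fix x assume x: "\<And>i. i \<in> I - {i0} \<Longrightarrow> (\<Sum>j\<in>J. A' i j * x j) = 0"
    have "(\<Sum>j\<in>insert p J. A i j * ext x 0 j) = 0" if "i \<in> I" for i
      using row0[of x 0] row[of i x 0] x[of i] that by (cases "i = i0") auto
    then have "\<forall>j\<in>insert p J. ext x 0 j = 0" by (rule insert.prems(3))
    then show "\<forall>j\<in>J. x j = 0" using insert.hyps unfolding ext_def by (metis insertCI)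
  qed
  then obtain x where x: "\<forall>i\<in>I - {i0}. (\<Sum>j\<in>J. A' i j * x j) = b i - A i p / A i0 p * b i0" by blast
  have "(\<Sum>j\<in>insert p J. A i j * ext x (b i0) j) = b i" if "i \<in> I" for i
    using row0[of x "b i0"] row[of i x "b i0"] x that by (cases "i = i0") auto
  then show ?case by blast
qed

section \<open>Power series solutions of the initial value problem\<close>

text \<open>The terms are dominated by those of an exponential series:
  \<open>(i + s) div m \<le> i + s\<close>, and the values of \<open>a\<close> that occur are
  bounded by their absolute sum. The base \<open>M\<close> is at least 1 so that its powers
  increase.\<close>

lemma summable_periodic_exponential:
  fixes c :: real and a :: "nat \<Rightarrow> real"
  assumes m: "0 < m"
  shows "summable (\<lambda>i. c ^ ((i + s) div m) * a ((i + s) mod m) / fact i * y ^ i)"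
proof (rule summable_comparison_test')
  define K where "K = (\<Sum>j<m. \<bar>a j\<bar>)"
  define M where "M = 1 + \<bar>c\<bar>"
  show "summable (\<lambda>i. K * M ^ s * (inverse (fact i) * (M * \<bar>y\<bar>) ^ i))"
    by (intro summable_mult summable_exp)
  fix i :: nat
  have 1: "\<bar>c\<bar> ^ ((i + s) div m) \<le> M ^ (i + s)"
  proof -
    have "\<bar>c\<bar> ^ ((i + s) div m) \<le> M ^ ((i + s) div m)" by (rule power_mono) (auto simp: M_def)
    also have "\<dots> \<le> M ^ (i + s)" by (rule power_increasing) (auto simp: M_def div_le_dividend)
    finally show ?thesis .
  qed
  have 2: "\<bar>a ((i + s) mod m)\<bar> \<le> K"
    unfolding K_def by (rule member_le_sum) (use m in auto)
  have "norm (c ^ ((i + s) div m) * a ((i + s) mod m) / fact i * y ^ i) =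
      \<bar>c\<bar> ^ ((i + s) div m) * \<bar>a ((i + s) mod m)\<bar> * (\<bar>y\<bar> ^ i / fact i)"
    by (simp add: abs_mult power_abs)
  also have "\<dots> \<le> M ^ (i + s) * K * (\<bar>y\<bar> ^ i / fact i)"
    using 1 2 by (intro mult_right_mono mult_mono) (auto simp: M_def)
  also have "\<dots> = K * M ^ s * (inverse (fact i) * (M * \<bar>y\<bar>) ^ i)"
    by (simp add: power_add power_mult_distrib divide_inverse mult_ac)
  finally show "norm (c ^ ((i + s) div m) * a ((i + s) mod m) / fact i * y ^ i)
    \<le> K * M ^ s * (inverse (fact i) * (M * \<bar>y\<bar>) ^ i)" .
qed

text \<open>
  The \<open>s\<close>-th derivative of the solution of \<open>u\<^sup>(\<^sup>m\<^sup>) = c u\<close> with \<open>u\<^sup>(\<^sup>i\<^sup>)(-1) = a i\<close> for \<open>i < m\<close>: its Taylor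
  coefficients at \<open>-1\<close> repeat with period \<open>m\<close> up to factors \<open>c\<close>.
\<close>

definition iv_solution :: "nat \<Rightarrow> real \<Rightarrow> (nat \<Rightarrow> real) \<Rightarrow> nat \<Rightarrow> real \<Rightarrow> real" where
  "iv_solution m c a s x = (\<Sum>i. c ^ ((i + s) div m) * a ((i + s) mod m) / fact i * (x + 1) ^ i)"

text \<open>Termwise differentiation cancels one factor of the factorial and shifts the index by
  one, which is the passage from \<open>s\<close> to \<open>Suc s\<close>.\<close>

lemma iv_solution_has_derivative:
  assumes "0 < m"
  shows "(iv_solution m c a s has_real_derivative iv_solution m c a (Suc s) x) (at x)"
proof -
  let ?t = "\<lambda>s i. c ^ ((i + s) div m) * a ((i + s) mod m) / fact i"
  have "diffs (?t s) = ?t (Suc s)"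
    by (rule ext) (simp add: diffs_def field_simps del: of_nat_Suc)
  moreover have "((\<lambda>x. \<Sum>i. ?t s i * x ^ i) has_real_derivative (\<Sum>i. diffs (?t s) i * (x + 1) ^ i)) (at (x + 1))"
    by (rule termdiffs_strong_converges_everywhere) (rule summable_periodic_exponential[OF assms])
  ultimately have "((\<lambda>x. \<Sum>i. ?t s i * x ^ i) has_real_derivative iv_solution m c a (Suc s) x) (at (x + 1))"
    by (simp add: iv_solution_def)
  then show ?thesis
    unfolding DERIV_shift by (simp add: iv_solution_def[abs_def])
qed

lemma iv_solution_periodic:
  assumes "0 < m"
  shows "iv_solution m c a (s + m) x = c * iv_solution m c a s x"
proof -
  have "c ^ ((i + (s + m)) div m) * a ((i + (s + m)) mod m) / fact i * (x + 1) ^ i =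
      c * (c ^ ((i + s) div m) * a ((i + s) mod m) / fact i * (x + 1) ^ i)" for i
    using assms by (simp add: add.assoc[symmetric])
  then show ?thesis
    unfolding iv_solution_def by (simp only: suminf_mult[OF summable_periodic_exponential[OF assms]])
qed

lemma iv_solution_initial: "s < m \<Longrightarrow> iv_solution m c a s (-1) = a s"
  unfolding iv_solution_def by (subst powser_zero[symmetric], simp)

lemma iv_solution_sum:
  assumes "0 < m" "finite J"
  shows "iv_solution m c (\<lambda>i. \<Sum>j\<in>J. y j * a j i) s x = (\<Sum>j\<in>J. y j * iv_solution m c (a j) s x)"
proof -
  have "c ^ ((i + s) div m) * (\<Sum>j\<in>J. y j * a j ((i + s) mod m)) / fact i * (x + 1) ^ i =
      (\<Sum>j\<in>J. y j * (c ^ ((i + s) div m) * a j ((i + s) mod m) / fact i * (x + 1) ^ i))" for i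
    by (simp add: sum_distrib_left sum_distrib_right sum_divide_distrib mult_ac)
  then have "iv_solution m c (\<lambda>i. \<Sum>j\<in>J. y j * a j i) s x =
      (\<Sum>i. \<Sum>j\<in>J. y j * (c ^ ((i + s) div m) * a j ((i + s) mod m) / fact i * (x + 1) ^ i))"
    unfolding iv_solution_def by (simp only:)
  also have "\<dots> = (\<Sum>j\<in>J. \<Sum>i. y j * (c ^ ((i + s) div m) * a j ((i + s) mod m) / fact i * (x + 1) ^ i))"
    by (rule suminf_sum) (intro summable_mult summable_periodic_exponential[OF assms(1)])
  also have "\<dots> = (\<Sum>j\<in>J. y j * iv_solution m c (a j) s x)"
    unfolding iv_solution_def
    by (intro sum.cong refl suminf_mult summable_periodic_exponential[OF assms(1)])
  finally show ?thesis .
qed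

text \<open>
  The boundary form \<open>B\<close> is an antiderivative of \<open>- (\<lambda> W\<^sub>0\<^sup>2 + W\<^sub>r\<^sup>2)\<close>, hence monotone, and vanishes at both ends.
\<close>

lemma homogeneous_bvp_trivial:
  fixes W :: "nat \<Rightarrow> real \<Rightarrow> real"
  assumes r: "0 < r" and lam: "0 < lam"
    and W: "\<And>j x. Suc j < 2 * r \<Longrightarrow> x \<in> \<II> \<Longrightarrow> (W j has_vector_derivative W (Suc j) x) (at x within \<II>)"
    and c: "continuous_on \<II> (W (2 * r - 1))"
    and D: "\<And>x. x \<in> {-1<..<1} \<Longrightarrow> (W (2 * r - 1) has_vector_derivative D x) (at x within \<II>)"
    and ode: "\<And>x. x \<in> {-1<..<1} \<Longrightarrow> (-1) ^ r * D x + lam * W 0 x = 0"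
    and bc: "\<And>s. s < r \<Longrightarrow> W s (-1) = 0" "\<And>s. s < r \<Longrightarrow> W s 1 = 0"
    and x: "x \<in> \<II>"
  shows "W 0 x = 0"
proof -
  have Wc: "continuous_on \<II> (W j)" if "j < 2 * r" for j
  proof (cases "Suc j < 2 * r")
    case True
    then show ?thesis by (intro continuous_on_vector_derivative[OF W])
  next
    case False
    then have "j = 2 * r - 1" using that by simp
    then show ?thesis using c by simp
  qed
  define B where "B x = (-1) ^ r * (\<Sum>s<r. (-1) ^ s * (W s x * W (2 * r - Suc s) x))" for x
  have Bc: "continuous_on \<II> B" unfolding B_def using r by (intro continuous_intros Wc) auto
  have der: "(B has_real_derivative - (lam * (W 0 x)\<^sup>2 + (W r x)\<^sup>2)) (at x)" if x: "x \<in> {-1<..<1}" for x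
  proof -
    have xI: "x \<in> \<II>" using x by simp
    \<comment> \<open>At \<open>s = 0\<close> the derivative of order \<open>2 * r\<close> is
      \<open>D x\<close>; the ladder \<open>W\<close> is only known up to order
      \<open>2 * r - 1\<close>.\<close>
    define T where "T s = (-1) ^ s * (W s x * (if s = 0 then D x else W (2 * r - s) x))" for s
    have fd: "(W (2 * r - Suc s) has_vector_derivative (if s = 0 then D x else W (2 * r - s) x)) (at x within \<II>)" if "s < r" for s
    proof (cases "s = 0")
      case False
      then have "Suc (2 * r - Suc s) = 2 * r - s" "Suc (2 * r - Suc s) < 2 * r" using that by auto
      then show ?thesis using W[of "2 * r - Suc s" x] xI False by simp
    qed (use D[OF x] in simp)
    have "((\<lambda>x. (-1) ^ s * (W s x * W (2 * r - Suc s) x)) has_vector_derivative T s - T (Suc s)) (at x within \<II>)"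
      if "s < r" for s
    proof -
      have "((\<lambda>x. (-1) ^ s * (W s x * W (2 * r - Suc s) x)) has_vector_derivative
          (-1) ^ s * (W s x * (if s = 0 then D x else W (2 * r - s) x) + W (Suc s) x * W (2 * r - Suc s) x)) (at x within \<II>)"
        using W[of s x] fd[OF that] xI that
        by (intro has_vector_derivative_mult_right has_vector_derivative_mult) auto
      then show ?thesis by (simp add: T_def algebra_simps)
    qed
    then have "(B has_vector_derivative (-1) ^ r * (\<Sum>s<r. T s - T (Suc s))) (at x within \<II>)"
      unfolding B_def by (intro has_vector_derivative_mult_right has_vector_derivative_sum) simp
    moreover have "(-1) ^ r * (\<Sum>s<r. T s - T (Suc s)) = - (lam * (W 0 x)\<^sup>2 + (W r x)\<^sup>2)"
    proof -
      have "(-1) ^ r * (\<Sum>s<r. T s - T (Suc s)) = ((-1) ^ r * D x) * W 0 x - ((-1) ^ r * (-1) ^ r) * (W r x)\<^sup>2"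
        unfolding sum_lessThan_telescope' using r by (simp add: T_def power2_eq_square algebra_simps mult_2)
      also have "(-1) ^ r * D x = - (lam * W 0 x)" using ode[OF x] by linarith
      also have "(-1) ^ r * (-1) ^ r = (1::real)" by (simp flip: power_mult_distrib)
      finally show ?thesis by (simp add: power2_eq_square)
    qed
    moreover have "at x within \<II> = at x" using x by (intro at_within_interior) simp
    ultimately show ?thesis by (simp add: has_real_derivative_iff_has_vector_derivative)
  qed
  have np: "- (lam * (W 0 x)\<^sup>2 + (W r x)\<^sup>2) \<le> 0" for x
  proof -
    have "0 \<le> lam * (W 0 x)\<^sup>2" using lam by simp
    then show ?thesis using zero_le_power2[of "W r x"] by linarith
  qed
  have B1: "B (-1) = 0" "B 1 = 0" unfolding B_def using bc by auto
  have dec: "B y \<le> B x" if "-1 \<le> x" "x \<le> y" "y \<le> 1" for x y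
  proof (rule DERIV_nonpos_imp_decreasing_open[OF that(2)])
    show "\<exists>d. (B has_real_derivative d) (at z) \<and> d \<le> 0" if "x < z" "z < y" for z
      using der[of z] np[of z] that \<open>-1 \<le> x\<close> \<open>y \<le> 1\<close> by auto
    show "continuous_on {x..y} B" by (rule continuous_on_subset[OF Bc]) (use that in auto)
  qed
  have B0: "B y = 0" if "y \<in> \<II>" for y
    using dec[of "-1" y] dec[of y 1] that B1 by auto
  show ?thesis
  proof (cases "x \<in> {-1<..<1}")
    case True
    \<comment> \<open>\<open>B\<close> vanishes on the whole interval, so its derivative, a negative
      definite form in \<open>W 0 x\<close> and \<open>W r x\<close>, is 0 at interior
      points.\<close>
    have "(B has_real_derivative 0) (at x)"
    proof (rule DERIV_cong_ev[THEN iffD1, of x x "\<lambda>_. 0" B 0 0])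
      have "\<forall>\<^sub>F y in nhds x. y \<in> {-1<..<1}" using True by (intro eventually_nhds_in_open) auto
      then show "\<forall>\<^sub>F y in nhds x. 0 = B y" by eventually_elim (simp add: B0)
    qed auto
    then have "- (lam * (W 0 x)\<^sup>2 + (W r x)\<^sup>2) = 0" using der[OF True] DERIV_unique by blast
    then have "lam * (W 0 x)\<^sup>2 = 0" using lam by (smt (verit) mult_nonneg_nonneg zero_le_power2)
    then show ?thesis using lam by simp
  next
    case False
    then have "x = -1 \<or> x = 1" using x by auto
    then show ?thesis using bc r by auto
  qed
qed

lemma neg_one_power_mult_cancel: "(-1) ^ r * ((-1) ^ r * x) = (x :: real)"
proof -
  have "(-1) ^ r * (-1) ^ r = (1 :: real)" by (simp flip: power_mult_distrib)
  then show ?thesis by (simp add: mult.assoc[symmetric])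
qed

section \<open>Existence and uniqueness for the boundary value problem\<close>

text \<open>By uniqueness the solution vanishes on the interval; its initial values are its
  derivatives at -1 and vanish with it.\<close>

lemma iv_solution_homogeneous_bvp_trivial:
  assumes r: "0 < r" and lam: "0 < lam"
    and a: "\<And>s. s < r \<Longrightarrow> a s = 0"
    and one: "\<And>s. s < r \<Longrightarrow> iv_solution (2 * r) (- ((-1) ^ r * lam)) a s 1 = 0"
    and s: "s < 2 * r"
  shows "a s = 0"
proof -
  let ?W = "iv_solution (2 * r) (- ((-1) ^ r * lam)) a"
  have m: "0 < 2 * r" using r by simp
  have der: "(?W j has_vector_derivative ?W (Suc j) x) (at x within \<II>)" for j x
    using iv_solution_has_derivative[OF m]
    unfolding has_real_derivative_iff_has_vector_derivative by (rule has_vector_derivative_at_within)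
  have top: "(?W (2 * r - 1) has_vector_derivative ?W (2 * r) x) (at x within \<II>)" for x
    using der[of "2 * r - 1" x] r by simp
  have ode: "(-1) ^ r * ?W (2 * r) x + lam * ?W 0 x = 0" for x
    using iv_solution_periodic[OF m, of "- ((-1) ^ r * lam)" a 0 x]
    by (simp add: mult.assoc neg_one_power_mult_cancel)
  have neg: "?W s (-1) = 0" if "s < r" for s
    using iv_solution_initial[of s "2 * r"] a[OF that] that by simp
  have W0: "?W 0 x = 0" if "x \<in> \<II>" for x
    by (rule homogeneous_bvp_trivial[OF r lam der continuous_on_vector_derivative[OF der] top ode neg one that])
  have "nderiv s (?W 0) (-1) = ?W s (-1)"
    by (rule nderiv_eqI[where F = ?W and m = s]) (use der in auto)
  moreover have "nderiv s (?W 0) (-1) = 0"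
    by (rule nderiv_eqI[where F = "\<lambda>_ _. 0" and m = s]) (use W0 in auto)
  ultimately show ?thesis using iv_solution_initial[OF s] by simp
qed

text \<open>Shooting from -1: the first \<open>r\<close> initial values are prescribed, the next
  \<open>r\<close> are the unknowns, and the \<open>r\<close> conditions at 1 form a square linear
  system for them. Its kernel is trivial because the homogeneous problem has only the zero
  solution.\<close>

lemma bvp_solution_exists:
  fixes a :: "nat \<Rightarrow> real"
  assumes r: "0 < r" and lam: "0 < lam"
  obtains U :: "nat \<Rightarrow> real \<Rightarrow> real" where
    "\<And>s x. (U s has_vector_derivative U (Suc s) x) (at x)"
    "\<And>s x. U (s + 2 * r) x = - ((-1) ^ r * lam) * U s x"
    "\<And>s. s < r \<Longrightarrow> U s (-1) = a s" "\<And>s. s < r \<Longrightarrow> U s 1 = 0"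
proof -
  define c where "c = - ((-1) ^ r * lam)"
  define m where "m = 2 * r"
  have m: "0 < m" using r by (simp add: m_def)
  define e where "e j = iv_solution m c (\<lambda>i. if i = j then 1 else 0)" for j :: nat
  define sol where "sol J z = iv_solution m c (\<lambda>i. \<Sum>j\<in>J. z j * (if i = j then 1 else 0))" for J :: "nat set" and z :: "nat \<Rightarrow> real"
  have sol_sum: "sol J z s x = (\<Sum>j\<in>J. z j * e j s x)" if "finite J" for J z s x
    unfolding sol_def e_def by (rule iv_solution_sum[OF m that])
  have sol_der: "(sol J z s has_vector_derivative sol J z (Suc s) x) (at x)" for J z s x
    using iv_solution_has_derivative[OF m] unfolding sol_def has_real_derivative_iff_has_vector_derivative .
  have sol_per: "sol J z (s + m) x = c * sol J z s x" for J z s x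
    unfolding sol_def by (rule iv_solution_periodic[OF m])
  have sol_init: "sol J z s (-1) = (if s \<in> J then z s else 0)" if "finite J" "s < m" for J z s
    unfolding sol_def iv_solution_initial[OF that(2)] using that(1) by (simp add: if_distrib cong: if_cong)
  have "\<exists>y. \<forall>s\<in>{..<r}. (\<Sum>j\<in>{r..<m}. e j s 1 * y j) = - (\<Sum>j<r. a j * e j s 1)"
  proof (rule square_system_solvable)
    show "card {..<r} = card {r..<m}" by (simp add: m_def)
    fix y assume y: "\<And>s. s \<in> {..<r} \<Longrightarrow> (\<Sum>j\<in>{r..<m}. e j s 1 * y j) = 0"
    let ?a = "\<lambda>i. \<Sum>j\<in>{r..<m}. y j * (if i = j then 1 else 0)"
    have ay: "?a j = (if j \<in> {r..<m} then y j else 0)" for j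
      by (simp add: if_distrib cong: if_cong)
    have a0: "?a j = 0" if "j < 2 * r" for j
    proof (rule iv_solution_homogeneous_bvp_trivial[OF r lam _ _ that])
      show "?a s = 0" if "s < r" for s unfolding ay using that by simp
      show "iv_solution (2 * r) (- ((-1) ^ r * lam)) ?a s 1 = 0" if "s < r" for s
        using sol_sum[of "{r..<m}" y s 1] y[of s] that unfolding sol_def m_def c_def by (simp add: mult.commute)
    qed
    show "\<forall>j\<in>{r..<m}. y j = 0"
    proof
      fix j assume "j \<in> {r..<m}"
      then show "y j = 0" using a0[of j] ay[of j] by (simp add: m_def)
    qed
  qed auto
  then obtain y where y: "\<And>s. s < r \<Longrightarrow> (\<Sum>j\<in>{r..<m}. e j s 1 * y j) = - (\<Sum>j<r. a j * e j s 1)" by auto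
  define z where "z j = (if j < r then a j else y j)" for j
  show thesis
  proof (rule that[of "sol {..<m} z"])
    show "(sol {..<m} z s has_vector_derivative sol {..<m} z (Suc s) x) (at x)" for s x by (rule sol_der)
    show "sol {..<m} z (s + 2 * r) x = - ((-1) ^ r * lam) * sol {..<m} z s x" for s x
      using sol_per[of "{..<m}" z s x] by (simp add: m_def c_def)
    show "sol {..<m} z s (-1) = a s" if "s < r" for s
      using that by (subst sol_init) (auto simp: m_def z_def)
    show "sol {..<m} z s 1 = 0" if s: "s < r" for s
    proof -
      have split: "{..<m} = {..<r} \<union> {r..<m}" "{..<r} \<inter> {r..<m} = {}" by (auto simp: m_def)
      have "sol {..<m} z s 1 = (\<Sum>j\<in>{..<r} \<union> {r..<m}. z j * e j s 1)" unfolding split(1)[symmetric] by (rule sol_sum) simp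
      also have "\<dots> = (\<Sum>j<r. z j * e j s 1) + (\<Sum>j\<in>{r..<m}. z j * e j s 1)"
        by (rule sum.union_disjoint) (use split in auto)
      also have "(\<Sum>j<r. z j * e j s 1) = (\<Sum>j<r. a j * e j s 1)" by (rule sum.cong) (auto simp: z_def)
      also have "(\<Sum>j\<in>{r..<m}. z j * e j s 1) = (\<Sum>j\<in>{r..<m}. e j s 1 * y j)" by (rule sum.cong) (auto simp: z_def)
      finally show ?thesis using y[OF s] by simp
    qed
  qed
qed

text \<open>The derivative ladders of two solutions differ by a solution of the homogeneous
  problem.\<close>

lemma is_bvp_sol_unique:
  assumes r: "0 < r" and lam: "0 < lam" and u: "is_bvp_sol r k lam u" and v: "is_bvp_sol r k lam v" and x: "x \<in> \<II>"
  shows "u x = v x"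
proof -
  define W where "W j x = nderiv j u x - nderiv j v x" for j x
  have uS: "u \<in> L2_sobolev (2 * r)" and vS: "v \<in> L2_sobolev (2 * r)" using u v by (auto simp: is_bvp_sol_def)
  have "W 0 x = 0"
  proof (rule homogeneous_bvp_trivial[OF r lam, where W = W and D = "\<lambda>x. nderiv (2 * r) u x - nderiv (2 * r) v x"])
    show "(W j has_vector_derivative W (Suc j) x) (at x within \<II>)" if "Suc j < 2 * r" "x \<in> \<II>" for j x
      unfolding W_def[abs_def]
      by (intro has_vector_derivative_diff L2_sobolev_has_vector_derivative[OF uS that] L2_sobolev_has_vector_derivative[OF vS that])
    show "continuous_on \<II> (W (2 * r - 1))"
      unfolding W_def[abs_def] using r by (intro continuous_on_diff L2_sobolev_continuous_on[OF uS] L2_sobolev_continuous_on[OF vS]) auto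
    have d: "(nderiv (2 * r - 1) w has_vector_derivative nderiv (2 * r) w x) (at x within \<II>)"
      if "is_bvp_sol r k lam w" "x \<in> {-1<..<1}" for w x
      using that nderiv_Suc[of "2 * r - 1" w x] r by (simp add: is_bvp_sol_def vector_derivative_works)
    show "(W (2 * r - 1) has_vector_derivative nderiv (2 * r) u x - nderiv (2 * r) v x) (at x within \<II>)"
      if "x \<in> {-1<..<1}" for x
      unfolding W_def[abs_def] by (intro has_vector_derivative_diff d u v that)
    have e: "(-1) ^ r * nderiv (2 * r) w x + lam * w x = 0" if "is_bvp_sol r k lam w" "x \<in> {-1<..<1}" for w x
      using that by (simp add: is_bvp_sol_def)
    show "(-1) ^ r * (nderiv (2 * r) u x - nderiv (2 * r) v x) + lam * W 0 x = 0" if "x \<in> {-1<..<1}" for x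
      using e[OF u that] e[OF v that] by (simp add: W_def algebra_simps)
    show "W s (-1) = 0" "W s 1 = 0" if "s < r" for s
      using u v that by (auto simp: W_def is_bvp_sol_def)
  qed (rule x)
  then show ?thesis by (simp add: W_def)
qed

text \<open>For \<open>k = 0\<close> the exponent is -1, hence the integer power; the natural
  exponent \<open>Suc k\<close> has the same parity.\<close>

lemma neg_one_powi_pred: "(-1) powi (int k - 1) = ((-1) ^ Suc k :: real)"
proof (cases k)
  case (Suc n)
  then have "int k - 1 = int n" by simp
  then show ?thesis using Suc by (simp only: power_int_of_nat) simp
qed simp

text \<open>Existence and uniqueness turn the definite description \<open>bvp_sol\<close> into an
  actual solution. The ladder \<open>U\<close> gives all its derivatives on the closed interval,
  whereas the boundary value problem states the equation only inside.\<close>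

lemma bvp_sol_ladder:
  assumes r: "0 < r" and lam: "0 < lam"
  obtains U :: "nat \<Rightarrow> real \<Rightarrow> real" where
    "\<And>s x. (U s has_vector_derivative U (Suc s) x) (at x)"
    "\<And>s x. U (s + 2 * r) x = - ((-1) ^ r * lam) * U s x"
    "\<And>s. s < r \<Longrightarrow> U s (-1) = (-1) ^ Suc k * (if s = r - k - 1 then 1 else 0)"
    "\<And>s. s < r \<Longrightarrow> U s 1 = 0"
    "\<And>x s. x \<in> \<II> \<Longrightarrow> nderiv s (bvp_sol r k lam) x = U s x"
proof -
  show thesis
  proof (rule bvp_solution_exists[OF r lam, of "\<lambda>s. (-1) ^ Suc k * (if s = r - k - 1 then 1 else 0)"])
    fix U :: "nat \<Rightarrow> real \<Rightarrow> real"
    assume der: "\<And>s x. (U s has_vector_derivative U (Suc s) x) (at x)"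
      and per: "\<And>s x. U (s + 2 * r) x = - ((-1) ^ r * lam) * U s x"
      and bc: "\<And>s. s < r \<Longrightarrow> U s (-1) = (-1) ^ Suc k * (if s = r - k - 1 then 1 else 0)" "\<And>s. s < r \<Longrightarrow> U s 1 = 0"
    have derI: "(U s has_vector_derivative U (Suc s) x) (at x within \<II>)" for s x
      by (rule has_vector_derivative_at_within[OF der])
    \<comment> \<open>Extension by 0 matches the normalisation in \<open>bvp_sol\<close>.\<close>
    define u where "u x = (if x \<in> \<II> then U 0 x else 0)" for x
    have nd: "nderiv s u x = U s x" if "x \<in> \<II>" for s x
      by (rule nderiv_eqI[where m = s]) (use derI that in \<open>auto simp: u_def\<close>)
    have sol: "is_bvp_sol r k lam u"
      unfolding is_bvp_sol_def neg_one_powi_pred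
    proof (intro conjI ballI allI impI)
      show "u \<in> L2_sobolev (2 * r)"
      proof (rule L2_sobolevI[where F = U])
        show "continuous_on \<II> (U (2 * r))" by (rule continuous_on_vector_derivative[OF derI])
        show "(U j has_vector_derivative U (Suc j) x) (at x within \<II>)" for j x by (rule derI)
      qed (use r in \<open>auto simp: u_def\<close>)
      fix x :: real assume "x \<in> {-1<..<1}"
      then have x: "x \<in> \<II>" by simp
      have "(nderiv (2 * r - 1) u has_vector_derivative U (Suc (2 * r - 1)) x) (at x within \<II>)"
        by (rule has_vector_derivative_transform[OF _ _ derI]) (use x nd in \<open>simp_all\<close>)
      then show "nderiv (2 * r - 1) u differentiable (at x within \<II>)" by (rule differentiableI_vector)
      show "(-1) ^ r * nderiv (2 * r) u x + lam * u x = 0"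
        using per[of 0 x] nd[OF x, of "2 * r"] nd[OF x, of 0] by (simp add: mult.assoc neg_one_power_mult_cancel)
    next
      fix s assume "s < r"
      then show "nderiv s u (-1) = (-1) ^ Suc k * (if s = r - k - 1 then 1 else 0)" "nderiv s u 1 = 0"
        using nd bc by auto
    qed
    have eq: "bvp_sol r k lam = u"
      unfolding bvp_sol_def
    proof (rule the_equality)
      show "is_bvp_sol r k lam u \<and> (\<forall>x. x \<notin> \<II> \<longrightarrow> u x = 0)" using sol by (simp add: u_def)
      fix v assume v: "is_bvp_sol r k lam v \<and> (\<forall>x. x \<notin> \<II> \<longrightarrow> v x = 0)"
      show "v = u"
      proof
        fix x show "v x = u x"
          using is_bvp_sol_unique[OF r lam, of k v u x] v sol by (cases "x \<in> \<II>") (auto simp: u_def)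
      qed
    qed
    show thesis by (rule that[OF der per bc]) (simp_all add: eq nd)
  qed
qed

section \<open>Representation of the functional by the solution\<close>

lemma bvp_sol_L2:
  assumes "0 < r" "0 < lam"
  shows "nderiv s (bvp_sol r k lam) \<in> L2"
proof (rule bvp_sol_ladder[OF assms, of k])
  fix U assume der: "\<And>s x. (U s has_vector_derivative U (Suc s) x) (at x)"
    and eq: "\<And>x s. x \<in> \<II> \<Longrightarrow> nderiv s (bvp_sol r k lam) x = U s x"
  have "continuous_on \<II> (U s)"
    by (rule continuous_on_vector_derivative[OF has_vector_derivative_at_within[OF der]])
  then have "U s \<in> L2" by (rule continuous_imp_L2)
  then show "nderiv s (bvp_sol r k lam) \<in> L2" using L2_cong[of "nderiv s (bvp_sol r k lam)" "U s"] eq by simp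
qed

text \<open>In Green's formula all terms at 1 vanish, and at -1 only \<open>s = r - k - 1\<close>
  survives, where \<open>f\<close> is differentiated \<open>r - Suc s = k\<close> times. The sign in
  the boundary condition is such that the total sign is \<open>(-1) ^ r\<close>, independent of
  \<open>k\<close>.\<close>

lemma bvp_sol_representation:
  assumes r: "0 < r" and k: "k < r" and lam: "0 < lam" and f: "f \<in> L2_sobolev r"
  shows "nderiv k f (-1) =
    inner2 (nderiv r (bvp_sol r k lam)) f - (-1) ^ r * inner2 (bvp_sol r k lam) (nderiv r f)"
proof (rule bvp_sol_ladder[OF r lam, of k])
  fix U assume der: "\<And>s x. (U s has_vector_derivative U (Suc s) x) (at x)"
    and bc: "\<And>s. s < r \<Longrightarrow> U s (-1) = (-1) ^ Suc k * (if s = r - k - 1 then 1 else 0)" "\<And>s. s < r \<Longrightarrow> U s 1 = 0"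
    and eq: "\<And>x s. x \<in> \<II> \<Longrightarrow> nderiv s (bvp_sol r k lam) x = U s x"
  have derI: "(U s has_vector_derivative U (Suc s) x) (at x within \<II>)" for s x
    by (rule has_vector_derivative_at_within[OF der])
  have G: "inner2 (U 0) (nderiv r f) - (-1) ^ r * inner2 (U r) f =
    (\<Sum>s<r. (-1) ^ s * (U s 1 * nderiv (r - Suc s) f 1)) -
    (\<Sum>s<r. (-1) ^ s * (U s (-1) * nderiv (r - Suc s) f (-1)))"
    by (rule Green_formula[where U = U, OF f r derI continuous_on_vector_derivative[OF derI]])
  have S1: "(\<Sum>s<r. (-1) ^ s * (U s 1 * nderiv (r - Suc s) f 1)) = 0" using bc(2) by (intro sum.neutral) simp
  have S2: "(\<Sum>s<r. (-1) ^ s * (U s (-1) * nderiv (r - Suc s) f (-1))) = (-1) ^ r * nderiv k f (-1)"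
  proof -
    have "(\<Sum>s<r. (-1) ^ s * (U s (-1) * nderiv (r - Suc s) f (-1))) =
        (\<Sum>s<r. if s = r - k - 1 then (-1) ^ s * (-1) ^ Suc k * nderiv (r - Suc s) f (-1) else 0)"
      using bc(1) by (intro sum.cong) auto
    also have "\<dots> = (-1) ^ (r - k - 1) * (-1) ^ Suc k * nderiv k f (-1)"
      using k by (subst sum.delta) (auto simp: Suc_diff_Suc)
    also have "(-1) ^ (r - k - 1) * (-1) ^ Suc k = ((-1) ^ r :: real)"
    proof -
      have "r - k - 1 + Suc k = r" using k by simp
      then show ?thesis by (simp only: power_add[symmetric])
    qed
    finally show ?thesis .
  qed
  have "(-1) ^ r * nderiv k f (-1) = (-1) ^ r * inner2 (U r) f - inner2 (U 0) (nderiv r f)"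
    using G unfolding S1 S2 by linarith
  then have "(-1) ^ r * ((-1) ^ r * nderiv k f (-1)) = (-1) ^ r * ((-1) ^ r * inner2 (U r) f - inner2 (U 0) (nderiv r f))"
    by (simp only:)
  then have "nderiv k f (-1) = inner2 (U r) f - (-1) ^ r * inner2 (U 0) (nderiv r f)"
    by (simp only: right_diff_distrib neg_one_power_mult_cancel)
  moreover have "inner2 (U r) f = inner2 (nderiv r (bvp_sol r k lam)) f"
    by (rule inner2_cong) (simp_all add: eq)
  moreover have "inner2 (U 0) (nderiv r f) = inner2 (bvp_sol r k lam) (nderiv r f)"
    using eq[of _ 0] by (intro inner2_cong) simp_all
  ultimately show ?thesis by simp
qed

text \<open>These multiples are the candidates for extremal functions. The differential equation
  expresses their derivative of order \<open>r\<close> by the solution itself, at the end points as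
  well because the ladder satisfies it there.\<close>

lemma bvp_sol_nderiv_L2_sobolev:
  assumes r: "0 < r" and lam: "0 < lam"
  shows "(\<lambda>x. c * nderiv r (bvp_sol r k lam) x) \<in> L2_sobolev r"
    and "x \<in> \<II> \<Longrightarrow> nderiv r (\<lambda>x. c * nderiv r (bvp_sol r k lam) x) x = - ((-1) ^ r * (c * lam)) * bvp_sol r k lam x"
proof -
  have "(\<lambda>x. c * nderiv r (bvp_sol r k lam) x) \<in> L2_sobolev r \<and>
    (\<forall>x\<in>\<II>. nderiv r (\<lambda>x. c * nderiv r (bvp_sol r k lam) x) x = - ((-1) ^ r * (c * lam)) * bvp_sol r k lam x)"
  proof (rule bvp_sol_ladder[OF r lam, of k])
    fix U assume der: "\<And>s x. (U s has_vector_derivative U (Suc s) x) (at x)"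
      and per: "\<And>s x. U (s + 2 * r) x = - ((-1) ^ r * lam) * U s x"
      and eq: "\<And>x s. x \<in> \<II> \<Longrightarrow> nderiv s (bvp_sol r k lam) x = U s x"
    define F where "F j x = c * U (r + j) x" for j x
    have F: "(F j has_vector_derivative F (Suc j) x) (at x within \<II>)" for j x
      unfolding F_def[abs_def] using has_vector_derivative_at_within[OF der, of "r + j"]
      by (intro has_vector_derivative_mult_right) simp
    have F0: "F 0 x = c * nderiv r (bvp_sol r k lam) x" if "x \<in> \<II>" for x
      using eq[OF that] by (simp add: F_def)
    have "nderiv r (\<lambda>x. c * nderiv r (bvp_sol r k lam) x) x = - ((-1) ^ r * (c * lam)) * bvp_sol r k lam x"
      if "x \<in> \<II>" for x
    proof -
      have "nderiv r (\<lambda>x. c * nderiv r (bvp_sol r k lam) x) x = F r x"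
        by (rule nderiv_eqI[where F = F and m = r, OF F0 F]) (use that in auto)
      also have "\<dots> = c * (- ((-1) ^ r * lam) * U 0 x)" using per[of 0 x] by (simp add: F_def mult_2)
      finally show ?thesis using eq[OF that, of 0] by simp
    qed
    moreover have "(\<lambda>x. c * nderiv r (bvp_sol r k lam) x) \<in> L2_sobolev r"
      by (rule L2_sobolevI[where F = F, OF r F0 F continuous_on_vector_derivative[OF F]])
    ultimately show ?thesis by blast
  qed
  then show "(\<lambda>x. c * nderiv r (bvp_sol r k lam) x) \<in> L2_sobolev r"
    and "x \<in> \<II> \<Longrightarrow> nderiv r (\<lambda>x. c * nderiv r (bvp_sol r k lam) x) x = - ((-1) ^ r * (c * lam)) * bvp_sol r k lam x"
    by auto
qed

section \<open>Test functions for the functional\<close>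

text \<open>The witness is \<open>(x + 1) ^ k / fact k\<close>. It removes the second term of the
  representation while the functional takes the value 1, so it isolates the pairing with the
  derivative of order \<open>r\<close> of the solution.\<close>

lemma shifted_monomial_L2_sobolev:
  assumes k: "k < r"
  obtains p where "p \<in> L2_sobolev r" "nderiv k p (-1) = 1" "\<And>x. x \<in> \<II> \<Longrightarrow> nderiv r p x = 0"
proof -
  define F where "F j x = (if j \<le> k then (x + 1) ^ (k - j) / fact (k - j) else (0 :: real))" for j x
  have F: "(F j has_vector_derivative F (Suc j) x) (at x within \<II>)" for j x
  proof (cases "j < k")
    case True
    then obtain n where n: "k - j = Suc n" by (metis Suc_diff_Suc)
    have "((\<lambda>x. (x + 1) ^ Suc n / fact (Suc n)) has_real_derivative (x + 1) ^ n / fact n) (at x within \<II>)"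
      by (rule derivative_eq_intros refl | simp)+
    moreover have "k - Suc j = n" using n by simp
    ultimately show ?thesis
      using True n unfolding F_def[abs_def] has_real_derivative_iff_has_vector_derivative by simp
  next
    case False
    then have "F j = (\<lambda>x. if j = k then 1 else 0)" "F (Suc j) x = 0" by (auto simp: F_def fun_eq_iff)
    then show ?thesis by simp
  qed
  have nd: "nderiv n (F 0) x = F n x" if "x \<in> \<II>" for n x
    by (rule nderiv_eqI[where F = F and m = n]) (use F that in auto)
  show thesis
  proof (rule that[of "F 0"])
    show "F 0 \<in> L2_sobolev r"
      by (rule L2_sobolevI[where F = F, OF _ _ F continuous_on_vector_derivative[OF F]]) (use k in auto)
    show "nderiv k (F 0) (-1) = 1" using nd[of "-1" k] by (simp add: F_def)
    show "nderiv r (F 0) x = 0" if "x \<in> \<II>" for x using nd[OF that, of r] k by (simp add: F_def)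
  qed
qed

lemma norm2_shifted_exp:
  assumes N: "0 < N"
  shows "(norm2 (\<lambda>x. exp (- (N * (x + 1)))))\<^sup>2 \<le> 1 / (2 * N)"
proof -
  let ?f = "\<lambda>x. exp (- (N * (x + 1)))"
  let ?G = "\<lambda>x. - (exp (- (2 * N * (x + 1))) / (2 * N))"
  have "(?G has_real_derivative ?f x * ?f x) (at x within \<II>)" for x
  proof -
    have "(?G has_real_derivative exp (- (2 * N * (x + 1)))) (at x within \<II>)"
      using N by (auto intro!: derivative_eq_intros)
    moreover have "exp (- (2 * N * (x + 1))) = ?f x * ?f x" by (simp add: exp_add[symmetric] algebra_simps)
    ultimately show ?thesis by simp
  qed
  then have "((\<lambda>x. ?f x * ?f x) has_integral (?G 1 - ?G (-1))) \<II>"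
    by (intro fundamental_theorem_of_calculus) (auto simp: has_real_derivative_iff_has_vector_derivative)
  moreover have "?f \<in> L2" by (rule continuous_imp_L2) (intro continuous_intros)
  then have "((\<lambda>x. ?f x * ?f x) has_integral inner2 ?f ?f) \<II>" by (intro inner2_has_integral)
  ultimately have "inner2 ?f ?f = ?G 1 - ?G (-1)" by (rule has_integral_unique[symmetric])
  then show ?thesis unfolding norm2_power2 using N by simp
qed

text \<open>The function \<open>exp (- (N * (x + 1)))\<close> concentrates at -1 as \<open>N\<close>
  grows: divided by \<open>(- N) ^ k\<close> it has derivative of order \<open>k\<close> equal to 1
  there, while its norm tends to 0.\<close>

lemma nderiv_unbounded_L2:
  assumes r: "0 < r" and e: "0 < e"
  obtains f where "f \<in> L2_sobolev r" "nderiv k f (-1) = 1" "norm2 f \<le> e"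
proof -
  \<comment> \<open>\<open>N \<ge> 1\<close> makes the factor \<open>1 / N ^ k\<close> at most 1;
    the other bound makes the norm of the exponential at most \<open>e\<close>.\<close>
  define N where "N = max 1 (1 / (2 * e\<^sup>2))"
  have N: "1 \<le> N" "1 / (2 * e\<^sup>2) \<le> N" by (auto simp: N_def)
  let ?g = "\<lambda>x. exp (- (N * (x + 1)))"
  define F where "F j x = (- N) ^ j / (- N) ^ k * ?g x" for j x
  have F: "(F j has_vector_derivative F (Suc j) x) (at x within \<II>)" for j x
    unfolding F_def[abs_def] has_real_derivative_iff_has_vector_derivative[symmetric]
    by (rule derivative_eq_intros refl | simp)+
  have nd: "nderiv n (F 0) x = F n x" if "x \<in> \<II>" for n x
    by (rule nderiv_eqI[where F = F and m = n]) (use F that in auto)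
  show thesis
  proof (rule that[of "F 0"])
    show "F 0 \<in> L2_sobolev r"
      by (rule L2_sobolevI[where F = F, OF r _ F continuous_on_vector_derivative[OF F]]) simp
    show "nderiv k (F 0) (-1) = 1" using nd[of "-1" k] N by (simp add: F_def)
    have "F 0 = (\<lambda>x. 1 / (- N) ^ k * ?g x)" by (simp add: F_def[abs_def])
    then have "norm2 (F 0) = \<bar>1 / (- N) ^ k\<bar> * norm2 ?g" by (simp only: norm2_cmult)
    also have "\<dots> \<le> 1 * norm2 ?g"
    proof (rule mult_right_mono)
      show "\<bar>1 / (- N) ^ k\<bar> \<le> 1" using N(1) one_le_power[of N k] by (simp add: power_abs[symmetric] abs_divide)
    qed (rule norm2_nonneg)
    also have "norm2 ?g \<le> e"
    proof (rule power2_le_imp_le)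
      have "(norm2 ?g)\<^sup>2 \<le> 1 / (2 * N)" using N by (intro norm2_shifted_exp) simp
      also have "\<dots> \<le> e\<^sup>2" using N e by (simp add: field_simps)
      finally show "(norm2 ?g)\<^sup>2 \<le> e\<^sup>2" .
    qed (use e in simp)
    finally show "norm2 (F 0) \<le> e" by simp
  qed
qed

section \<open>The balanced parameter\<close>

text \<open>In the application \<open>a l\<close> and \<open>b l\<close> are the norms of the
  derivative of order \<open>r\<close> of the solution and of the solution itself, and
  \<open>cross\<close> is Cauchy-Schwarz in \<open>bvp_sol_cross\<close>. Minimisation requires
  continuity of the combination \<open>E\<close> alone instead of continuity of \<open>a\<close> and
  \<open>b\<close>; \<open>E\<close> is continuous as an infimum of affine functions of
  \<open>l\<close>.\<close>

lemma exists_balanced_parameter: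
  fixes a b :: "real \<Rightarrow> real"
  assumes \<delta>: "0 < \<delta>" and c0: "0 < c0" and a: "\<And>l. 0 < l \<Longrightarrow> c0 \<le> a l" and b: "\<And>l. 0 < l \<Longrightarrow> 0 < b l"
    and cross: "\<And>l m. 0 < l \<Longrightarrow> 0 < m \<Longrightarrow> (a l)\<^sup>2 + l * (b l)\<^sup>2 \<le> a l * a m + l * (b l * b m)"
    and unb: "\<And>e. 0 < e \<Longrightarrow> \<exists>M. \<forall>l>0. 1 \<le> e * a l + M * b l"
  shows "\<exists>l>0. \<delta> * l * b l = a l"
proof -
  define E where "E l = (a l)\<^sup>2 + l * (b l)\<^sup>2" for l
  define \<Psi> where "\<Psi> l = (\<delta>\<^sup>2 + 1 / l) * E l" for l
  have E_min: "E l \<le> (a m)\<^sup>2 + l * (b m)\<^sup>2" if "0 < l" "0 < m" for l m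
  proof -
    have "2 * (a l * a m) \<le> (a l)\<^sup>2 + (a m)\<^sup>2" using sum_squares_bound[of "a l" "a m"] by (simp add: mult.assoc)
    moreover have "2 * (l * (b l * b m)) \<le> l * ((b l)\<^sup>2 + (b m)\<^sup>2)"
    proof -
      have "l * (2 * (b l * b m)) \<le> l * ((b l)\<^sup>2 + (b m)\<^sup>2)"
        using sum_squares_bound[of "b l" "b m"] that by (intro mult_left_mono) (auto simp: mult.assoc)
      then show ?thesis by simp
    qed
    ultimately show ?thesis using cross[OF that] unfolding E_def by (simp add: distrib_left)
  qed
  then have E_concave: "E l \<le> E m + (l - m) * (b m)\<^sup>2" if "0 < l" "0 < m" for l m
    using E_min[OF that] by (simp add: E_def algebra_simps)
  have E_mono: "E l \<le> E m" if "0 < l" "l \<le> m" for l m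
  proof -
    have "(l - m) * (b m)\<^sup>2 \<le> 0" using that by (simp add: mult_nonpos_nonneg)
    then show ?thesis using E_concave[of l m] that by linarith
  qed
  have E_pos: "c0\<^sup>2 \<le> E l" if "0 < l" for l
  proof -
    have "c0\<^sup>2 \<le> (a l)\<^sup>2" using a[OF that] c0 by (intro power_mono) auto
    moreover have "0 \<le> l * (b l)\<^sup>2" using that by simp
    ultimately show ?thesis by (simp add: E_def)
  qed
  have E_nonneg: "0 \<le> E l" if "0 < l" for l
    using E_pos[OF that] zero_le_power2[of c0] by linarith
  \<comment> \<open>On an interval away from 0 the slopes of the affine majorants are bounded,
    because \<open>E\<close> is monotone; hence \<open>E\<close> is Lipschitz there.\<close>
  have E_cont: "continuous_on {l..h} E" if lh: "0 < l" "l \<le> h" for l h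
  proof -
    define C where "C = E h / l"
    have bC: "(b x)\<^sup>2 \<le> C" if "x \<in> {l..h}" for x
    proof -
      have "l * (b x)\<^sup>2 \<le> x * (b x)\<^sup>2" using that by (intro mult_right_mono) auto
      also have "\<dots> \<le> E x" by (simp add: E_def)
      also have "\<dots> \<le> E h" using that lh by (intro E_mono) auto
      finally show ?thesis using lh by (simp add: C_def field_simps)
    qed
    have one: "E x - E y \<le> C * \<bar>x - y\<bar>" if "x \<in> {l..h}" "y \<in> {l..h}" for x y
    proof -
      have "E x - E y \<le> (x - y) * (b y)\<^sup>2" using E_concave[of x y] that lh by simp
      also have "\<dots> \<le> \<bar>x - y\<bar> * (b y)\<^sup>2" by (intro mult_right_mono) auto
      also have "\<dots> \<le> \<bar>x - y\<bar> * C" using bC[OF that(2)] by (intro mult_left_mono) auto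
      finally show ?thesis by (simp add: mult.commute)
    qed
    have "C-lipschitz_on {l..h} E"
    proof (rule lipschitz_onI)
      show "dist (E x) (E y) \<le> C * dist x y" if "x \<in> {l..h}" "y \<in> {l..h}" for x y
        using one[OF that] one[OF that(2) that(1)] by (simp add: dist_real_def abs_minus_commute abs_le_iff)
      show "0 \<le> C" using E_nonneg[of h] lh by (simp add: C_def)
    qed
    then show ?thesis by (rule lipschitz_on_continuous_on)
  qed
  \<comment> \<open>At or beyond the end points of \<open>{l0..h}\<close> the function
    \<open>\<Psi>\<close> is at least its value \<open>P\<close> at 1. This compact interval
    contains 1, so the minimum over it is global.\<close>
  define P where "P = \<Psi> 1"
  have P: "0 < P" unfolding P_def \<Psi>_def using E_pos[of 1] c0 \<delta>
    by (intro mult_pos_pos add_pos_pos) (auto intro: less_le_trans[of 0 "c0\<^sup>2"])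
  define l0 where "l0 = min 1 (c0\<^sup>2 / P)"
  have l0: "0 < l0" "l0 \<le> 1" using c0 P by (auto simp: l0_def)
  have small: "P \<le> \<Psi> l" if "0 < l" "l \<le> l0" for l
  proof -
    have "l * P \<le> c0\<^sup>2"
    proof -
      have "l * P \<le> (c0\<^sup>2 / P) * P" using that P by (intro mult_right_mono) (auto simp: l0_def)
      then show ?thesis using P by simp
    qed
    then have "P \<le> 1 / l * c0\<^sup>2" using that by (simp add: field_simps)
    also have "\<dots> \<le> 1 / l * E l" using E_pos[of l] that by (intro mult_left_mono) auto
    also have "\<dots> \<le> \<Psi> l" unfolding \<Psi>_def using E_nonneg[of l] that
      by (intro mult_right_mono) auto
    finally show ?thesis .
  qed
  \<comment> \<open>With \<open>2 * e\<^sup>2 * P = \<delta>\<^sup>2\<close>, the estimate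
    \<open>1 \<le> 2 * e\<^sup>2 * E l\<close> for large \<open>l\<close> becomes
    \<open>P \<le> \<delta>\<^sup>2 * E l\<close>.\<close>
  define e where "e = \<delta> / sqrt (2 * P)"
  have e: "0 < e" using \<delta> P by (simp add: e_def)
  have e2: "e\<^sup>2 * (2 * P) = \<delta>\<^sup>2" using P by (simp add: e_def power_divide)
  obtain M where M: "\<And>l. 0 < l \<Longrightarrow> 1 \<le> e * a l + M * b l" using unb[OF e] by blast
  \<comment> \<open>From \<open>h\<close> on, \<open>M\<^sup>2 \<le> e\<^sup>2 * l\<close>, so the
    term with \<open>M\<close> is absorbed by \<open>l * (b l)\<^sup>2\<close>.\<close>
  define h where "h = max 1 ((M / e)\<^sup>2)"
  have large: "P \<le> \<Psi> l" if "h \<le> l" for l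
  proof -
    have l: "1 \<le> l" "(M / e)\<^sup>2 \<le> l" using that by (auto simp: h_def)
    have Ml: "M\<^sup>2 \<le> e\<^sup>2 * l" using l(2) e by (simp add: power_divide field_simps)
    have "1 \<le> (e * a l + M * b l)\<^sup>2" using M[of l] l by simp
    also have "\<dots> \<le> 2 * (e * a l)\<^sup>2 + 2 * (M * b l)\<^sup>2"
      using sum_squares_bound[of "e * a l" "M * b l"] by (simp add: power2_sum)
    also have "\<dots> = 2 * (e\<^sup>2 * (a l)\<^sup>2 + M\<^sup>2 * (b l)\<^sup>2)" by (simp add: power_mult_distrib)
    also have "\<dots> \<le> 2 * (e\<^sup>2 * (a l)\<^sup>2 + (e\<^sup>2 * l) * (b l)\<^sup>2)"
      using mult_right_mono[OF Ml, of "(b l)\<^sup>2"] by simp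
    also have "\<dots> = 2 * e\<^sup>2 * E l" by (simp add: E_def algebra_simps)
    finally have "P * 1 \<le> P * (2 * e\<^sup>2 * E l)" using P by (intro mult_left_mono) auto
    also have "\<dots> = \<delta>\<^sup>2 * E l" unfolding e2[symmetric] by simp
    also have "\<dots> \<le> \<Psi> l" unfolding \<Psi>_def using E_nonneg[of l] l
      by (intro mult_right_mono) auto
    finally show ?thesis by simp
  qed
  have h: "1 \<le> h" by (simp add: h_def)
  have "continuous_on {l0..h} \<Psi>"
    unfolding \<Psi>_def using l0 h by (intro continuous_intros E_cont) auto
  then obtain l where l: "l \<in> {l0..h}" and lmin: "\<And>y. y \<in> {l0..h} \<Longrightarrow> \<Psi> l \<le> \<Psi> y"
    using continuous_attains_inf[of "{l0..h}" \<Psi>] l0 h by auto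
  have l_pos: "0 < l" using l l0 by simp
  have "\<Psi> l \<le> P" unfolding P_def using lmin[of 1] l0 h by simp
  then have \<Psi>_min: "\<Psi> l \<le> \<Psi> y" if "0 < y" for y
    using small[OF that] large[of y] lmin[of y] by (cases "y \<le> l0"; cases "h \<le> y") auto
  text \<open>
    \<open>\<Psi>\<close> lies below \<open>\<mu> \<mapsto> (\<delta>\<^sup>2 + 1/\<mu>) ((a l)\<^sup>2 + \<mu> (b l)\<^sup>2)\<close> and touches it at \<open>l\<close>. So \<open>l\<close> is a minimum point of
    the latter function as well, whose only minimum point is \<open>a l / (\<delta> b l)\<close>.
  \<close>
  define y where "y = a l / (\<delta> * b l)"
  have al: "0 < a l" and bl: "0 < b l" using a[OF l_pos] b[OF l_pos] c0 by auto
  have y: "0 < y" using al bl \<delta> by (simp add: y_def)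
  have exp: "(\<delta>\<^sup>2 + 1 / m) * ((a l)\<^sup>2 + m * (b l)\<^sup>2) = \<delta>\<^sup>2 * (a l)\<^sup>2 + (b l)\<^sup>2 + (\<delta>\<^sup>2 * (b l)\<^sup>2 * m + (a l)\<^sup>2 / m)"
    if "0 < m" for m using that by (simp add: field_simps)
  have "\<Psi> l \<le> (\<delta>\<^sup>2 + 1 / y) * ((a l)\<^sup>2 + y * (b l)\<^sup>2)"
    using \<Psi>_min[OF y] E_min[OF y l_pos] y unfolding \<Psi>_def
    by (elim order_trans) (intro mult_left_mono, auto)
  then have "\<delta>\<^sup>2 * (b l)\<^sup>2 * l + (a l)\<^sup>2 / l \<le> \<delta>\<^sup>2 * (b l)\<^sup>2 * y + (a l)\<^sup>2 / y"
    unfolding \<Psi>_def E_def exp[OF l_pos] exp[OF y] by linarith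
  also have "\<dots> = 2 * (\<delta> * a l * b l)"
    using al bl \<delta> by (simp add: y_def power2_eq_square field_simps)
  finally have "(\<delta>\<^sup>2 * (b l)\<^sup>2 * l + (a l)\<^sup>2 / l) * l \<le> 2 * (\<delta> * a l * b l) * l"
    using l_pos by (intro mult_right_mono) auto
  then have "\<delta>\<^sup>2 * (b l)\<^sup>2 * l * l + (a l)\<^sup>2 \<le> 2 * (\<delta> * a l * b l) * l"
    using l_pos by (simp add: distrib_right)
  \<comment> \<open>The value at \<open>y\<close> is the lower bound given by the
    arithmetic-geometric mean inequality; attaining it at \<open>l\<close> means that a perfect
    square vanishes.\<close>
  then have "(\<delta> * l * b l - a l)\<^sup>2 \<le> 0"
    by (simp add: power2_eq_square algebra_simps)
  then have "\<delta> * l * b l = a l" by simp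
  then show ?thesis using l_pos by blast
qed

section \<open>Norms of the solutions and the balanced parameter\<close>

text \<open>Cauchy-Schwarz in both terms of the representation. Since \<open>lam\<close> is free,
  one test function \<open>f\<close> constrains the norms for all parameters at once.\<close>

lemma nderiv_bound:
  assumes r: "0 < r" and k: "k < r" and lam: "0 < lam" and f: "f \<in> L2_sobolev r"
  shows "\<bar>nderiv k f (-1)\<bar> \<le> norm2 (nderiv r (bvp_sol r k lam)) * norm2 f + norm2 (bvp_sol r k lam) * norm2 (nderiv r f)"
proof -
  have "\<bar>inner2 (nderiv r (bvp_sol r k lam)) f\<bar> \<le> norm2 (nderiv r (bvp_sol r k lam)) * norm2 f"
    by (intro abs_inner2_le_norm2 bvp_sol_L2[OF r lam] L2_sobolev_imp_L2(1)[OF f r])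
  moreover have "\<bar>inner2 (bvp_sol r k lam) (nderiv r f)\<bar> \<le> norm2 (bvp_sol r k lam) * norm2 (nderiv r f)"
    by (intro abs_inner2_le_norm2 bvp_sol_L2[OF r lam, of 0, simplified] L2_sobolev_imp_L2(2)[OF f r])
  then have "\<bar>(-1) ^ r * inner2 (bvp_sol r k lam) (nderiv r f)\<bar> \<le> norm2 (bvp_sol r k lam) * norm2 (nderiv r f)"
    by (simp add: abs_mult power_abs)
  ultimately show ?thesis unfolding bvp_sol_representation[OF r k lam f] by linarith
qed

text \<open>Both sides are the value of the functional at \<open>?g\<close>, represented once with
  \<open>mu\<close> and once with \<open>lam\<close>.\<close>

lemma bvp_sol_cross:
  assumes r: "0 < r" and k: "k < r" and lam: "0 < lam" and mu: "0 < mu"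
  shows "inner2 (nderiv r (bvp_sol r k mu)) (nderiv r (bvp_sol r k lam)) + lam * inner2 (bvp_sol r k mu) (bvp_sol r k lam) =
    (norm2 (nderiv r (bvp_sol r k lam)))\<^sup>2 + lam * (norm2 (bvp_sol r k lam))\<^sup>2"
proof -
  let ?g = "nderiv r (bvp_sol r k lam)"
  have g: "?g \<in> L2_sobolev r" using bvp_sol_nderiv_L2_sobolev(1)[OF r lam, of 1 k] by simp
  have gr: "nderiv r ?g x = - ((-1) ^ r * lam) * bvp_sol r k lam x" if "x \<in> \<II>" for x
    using bvp_sol_nderiv_L2_sobolev(2)[OF r lam that, of 1 k] by simp
  have "nderiv k ?g (-1) = inner2 (nderiv r (bvp_sol r k m)) ?g + lam * inner2 (bvp_sol r k m) (bvp_sol r k lam)"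
    if m: "0 < m" for m
  proof -
    have "inner2 (bvp_sol r k m) (nderiv r ?g) = inner2 (bvp_sol r k m) (\<lambda>x. - ((-1) ^ r * lam) * bvp_sol r k lam x)"
      by (rule inner2_cong) (use gr in auto)
    also have "\<dots> = - ((-1) ^ r * (lam * inner2 (bvp_sol r k m) (bvp_sol r k lam)))"
      unfolding inner2_cmult_right by simp
    finally show ?thesis
      unfolding bvp_sol_representation[OF r k m g] by (simp add: neg_one_power_mult_cancel)
  qed
  from this[OF mu] this[OF lam] show ?thesis unfolding norm2_power2 by simp
qed

text \<open>A function on which the functional is 1 and whose derivative of order \<open>r\<close>
  vanishes leaves only the first term of \<open>nderiv_bound\<close>.\<close>

lemma norm2_nderiv_bvp_sol_lower_bound:
  assumes r: "0 < r" and k: "k < r"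
  obtains c where "0 < c" "\<And>lam. 0 < lam \<Longrightarrow> c \<le> norm2 (nderiv r (bvp_sol r k lam))"
proof -
  obtain p where p: "p \<in> L2_sobolev r" "nderiv k p (-1) = 1" "\<And>x. x \<in> \<II> \<Longrightarrow> nderiv r p x = 0"
    using shifted_monomial_L2_sobolev[OF k] by blast
  have "norm2 (nderiv r p) = norm2 (\<lambda>x. 0)" by (rule norm2_cong) (use p(3) in simp)
  then have p0: "norm2 (nderiv r p) = 0" by (simp add: norm2_def)
  have le: "1 \<le> norm2 (nderiv r (bvp_sol r k lam)) * norm2 p" if "0 < lam" for lam
    using nderiv_bound[OF r k that p(1)] p(2) p0 by simp
  have "norm2 p \<noteq> 0" using le[of 1] by auto
  then have "0 < norm2 p" using norm2_nonneg[of p] by simp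
  then show thesis using that[of "1 / norm2 p"] le by (simp add: field_simps)
qed

text \<open>If the norm were 0, \<open>nderiv_bound\<close> would bound the functional by a multiple
  of \<open>norm2 f\<close> alone.\<close>

lemma norm2_bvp_sol_pos:
  assumes r: "0 < r" and k: "k < r" and lam: "0 < lam"
  shows "0 < norm2 (bvp_sol r k lam)"
proof -
  let ?a = "norm2 (nderiv r (bvp_sol r k lam))"
  have a: "0 < ?a"
  proof (rule norm2_nderiv_bvp_sol_lower_bound[OF r k])
    fix c assume "0 < c" and c: "\<And>lam. 0 < lam \<Longrightarrow> c \<le> norm2 (nderiv r (bvp_sol r k lam))"
    then show "0 < ?a" using c[OF lam] by linarith
  qed
  obtain f where f: "f \<in> L2_sobolev r" "nderiv k f (-1) = 1" "norm2 f \<le> 1 / (2 * ?a)"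
    using nderiv_unbounded_L2[OF r, of "1 / (2 * ?a)" k] a by auto
  have "?a * norm2 f \<le> ?a * (1 / (2 * ?a))" using f(3) a by (intro mult_left_mono) auto
  also have "\<dots> = 1 / 2" using a by simp
  finally have "?a * norm2 f \<le> 1 / 2" .
  then have "1 / 2 \<le> norm2 (bvp_sol r k lam) * norm2 (nderiv r f)"
    using nderiv_bound[OF r k lam f(1)] f(2) by simp
  then have "norm2 (bvp_sol r k lam) \<noteq> 0" by auto
  then show ?thesis using norm2_nonneg[of "bvp_sol r k lam"] by simp
qed

lemma balanced_parameter_exists:
  assumes r: "0 < r" and k: "k < r" and \<delta>: "0 < \<delta>"
  shows "\<exists>lam>0. \<delta> * lam * norm2 (bvp_sol r k lam) = norm2 (nderiv r (bvp_sol r k lam))"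
proof -
  obtain c where c: "0 < c" "\<And>lam. 0 < lam \<Longrightarrow> c \<le> norm2 (nderiv r (bvp_sol r k lam))"
    using norm2_nderiv_bvp_sol_lower_bound[OF r k] by blast
  show ?thesis
  proof (rule exists_balanced_parameter[OF \<delta> c norm2_bvp_sol_pos[OF r k]])
    fix l m :: real assume l: "0 < l" and m: "0 < m"
    let ?a = "\<lambda>l. norm2 (nderiv r (bvp_sol r k l))" and ?b = "\<lambda>l. norm2 (bvp_sol r k l)"
    have "inner2 (nderiv r (bvp_sol r k m)) (nderiv r (bvp_sol r k l)) \<le> ?a m * ?a l"
      by (intro inner2_le_norm2 bvp_sol_L2[OF r] l m)
    moreover have "inner2 (bvp_sol r k m) (bvp_sol r k l) \<le> ?b m * ?b l"
      using bvp_sol_L2[OF r, of _ 0] l m by (intro inner2_le_norm2) auto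
    then have "l * inner2 (bvp_sol r k m) (bvp_sol r k l) \<le> l * (?b m * ?b l)"
      using l by (intro mult_left_mono) auto
    ultimately show "(?a l)\<^sup>2 + l * (?b l)\<^sup>2 \<le> ?a l * ?a m + l * (?b l * ?b m)"
      using bvp_sol_cross[OF r k l m] by (simp add: mult.commute)
  next
    fix e :: real assume e: "0 < e"
    \<comment> \<open>One \<open>f\<close> of norm at most \<open>e\<close> serves for all
      parameters; the constant \<open>M\<close> is the norm of its derivative of order
      \<open>r\<close>.\<close>
    obtain f where f: "f \<in> L2_sobolev r" "nderiv k f (-1) = 1" "norm2 f \<le> e"
      using nderiv_unbounded_L2[OF r e, of k] by blast
    show "\<exists>M. \<forall>l>0. 1 \<le> e * norm2 (nderiv r (bvp_sol r k l)) + M * norm2 (bvp_sol r k l)"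
    proof (intro exI[of _ "norm2 (nderiv r f)"] allI impI)
      fix l :: real assume l: "0 < l"
      have "norm2 (nderiv r (bvp_sol r k l)) * norm2 f \<le> norm2 (nderiv r (bvp_sol r k l)) * e"
        using f(3) norm2_nonneg by (rule mult_left_mono)
      then show "1 \<le> e * norm2 (nderiv r (bvp_sol r k l)) + norm2 (nderiv r f) * norm2 (bvp_sol r k l)"
        using nderiv_bound[OF r k l f(1)] f(2) by (simp add: mult.commute)
    qed
  qed
qed

text \<open>Balance makes the two sides of the cross inequality multiples of \<open>X l\<close> and
  \<open>X m\<close> by the same positive factor, so \<open>X l \<le> X m\<close>, and equality
  follows by symmetry. Then Cauchy-Schwarz is an equality for the derivatives of order
  \<open>r\<close>, and a common test function equates their norms.\<close>

lemma balanced_parameter_unique: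
  assumes r: "0 < r" and k: "k < r" and \<delta>: "0 < \<delta>" and l: "0 < l" and m: "0 < m"
    and lb: "\<delta> * l * norm2 (bvp_sol r k l) = norm2 (nderiv r (bvp_sol r k l))"
    and mb: "\<delta> * m * norm2 (bvp_sol r k m) = norm2 (nderiv r (bvp_sol r k m))"
  shows "l = m"
proof -
  define a where "a l = norm2 (nderiv r (bvp_sol r k l))" for l
  define b where "b l = norm2 (bvp_sol r k l)" for l
  define i where "i = inner2 (nderiv r (bvp_sol r k l)) (nderiv r (bvp_sol r k m))"
  define j where "j = inner2 (bvp_sol r k l) (bvp_sol r k m)"
  have i: "i \<le> a l * a m" unfolding i_def a_def by (intro inner2_le_norm2 bvp_sol_L2[OF r] l m)
  have j: "j \<le> b l * b m" unfolding j_def b_def using bvp_sol_L2[OF r, of _ 0] l m by (intro inner2_le_norm2) auto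
  have bpos: "0 < b l" "0 < b m" unfolding b_def using norm2_bvp_sol_pos[OF r k] l m by auto
  have al: "a l = \<delta> * l * b l" and am: "a m = \<delta> * m * b m" using lb mb by (auto simp: a_def b_def)
  have cl: "i + l * j = (a l)\<^sup>2 + l * (b l)\<^sup>2"
    using bvp_sol_cross[OF r k l m] unfolding i_def j_def a_def b_def
    by (simp add: inner2_commute)
  have cm: "i + m * j = (a m)\<^sup>2 + m * (b m)\<^sup>2"
    using bvp_sol_cross[OF r k m l] unfolding i_def j_def a_def b_def by simp
  \<comment> \<open>At a balanced parameter this is the value claimed for the modulus of
    continuity.\<close>
  define X where "X l = b l + \<delta> * a l" for l
  have Xl: "(a l)\<^sup>2 + l * (b l)\<^sup>2 = l * b l * X l" "a l * a m + l * (b l * b m) = l * b l * X m"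
    unfolding X_def al by (simp_all add: power2_eq_square algebra_simps)
  have Xm: "(a m)\<^sup>2 + m * (b m)\<^sup>2 = m * b m * X m" "a l * a m + m * (b l * b m) = m * b m * X l"
    unfolding X_def am by (simp_all add: power2_eq_square algebra_simps)
  have lj: "l * j \<le> l * (b l * b m)" and mj: "m * j \<le> m * (b l * b m)"
    using j l m by (auto intro: mult_left_mono)
  have "l * b l * X l \<le> l * b l * X m" using cl i lj unfolding Xl[symmetric] by linarith
  then have "X l \<le> X m" using l bpos by (simp add: mult_le_cancel_left_pos)
  moreover have "m * b m * X m \<le> m * b m * X l" using cm i mj unfolding Xm[symmetric] by linarith
  then have "X m \<le> X l" using m bpos by (simp add: mult_le_cancel_left_pos)
  ultimately have X: "X l = X m" by simp
  then have "i + l * j = a l * a m + l * (b l * b m)" unfolding cl Xl by simp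
  then have ieq: "i = a l * a m" using i lj by linarith
  \<comment> \<open>\<open>p\<close> pairs to 1 with the derivative of order \<open>r\<close> of the
    solution for every parameter; parallel functions with this property have equal norms.\<close>
  obtain p where p: "p \<in> L2_sobolev r" "nderiv k p (-1) = 1" "\<And>x. x \<in> \<II> \<Longrightarrow> nderiv r p x = 0"
    using shifted_monomial_L2_sobolev[OF k] by blast
  have ip: "inner2 (nderiv r (bvp_sol r k z)) p = 1" if "0 < z" for z
  proof -
    have "inner2 (bvp_sol r k z) (nderiv r p) = inner2 (bvp_sol r k z) (\<lambda>x. 0)"
      by (rule inner2_cong) (use p(3) in auto)
    then show ?thesis using bvp_sol_representation[OF r k that p(1)] p(2) by (simp add: inner2_def)
  qed
  have "a l * inner2 (nderiv r (bvp_sol r k m)) p = a m * inner2 (nderiv r (bvp_sol r k l)) p"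
    unfolding a_def
    by (rule inner2_eq_norm2_imp_parallel[OF bvp_sol_L2[OF r l] bvp_sol_L2[OF r m] L2_sobolev_imp_L2(1)[OF p(1) r]
        ieq[unfolded i_def a_def]])
  then have "a l = a m" using ip l m by simp
  then have "b l = b m" using X unfolding X_def by simp
  then have "\<delta> * b l * l = \<delta> * b l * m" using \<open>a l = a m\<close> unfolding al am by (simp add: mult_ac)
  then show ?thesis using \<delta> bpos by simp
qed

section \<open>The modulus of continuity and optimal recovery\<close>

text \<open>The factor \<open>c\<close> gives the derivative of order \<open>r\<close> norm 1, and
  balance then gives the function itself norm \<delta>. The two signs \<sigma> provide the pair of
  opposite values used against an arbitrary recovery map.\<close>

lemma extremal_function:
  assumes r: "0 < r" and k: "k < r" and \<delta>: "0 < \<delta>" and lam: "0 < lam" and \<sigma>: "\<bar>\<sigma>\<bar> = 1"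
    and bal: "\<delta> * lam * norm2 (bvp_sol r k lam) = norm2 (nderiv r (bvp_sol r k lam))"
  obtains f where "f \<in> W2 r" "norm2 f = \<delta>"
    "nderiv k f (-1) = \<sigma> * (norm2 (nderiv r (bvp_sol r k lam)) * \<delta> + norm2 (bvp_sol r k lam))"
proof -
  let ?u = "bvp_sol r k lam" and ?g = "nderiv r (bvp_sol r k lam)"
  have b: "0 < norm2 ?u" by (rule norm2_bvp_sol_pos[OF r k lam])
  define c where "c = \<sigma> / (lam * norm2 ?u)"
  let ?f = "\<lambda>x. c * ?g x"
  have f: "?f \<in> L2_sobolev r" by (rule bvp_sol_nderiv_L2_sobolev(1)[OF r lam])
  have fr: "nderiv r ?f x = - ((-1) ^ r * (c * lam)) * ?u x" if "x \<in> \<II>" for x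
    by (rule bvp_sol_nderiv_L2_sobolev(2)[OF r lam that])
  have "norm2 (nderiv r ?f) = norm2 (\<lambda>x. - ((-1) ^ r * (c * lam)) * ?u x)" by (rule norm2_cong) (rule fr)
  also have "\<dots> = \<bar>c\<bar> * lam * norm2 ?u" unfolding norm2_cmult using lam by (simp add: abs_mult power_abs)
  also have "\<dots> = 1" using b lam \<sigma> by (simp add: c_def abs_mult)
  finally have "?f \<in> W2 r" using f by (simp add: W2_def)
  moreover have "norm2 ?f = \<delta>"
    unfolding norm2_cmult bal[symmetric] using b lam \<sigma> by (simp add: c_def abs_mult)
  moreover have "nderiv k ?f (-1) = \<sigma> * (norm2 ?g * \<delta> + norm2 ?u)"
  proof -
    have "inner2 ?u (nderiv r ?f) = inner2 ?u (\<lambda>x. - ((-1) ^ r * (c * lam)) * ?u x)"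
      by (rule inner2_cong) (use fr in auto)
    also have "\<dots> = - ((-1) ^ r * (c * lam * (norm2 ?u)\<^sup>2))"
      unfolding inner2_cmult_right norm2_power2 by simp
    finally have "nderiv k ?f (-1) = c * (norm2 ?g)\<^sup>2 + c * lam * (norm2 ?u)\<^sup>2"
      unfolding bvp_sol_representation[OF r k lam f] inner2_cmult_right norm2_power2
      by (simp add: neg_one_power_mult_cancel)
    also have "c * (norm2 ?g)\<^sup>2 = \<sigma> * (norm2 ?g * \<delta>)"
      using b lam unfolding c_def power2_eq_square by (subst (2) bal[symmetric]) (simp add: field_simps)
    also have "c * lam * (norm2 ?u)\<^sup>2 = \<sigma> * norm2 ?u"
      using b lam by (simp add: c_def power2_eq_square)
    finally show ?thesis by (simp add: distrib_left)
  qed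
  ultimately show thesis by (rule that)
qed

lemma inner2_in_linear_maps:
  assumes g: "g \<in> L2"
  shows "inner2 g \<in> linear_maps"
proof -
  have ae: "inner2 g f = inner2 g h" if fh: "f \<in> L2" "h \<in> L2" "AE x in lebesgue_on \<II>. f x = h x" for f h
    unfolding inner2_def
  proof (rule integral_cong_AE)
    show "AE x in lebesgue_on \<II>. g x * f x = g x * h x" using fh(3) by eventually_elim simp
  qed (use L2D(1)[OF g] L2D(1)[OF fh(1)] L2D(1)[OF fh(2)] in measurable)
  show ?thesis
    unfolding linear_maps_def all_maps_def
    by (intro CollectI conjI ballI allI impI)
      (rule ae inner2_add_right[OF g] inner2_cmult_right; assumption)+
qed

text \<open>\<open>nderiv_bound\<close> gives the upper estimate, and
  \<open>extremal_function\<close> attains it.\<close>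

lemma modulus_eq:
  assumes r: "0 < r" and k: "k < r" and \<delta>: "0 < \<delta>" and lam: "0 < lam"
    and bal: "\<delta> * lam * norm2 (bvp_sol r k lam) = norm2 (nderiv r (bvp_sol r k lam))"
  shows "modulus r k \<delta> = ereal (norm2 (nderiv r (bvp_sol r k lam)) * \<delta> + norm2 (bvp_sol r k lam))" (is "_ = ereal ?V")
  unfolding modulus_def
proof (rule antisym)
  show "(SUP f\<in>{f \<in> W2 r. norm2 f \<le> \<delta>}. ereal \<bar>nderiv k f (-1)\<bar>) \<le> ereal ?V"
  proof (rule SUP_least)
    fix f assume "f \<in> {f \<in> W2 r. norm2 f \<le> \<delta>}"
    then have f: "f \<in> L2_sobolev r" "norm2 (nderiv r f) \<le> 1" "norm2 f \<le> \<delta>" by (auto simp: W2_def)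
    have "\<bar>nderiv k f (-1)\<bar> \<le> norm2 (nderiv r (bvp_sol r k lam)) * norm2 f + norm2 (bvp_sol r k lam) * norm2 (nderiv r f)"
      by (rule nderiv_bound[OF r k lam f(1)])
    also have "\<dots> \<le> norm2 (nderiv r (bvp_sol r k lam)) * \<delta> + norm2 (bvp_sol r k lam) * 1"
      using f(2,3) by (intro add_mono mult_left_mono norm2_nonneg)
    finally show "ereal \<bar>nderiv k f (-1)\<bar> \<le> ereal ?V" by simp
  qed
  obtain f where f: "f \<in> W2 r" "norm2 f = \<delta>" "nderiv k f (-1) = 1 * ?V"
    using extremal_function[OF r k \<delta> lam _ bal, of 1] by auto
  then show "ereal ?V \<le> (SUP f\<in>{f \<in> W2 r. norm2 f \<le> \<delta>}. ereal \<bar>nderiv k f (-1)\<bar>)"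
    by (intro SUP_upper2[of f]) auto
qed

text \<open>The upper bound comes from the linear map \<open>inner2 ?g\<close>, and the lower bound
  holds for every map; hence both classes of maps have the same error.\<close>

lemma recovery_error_eq:
  assumes r: "0 < r" and k: "k < r" and \<delta>: "0 < \<delta>" and lam: "0 < lam"
    and bal: "\<delta> * lam * norm2 (bvp_sol r k lam) = norm2 (nderiv r (bvp_sol r k lam))"
    and R: "linear_maps \<subseteq> R"
  shows "recovery_error R r k \<delta> = ereal (norm2 (nderiv r (bvp_sol r k lam)) * \<delta> + norm2 (bvp_sol r k lam))" (is "_ = ereal ?V")
  unfolding recovery_error_def
proof (rule antisym)
  let ?A = "{(f, g). f \<in> W2 r \<and> g \<in> L2 \<and> norm2 (\<lambda>x. f x - g x) \<le> \<delta>}"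
  let ?u = "bvp_sol r k lam" and ?g = "nderiv r (bvp_sol r k lam)"
  have u: "?u \<in> L2" and g: "?g \<in> L2" using bvp_sol_L2[OF r lam, of 0 k] bvp_sol_L2[OF r lam, of r k] by auto
  show "(INF S\<in>R. SUP (f, g)\<in>?A. ereal \<bar>nderiv k f (-1) - S g\<bar>) \<le> ereal ?V"
  proof (rule INF_lower2[of "inner2 ?g"])
    show "inner2 ?g \<in> R" using inner2_in_linear_maps[OF g] R by blast
    show "(SUP (f, g)\<in>?A. ereal \<bar>nderiv k f (-1) - inner2 ?g g\<bar>) \<le> ereal ?V"
    proof (rule SUP_least)
      fix z assume "z \<in> ?A"
      then obtain f h where z: "z = (f, h)" "f \<in> W2 r" "h \<in> L2" "norm2 (\<lambda>x. f x - h x) \<le> \<delta>" by auto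
      have f: "f \<in> L2_sobolev r" "norm2 (nderiv r f) \<le> 1" using z(2) by (auto simp: W2_def)
      have fL: "f \<in> L2" "nderiv r f \<in> L2" using L2_sobolev_imp_L2[OF f(1) r] by auto
      have "nderiv k f (-1) - inner2 ?g h = inner2 ?g (\<lambda>x. f x - h x) - (-1) ^ r * inner2 ?u (nderiv r f)"
        unfolding bvp_sol_representation[OF r k lam f(1)] inner2_diff_right[OF g fL(1) z(3)] by simp
      moreover have "\<bar>inner2 ?g (\<lambda>x. f x - h x)\<bar> \<le> norm2 ?g * norm2 (\<lambda>x. f x - h x)"
        by (intro abs_inner2_le_norm2 g L2_diff fL z(3))
      moreover have "norm2 ?g * norm2 (\<lambda>x. f x - h x) \<le> norm2 ?g * \<delta>"
        using z(4) norm2_nonneg by (rule mult_left_mono)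
      moreover have "\<bar>(-1) ^ r * inner2 ?u (nderiv r f)\<bar> \<le> norm2 ?u * norm2 (nderiv r f)"
        using abs_inner2_le_norm2[OF u fL(2)] by (simp add: abs_mult power_abs)
      moreover have "norm2 ?u * norm2 (nderiv r f) \<le> norm2 ?u * 1"
        using f(2) norm2_nonneg by (rule mult_left_mono)
      ultimately have "\<bar>nderiv k f (-1) - inner2 ?g h\<bar> \<le> ?V" by linarith
      then show "(case z of (f, h) \<Rightarrow> ereal \<bar>nderiv k f (-1) - inner2 ?g h\<bar>) \<le> ereal ?V" by (simp add: z(1))
    qed
  qed
  show "ereal ?V \<le> (INF S\<in>R. SUP (f, g)\<in>?A. ereal \<bar>nderiv k f (-1) - S g\<bar>)"
  proof (rule INF_greatest)
    fix S :: "(real \<Rightarrow> real) \<Rightarrow> real"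
    let ?z = "(\<lambda>x. 0) :: real \<Rightarrow> real"
    obtain f1 where f1: "f1 \<in> W2 r" "norm2 f1 = \<delta>" "nderiv k f1 (-1) = 1 * ?V"
      using extremal_function[OF r k \<delta> lam _ bal, of 1] by auto
    obtain f2 where f2: "f2 \<in> W2 r" "norm2 f2 = \<delta>" "nderiv k f2 (-1) = -1 * ?V"
      using extremal_function[OF r k \<delta> lam _ bal, of "-1"] by auto
    \<comment> \<open>The observation 0 is compatible with both functions, because their norm is
      \<delta>.\<close>
    have in': "(f1, ?z) \<in> ?A" "(f2, ?z) \<in> ?A" using f1 f2 L2_zero by auto
    have sup: "ereal \<bar>nderiv k f (-1) - S ?z\<bar> \<le> (SUP (f, g)\<in>?A. ereal \<bar>nderiv k f (-1) - S g\<bar>)" if "(f, ?z) \<in> ?A" for f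
      using that by (intro SUP_upper2[OF that]) simp
    \<comment> \<open>The functional takes the values \<open>?V\<close> and \<open>- ?V\<close> at
      \<open>f1\<close> and \<open>f2\<close>, so the single number \<open>S ?z\<close> cannot be
      closer than \<open>?V\<close> to both.\<close>
    have "?V \<le> \<bar>nderiv k f1 (-1) - S ?z\<bar> \<or> ?V \<le> \<bar>nderiv k f2 (-1) - S ?z\<bar>"
    proof -
      have "v \<le> \<bar>1 * v - s\<bar> \<or> v \<le> \<bar>-1 * v - s\<bar>" for v s :: real by (cases "s \<le> 0") auto
      then show ?thesis unfolding f1(3) f2(3) .
    qed
    then show "ereal ?V \<le> (SUP (f, g)\<in>?A. ereal \<bar>nderiv k f (-1) - S g\<bar>)"
    proof
      assume "?V \<le> \<bar>nderiv k f1 (-1) - S ?z\<bar>"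
      then have "ereal ?V \<le> ereal \<bar>nderiv k f1 (-1) - S ?z\<bar>" by simp
      then show ?thesis using sup[OF in'(1)] by (rule order_trans)
    next
      assume "?V \<le> \<bar>nderiv k f2 (-1) - S ?z\<bar>"
      then have "ereal ?V \<le> ereal \<bar>nderiv k f2 (-1) - S ?z\<bar>" by simp
      then show ?thesis using sup[OF in'(2)] by (rule order_trans)
    qed
  qed
qed

theorem theorem1:
  fixes r k :: nat and R :: "((real \<Rightarrow> real) \<Rightarrow> real) set" and \<delta> :: real
  assumes "1 \<le> r" and "k \<le> r - 1"
    and "R = all_maps \<or> R = linear_maps"
    and "\<delta> > 0"
  shows "(\<exists>!lam. lam > 0 \<and>
            \<delta> * lam * norm2 (bvp_sol r k lam) = norm2 (nderiv r (bvp_sol r k lam))) \<and>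
         (\<forall>lam. lam > 0 \<and>
            \<delta> * lam * norm2 (bvp_sol r k lam) = norm2 (nderiv r (bvp_sol r k lam)) \<longrightarrow>
            modulus r k \<delta> = recovery_error R r k \<delta> \<and>
            recovery_error R r k \<delta> =
              ereal (norm2 (nderiv r (bvp_sol r k lam)) * \<delta> + norm2 (bvp_sol r k lam)))"
proof -
  have r: "0 < r" and k: "k < r" using assms(1,2) by auto
  have R: "linear_maps \<subseteq> R" using assms(3) by (auto simp: linear_maps_def)
  show ?thesis
  proof (intro conjI allI impI)
    show "\<exists>!lam. lam > 0 \<and> \<delta> * lam * norm2 (bvp_sol r k lam) = norm2 (nderiv r (bvp_sol r k lam))"
    proof (rule ex_ex1I)
      show "\<exists>lam. lam > 0 \<and> \<delta> * lam * norm2 (bvp_sol r k lam) = norm2 (nderiv r (bvp_sol r k lam))"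
        by (rule balanced_parameter_exists[OF r k assms(4)])
    qed (elim conjE, rule balanced_parameter_unique[OF r k assms(4)])
  next
    fix lam assume "lam > 0 \<and> \<delta> * lam * norm2 (bvp_sol r k lam) = norm2 (nderiv r (bvp_sol r k lam))"
    then have lam: "lam > 0" and bal: "\<delta> * lam * norm2 (bvp_sol r k lam) = norm2 (nderiv r (bvp_sol r k lam))" by auto
    show "recovery_error R r k \<delta> = ereal (norm2 (nderiv r (bvp_sol r k lam)) * \<delta> + norm2 (bvp_sol r k lam))"
      by (rule recovery_error_eq[OF r k assms(4) lam bal R])
    then show "modulus r k \<delta> = recovery_error R r k \<delta>"
      using modulus_eq[OF r k assms(4) lam bal] by simp
  qed
qed

end
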